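(* (In $\mathbf{ZF}$.) Let $\mathbf{X}$ be a non-empty zero-dimensional $T_1$-space for which the Banaschewski compactification $\beta_0\mathbf{X}$ exists. Then $\mathbf{CMC}$ implies that the topological spaces $\mathbf{Max}(U_{\aleph_0}(\mathbf{X}))$ and $\beta_0\mathbf{X}$ are homeomorphic.
   Context: The base theory is $\mathbf{ZF}$ (the Axiom of Choice is not assumed). $\mathbf{CMC}$ is the statement: for every family $\{A_n:n\in\omega\}$ of non-empty sets there is a function assigning to each $n\in\omega$ a non-empty finite subset of $A_n$. A space is compact if every open cover has a finite subcover, and zero-dimensional if its clopen sets form a base. A compactification of $\mathbf{X}$ is a pair $\langle\alpha\mathbf{X},\alpha\rangle$ with $\alpha\mathbf{X}$ compact and $\alpha:\mathbf{X}\to\alpha\mathbf{X}$ a homeomorphic embedding with dense image. A Banaschewski compactification of a zero-dimensional $T_1$-space $\mathbf{X}$ is a zero-dimensional $T_1$-compactification $\beta_0\mathbf{X}$ such that for every compact zero-dimensional $T_1$-space $\mathbf{K}$ and every continuous $f:\mathbf{X}\to\mathbf{K}$ there is a continuous $\tilde f:\beta_0\mathbf{X}\to\mathbf{K}$ with $\tilde f\circ\beta_0=f$. $C(\mathbf{X})$ is the ring of continuous real functions on $\mathbf{X}$. For $A\subseteq X$, $\mathrm{osc}_A(f)=\sup\{|f(x)-f(y)|:x,y\in A\}$ if $A\neq\emptyset$ and $\mathrm{osc}_\emptyset(f)=0$. $U_{\aleph_0}(\mathbf{X})$ is the subring of $C(\mathbf{X})$ consisting of all $f\in C(\mathbf{X})$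 such that for every real $\varepsilon>0$ there is a countable (equipotent to a subset of $\omega$) family $\mathcal{A}$ of clopen subsets of $\mathbf{X}$ with $\bigcup\mathcal{A}=X$ and $\mathrm{osc}_A(f)\leq\varepsilon$ for every $A\in\mathcal{A}$. For a commutative ring $R$, $\mathbf{Max}(R)$ is the set of all maximal ideals of $R$ with the hull-kernel topology, i.e. the topology with base $\{\{M: M \text{ maximal ideal of } R,\ r\notin M\}: r\in R\}$. *)

theory Defs
  imports "HOL-Algebra.Ideal"
begin

section \<open>Models of ZF\<close>

text \<open>
  Isabelle/HOL itself has a choice operator, so choice principles stated about HOL sets are
  theorems. A ZF theorem is therefore rendered as a statement about an arbitrary model of
  first-order ZF (without choice). Separation and Replacement are restricted to predicates
  given by first-order formulas with parameters; with arbitrary HOL predicates in these schemes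
  the choice operator of HOL would make the Axiom of Choice true in every model.
\<close>

text \<open>Formulas of set theory with de Bruijn indices: \<open>All\<close> binds index 0.\<close>

datatype fm = Mem nat nat | Eq nat nat | Neg fm | Conj fm fm | All fm

primrec sat :: "('a \<Rightarrow> 'a set) \<Rightarrow> (nat \<Rightarrow> 'a) \<Rightarrow> fm \<Rightarrow> bool" where
  "sat els \<rho> (Mem i j) \<longleftrightarrow> \<rho> i \<in> els (\<rho> j)"
| "sat els \<rho> (Eq i j) \<longleftrightarrow> \<rho> i = \<rho> j"
| "sat els \<rho> (Neg p) \<longleftrightarrow> \<not> sat els \<rho> p"
| "sat els \<rho> (Conj p q) \<longleftrightarrow> sat els \<rho> p \<and> sat els \<rho> q"
| "sat els \<rho> (All p) \<longleftrightarrow> (\<forall>x. sat els (case_nat x \<rho>) p)"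

text \<open>
  The elements of a type of class \<open>ZF\<close> are the sets of the model; \<open>x \<in> elts y\<close> is the
  membership relation of the model. In the two schemes \<open>\<rho>\<close> supplies the parameters.
\<close>

class ZF =
  fixes elts :: "'a \<Rightarrow> 'a set"
  assumes ZF_extensionality: "elts x = elts y \<Longrightarrow> x = y"
    and ZF_foundation: "elts x \<noteq> {} \<Longrightarrow> \<exists>y \<in> elts x. elts y \<inter> elts x = {}"
    and ZF_pairing: "\<exists>z. elts z = {x, y}"
    and ZF_union: "\<exists>u. elts u = (\<Union>y \<in> elts x. elts y)"
    and ZF_power: "\<exists>p. elts p = {y. elts y \<subseteq> elts x}"
    and ZF_infinity: "\<exists>w. (\<exists>e \<in> elts w. elts e = {}) \<and>
                          (\<forall>x \<in> elts w. \<exists>s \<in> elts w. elts s = insert x (elts x))"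
    and ZF_separation: "\<exists>b. elts b = {x \<in> elts a. sat elts (case_nat x \<rho>) \<phi>}"
    and ZF_replacement: "(\<forall>x \<in> elts a. \<exists>!y. sat elts (case_nat x (case_nat y \<rho>)) \<phi>) \<Longrightarrow>
                          \<exists>b. elts b = {y. \<exists>x \<in> elts a. sat elts (case_nat x (case_nat y \<rho>)) \<phi>}"


section \<open>Basic set theory in the model\<close>

text \<open>
  \<open>intern S\<close> is the set of the model whose elements are exactly those of \<open>S\<close>. It is unspecified
  if there is no such set; ZF proves its existence wherever it is used in what follows.
  All quantifiers over variables of type \<open>'a\<close> range over sets of the model.
\<close>

definition intern :: "'a::ZF set \<Rightarrow> 'a" where
  "intern S = (THE s. elts s = S)"

definition zempty :: "'a::ZF" where
  "zempty = intern {}"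

definition zpair :: "'a::ZF \<Rightarrow> 'a \<Rightarrow> 'a" where
  "zpair x y = intern {intern {x}, intern {x, y}}"

definition zUnion :: "'a::ZF \<Rightarrow> 'a" where
  "zUnion x = intern (\<Union>y \<in> elts x. elts y)"

definition zinter :: "'a::ZF \<Rightarrow> 'a \<Rightarrow> 'a" where
  "zinter x y = intern (elts x \<inter> elts y)"

definition zdiff :: "'a::ZF \<Rightarrow> 'a \<Rightarrow> 'a" where
  "zdiff x y = intern (elts x - elts y)"

definition ztimes :: "'a::ZF \<Rightarrow> 'a \<Rightarrow> 'a" where
  "ztimes A B = intern {zpair x y | x y. x \<in> elts A \<and> y \<in> elts B}"

definition zfun :: "'a::ZF \<Rightarrow> 'a \<Rightarrow> 'a \<Rightarrow> bool" where
  "zfun f A B \<longleftrightarrow> elts f \<subseteq> elts (ztimes A B) \<and> (\<forall>x \<in> elts A. \<exists>!y. zpair x y \<in> elts f)"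

definition zapp :: "'a::ZF \<Rightarrow> 'a \<Rightarrow> 'a" where
  "zapp f x = (THE y. zpair x y \<in> elts f)"

definition zlam :: "'a::ZF \<Rightarrow> ('a \<Rightarrow> 'a) \<Rightarrow> 'a" where
  "zlam A b = intern {zpair x (b x) | x. x \<in> elts A}"

definition zbij :: "'a::ZF \<Rightarrow> 'a \<Rightarrow> 'a \<Rightarrow> bool" where
  "zbij f A B \<longleftrightarrow> zfun f A B \<and> bij_betw (zapp f) (elts A) (elts B)"

definition zimage :: "'a::ZF \<Rightarrow> 'a \<Rightarrow> 'a" where
  "zimage f A = intern {zapp f x | x. x \<in> elts A}"

definition zpreimage :: "'a::ZF \<Rightarrow> 'a \<Rightarrow> 'a \<Rightarrow> 'a" where
  "zpreimage f A V = intern {x \<in> elts A. zapp f x \<in> elts V}"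

definition inductive_in_model :: "'a::ZF \<Rightarrow> bool" where
  "inductive_in_model w \<longleftrightarrow>
     zempty \<in> elts w \<and> (\<forall>x \<in> elts w. intern (insert x (elts x)) \<in> elts w)"

definition omega :: "'a::ZF" where
  "omega = intern {n. \<forall>w. inductive_in_model w \<longrightarrow> n \<in> elts w}"

definition zfinite :: "'a::ZF \<Rightarrow> bool" where
  "zfinite A \<longleftrightarrow> (\<exists>n \<in> elts omega. \<exists>f. zbij f n A)"

definition zcountable :: "'a::ZF \<Rightarrow> bool" where
  "zcountable A \<longleftrightarrow> (\<exists>f B. elts B \<subseteq> elts omega \<and> zbij f A B)"

definition CMC :: "'a::ZF itself \<Rightarrow> bool" where
  "CMC (u :: 'a itself) \<longleftrightarrow>
     (\<forall>(A::'a) B. zfun A omega B \<and> (\<forall>n \<in> elts omega. zapp A n \<noteq> zempty) \<longrightarrow>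
        (\<exists>F C. zfun F omega C \<and>
           (\<forall>n \<in> elts omega. zapp F n \<noteq> zempty \<and> zfinite (zapp F n) \<and>
              elts (zapp F n) \<subseteq> elts (zapp A n))))"


section \<open>Topology in the model\<close>

definition topology_on :: "'a::ZF \<Rightarrow> 'a \<Rightarrow> bool" where
  "topology_on X T \<longleftrightarrow>
     (\<forall>U \<in> elts T. elts U \<subseteq> elts X) \<and> zempty \<in> elts T \<and> X \<in> elts T \<and>
     (\<forall>S. elts S \<subseteq> elts T \<longrightarrow> zUnion S \<in> elts T) \<and>
     (\<forall>U \<in> elts T. \<forall>V \<in> elts T. zinter U V \<in> elts T)"

definition clopen_in :: "'a::ZF \<Rightarrow> 'a \<Rightarrow> 'a \<Rightarrow> bool" where
  "clopen_in X T A \<longleftrightarrow> A \<in> elts T \<and> elts A \<subseteq> elts X \<and> zdiff X A \<in> elts T"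

definition topology_of_base :: "'a::ZF \<Rightarrow> 'a" where
  "topology_of_base B = intern {zUnion S | S. elts S \<subseteq> elts B}"

definition is_base :: "'a::ZF \<Rightarrow> 'a \<Rightarrow> bool" where
  "is_base B T \<longleftrightarrow> elts B \<subseteq> elts T \<and> (\<forall>U \<in> elts T. \<exists>S. elts S \<subseteq> elts B \<and> U = zUnion S)"

definition zero_dim :: "'a::ZF \<Rightarrow> 'a \<Rightarrow> bool" where
  "zero_dim X T \<longleftrightarrow> is_base (intern {A. clopen_in X T A}) T"

definition T1 :: "'a::ZF \<Rightarrow> 'a \<Rightarrow> bool" where
  "T1 X T \<longleftrightarrow> (\<forall>x \<in> elts X. \<forall>y \<in> elts X. x \<noteq> y \<longrightarrow> (\<exists>U \<in> elts T. x \<in> elts U \<and> y \<notin> elts U))"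

definition compact_top :: "'a::ZF \<Rightarrow> 'a \<Rightarrow> bool" where
  "compact_top X T \<longleftrightarrow>
     (\<forall>C. elts C \<subseteq> elts T \<and> zUnion C = X \<longrightarrow>
        (\<exists>F. elts F \<subseteq> elts C \<and> zfinite F \<and> zUnion F = X))"

definition cont :: "'a::ZF \<Rightarrow> 'a \<Rightarrow> 'a \<Rightarrow> 'a \<Rightarrow> 'a \<Rightarrow> bool" where
  "cont f X T Y S \<longleftrightarrow> zfun f X Y \<and> (\<forall>V \<in> elts S. zpreimage f X V \<in> elts T)"

definition homeo_map :: "'a::ZF \<Rightarrow> 'a \<Rightarrow> 'a \<Rightarrow> 'a \<Rightarrow> 'a \<Rightarrow> bool" where
  "homeo_map f X T Y S \<longleftrightarrow>
     zbij f X Y \<and> cont f X T Y S \<and> (\<forall>U \<in> elts T. zimage f U \<in> elts S)"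

definition homeomorphic_tops :: "'a::ZF \<Rightarrow> 'a \<Rightarrow> 'a \<Rightarrow> 'a \<Rightarrow> bool" where
  "homeomorphic_tops X T Y S \<longleftrightarrow> (\<exists>f. homeo_map f X T Y S)"

definition subspace_top :: "'a::ZF \<Rightarrow> 'a \<Rightarrow> 'a" where
  "subspace_top T A = intern {zinter U A | U. U \<in> elts T}"

definition embedding :: "'a::ZF \<Rightarrow> 'a \<Rightarrow> 'a \<Rightarrow> 'a \<Rightarrow> 'a \<Rightarrow> bool" where
  "embedding f X T Y S \<longleftrightarrow>
     zfun f X Y \<and> homeo_map f X T (zimage f X) (subspace_top S (zimage f X))"

definition dense_in :: "'a::ZF \<Rightarrow> 'a \<Rightarrow> bool" where
  "dense_in T D \<longleftrightarrow> (\<forall>U \<in> elts T. U \<noteq> zempty \<longrightarrow> zinter U D \<noteq> zempty)"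

definition compactification :: "'a::ZF \<Rightarrow> 'a \<Rightarrow> 'a \<Rightarrow> 'a \<Rightarrow> 'a \<Rightarrow> bool" where
  "compactification X T Y S \<alpha> \<longleftrightarrow>
     topology_on Y S \<and> compact_top Y S \<and> embedding \<alpha> X T Y S \<and> dense_in S (zimage \<alpha> X)"

definition Banaschewski :: "'a::ZF \<Rightarrow> 'a \<Rightarrow> 'a \<Rightarrow> 'a \<Rightarrow> 'a \<Rightarrow> bool" where
  "Banaschewski X T Y S \<beta> \<longleftrightarrow>
     compactification X T Y S \<beta> \<and> zero_dim Y S \<and> T1 Y S \<and>
     (\<forall>K TK f. topology_on K TK \<and> compact_top K TK \<and> zero_dim K TK \<and> T1 K TK \<and>
        cont f X T K TK \<longrightarrow>
        (\<exists>g. cont g Y S K TK \<and> (\<forall>x \<in> elts X. zapp g (zapp \<beta> x) = zapp f x)))"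


section \<open>The real numbers of the model\<close>

text \<open>
  Algebraic structures of the model are presented as records of the algebra library whose
  components are represented by sets of the model. Notions such as \<open>field\<close> and \<open>ideal\<close> only
  quantify over elements of the carrier, so they mean the same inside and outside the model.
  Least upper bounds are required only for subsets of the carrier which belong to the model.
\<close>

record 'a ord_ring = "'a ring" +
  leq :: "'a \<Rightarrow> 'a \<Rightarrow> bool"

definition is_lub :: "'a ord_ring \<Rightarrow> 'a set \<Rightarrow> 'a \<Rightarrow> bool" where
  "is_lub R A s \<longleftrightarrow> s \<in> carrier R \<and> (\<forall>x \<in> A. leq R x s) \<and>
     (\<forall>b \<in> carrier R. (\<forall>x \<in> A. leq R x b) \<longrightarrow> leq R s b)"

definition in_model :: "'a::ZF ord_ring \<Rightarrow> bool" where
  "in_model R \<longleftrightarrow>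
     (\<exists>C p m l. elts C = carrier R \<and>
        zfun p (ztimes C C) C \<and> zfun m (ztimes C C) C \<and> elts l \<subseteq> elts (ztimes C C) \<and>
        (\<forall>x \<in> elts C. \<forall>y \<in> elts C.
           x \<oplus>\<^bsub>R\<^esub> y = zapp p (zpair x y) \<and> x \<otimes>\<^bsub>R\<^esub> y = zapp m (zpair x y) \<and>
           (leq R x y \<longleftrightarrow> zpair x y \<in> elts l)))"

definition complete_ordered_field :: "'a::ZF ord_ring \<Rightarrow> bool" where
  "complete_ordered_field R \<longleftrightarrow>
     in_model R \<and> field R \<and>
     linear_order_on (carrier R) {(x, y). x \<in> carrier R \<and> y \<in> carrier R \<and> leq R x y} \<and>
     (\<forall>x \<in> carrier R. \<forall>y \<in> carrier R. \<forall>z \<in> carrier R.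
        leq R x y \<longrightarrow> leq R (x \<oplus>\<^bsub>R\<^esub> z) (y \<oplus>\<^bsub>R\<^esub> z)) \<and>
     (\<forall>x \<in> carrier R. \<forall>y \<in> carrier R.
        leq R \<zero>\<^bsub>R\<^esub> x \<and> leq R \<zero>\<^bsub>R\<^esub> y \<longrightarrow> leq R \<zero>\<^bsub>R\<^esub> (x \<otimes>\<^bsub>R\<^esub> y)) \<and>
     (\<forall>A. elts A \<subseteq> carrier R \<and> A \<noteq> zempty \<and>
        (\<exists>b \<in> carrier R. \<forall>x \<in> elts A. leq R x b) \<longrightarrow> (\<exists>s. is_lub R (elts A) s))"

definition strictly_less :: "'a ord_ring \<Rightarrow> 'a \<Rightarrow> 'a \<Rightarrow> bool" where
  "strictly_less R x y \<longleftrightarrow> leq R x y \<and> x \<noteq> y"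

definition absval :: "'a ord_ring \<Rightarrow> 'a \<Rightarrow> 'a" where
  "absval R x = (if leq R \<zero>\<^bsub>R\<^esub> x then x else \<ominus>\<^bsub>R\<^esub> x)"

definition real_top :: "'a::ZF ord_ring \<Rightarrow> 'a" where
  "real_top R = topology_of_base
     (intern {intern {x \<in> carrier R. strictly_less R a x \<and> strictly_less R x b} | a b.
                a \<in> carrier R \<and> b \<in> carrier R})"


section \<open>Rings of continuous functions and maximal ideals\<close>

definition C_set :: "'a::ZF ord_ring \<Rightarrow> 'a \<Rightarrow> 'a \<Rightarrow> 'a set" where
  "C_set R X T = {f. cont f X T (intern (carrier R)) (real_top R)}"

text \<open>
  The oscillation is a possibly infinite supremum: \<open>has_osc R f A s\<close> says that it is the
  real number \<open>s\<close>, so it fails for every \<open>s\<close> if \<open>f\<close> is unbounded on \<open>A\<close>.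
\<close>

definition has_osc :: "'a::ZF ord_ring \<Rightarrow> 'a \<Rightarrow> 'a \<Rightarrow> 'a \<Rightarrow> bool" where
  "has_osc R f A s \<longleftrightarrow>
     (if A = zempty then s = \<zero>\<^bsub>R\<^esub>
      else is_lub R {absval R (zapp f x \<ominus>\<^bsub>R\<^esub> zapp f y) | x y. x \<in> elts A \<and> y \<in> elts A} s)"

definition U_aleph0 :: "'a::ZF ord_ring \<Rightarrow> 'a \<Rightarrow> 'a \<Rightarrow> 'a ring" where
  "U_aleph0 R X T =
     \<lparr>carrier = {f \<in> C_set R X T.
        \<forall>\<epsilon> \<in> carrier R. strictly_less R \<zero>\<^bsub>R\<^esub> \<epsilon> \<longrightarrow>
          (\<exists>\<A>. zcountable \<A> \<and> zUnion \<A> = X \<and>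
             (\<forall>A \<in> elts \<A>. clopen_in X T A \<and> (\<exists>s. has_osc R f A s \<and> leq R s \<epsilon>)))},
      monoid.mult = (\<lambda>f g. zlam X (\<lambda>x. zapp f x \<otimes>\<^bsub>R\<^esub> zapp g x)),
      one = zlam X (\<lambda>x. \<one>\<^bsub>R\<^esub>),
      zero = zlam X (\<lambda>x. \<zero>\<^bsub>R\<^esub>),
      add = (\<lambda>f g. zlam X (\<lambda>x. zapp f x \<oplus>\<^bsub>R\<^esub> zapp g x))\<rparr>"

text \<open>
  The library's \<open>maximalideal\<close> would compare \<open>M\<close> with all HOL sets that are ideals; here
  maximality refers to the ideals that belong to the model.
\<close>

definition max_ideals :: "'a::ZF ring \<Rightarrow> 'a" where
  "max_ideals R = intern {M. ideal (elts M) R \<and> elts M \<noteq> carrier R \<and>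
     (\<forall>J. ideal (elts J) R \<and> elts M \<subseteq> elts J \<longrightarrow> J = M \<or> elts J = carrier R)}"

definition hull_kernel_top :: "'a::ZF ring \<Rightarrow> 'a" where
  "hull_kernel_top R =
     topology_of_base (intern {intern {M \<in> elts (max_ideals R). r \<notin> elts M} | r. r \<in> carrier R})"

end

theory Submission
  imports Defs "HOL-Library.Countable"
begin

text \<open>
  Call two subsets of \<open>X\<close> separated if a clopen set contains one and misses the other. The proof
  works with the functions \<open>f : X \<rightarrow> \<real>\<close> for which \<open>{f \<le> a}\<close> and \<open>{b \<le> f}\<close> are separated whenever \<open>a < b\<close>
  (\<open>sepfun\<close>). Under \<^bold>\<open>CMC\<close> they are exactly the members of \<open>U = U_aleph0\<close> (\<open>carrier_U_aleph0\<close>). One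
  inclusion is choice-free: the enumeration of a countable clopen cover makes the cover disjoint, and
  the pieces that meet \<open>{f \<le> a}\<close> form a separating set.

  \<^bold>\<open>CMC\<close> is used in one way (\<open>nat_indexed_choice\<close>). If for every \<open>n\<close> there is a clopen set with some
  property, and the property is closed under binary unions, then the union of the finite set provided by
  \<^bold>\<open>CMC\<close> is a single such clopen set. In particular each of these functions yields countable
  clopen partitions on whose pieces it hardly varies. Gluing along such partitions shows that separation is a local
  matter (\<open>sep_patch\<close>): two sets of the model are separated if this is so within each strip \<open>{t \<le> f \<le> t + \<delta>}\<close>.
  Closure under sums and products follows; inverses of positive functions are immediate. So \<open>U\<close> is a
  ring, and its positive members are units.

  Clopen subsets of \<open>X\<close> extend to clopen subsets of the Banaschewski compactification \<open>\<beta>X\<close>, because they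
  correspond to maps to a two-point space. For \<open>y\<close> in \<open>\<beta>X\<close> let \<open>M y\<close> be the set of all \<open>f\<close> in \<open>U\<close> whose zero
  set has \<open>y\<close> in its closure (\<open>vanishes\<close>, \<open>point_ideal\<close>). It is closed under sums, since zero sets
  of \<open>f\<close> and \<open>g\<close> that are disjoint on a clopen set are separated there by means of \<open>f\<^sup>2 / (f\<^sup>2 + g\<^sup>2)\<close>
  (\<open>separate_zero_sets\<close>). It is maximal, since a function not in \<open>M y\<close> has no common zero with the
  indicator of some clopen set missing \<open>y\<close>, and this indicator belongs to \<open>M y\<close>. By compactness every proper ideal is contained in
  some \<open>M y\<close> (\<open>proper_ideal_vanishes\<close>). So \<open>y \<mapsto> M y\<close> is a bijection onto the maximal ideals, and it
  matches clopen sets with basic open sets (\<open>homeomorphic\<close>).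

  The statement is about a model of \<open>ZF\<close> in which Separation holds for first-order formulas only.
  Whenever a set is formed, it has to be shown that its defining condition is first-order; a
  calculus of definable predicates and terms reduces this to applying introduction rules. Induction
  likewise is available for definable predicates only. Arithmetic in the real field \<open>R\<close> of the model is
  carried out in a type of class \<open>linordered_field\<close> that is a copy of the carrier of \<open>R\<close>.
\<close>

section \<open>First-order definability with parameters\<close>

text \<open>
  A formula has a single environment. In what follows the even slots of the environment
  (see \<open>mix\<close>) hold the arguments of a predicate and the odd slots hold parameters from the model;
  renaming moves variables between the slots.
\<close>

primrec rename :: "(nat \<Rightarrow> nat) \<Rightarrow> fm \<Rightarrow> fm" where
  "rename r (Mem i j) = Mem (r i) (r j)"
| "rename r (Eq i j) = Eq (r i) (r j)"
| "rename r (Neg p) = Neg (rename r p)"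
| "rename r (Conj p q) = Conj (rename r p) (rename r q)"
| "rename r (All p) = All (rename (case_nat 0 (\<lambda>i. Suc (r i))) p)"

lemma sat_rename: "sat E \<rho> (rename r p) = sat E (\<lambda>i. \<rho> (r i)) p"
proof (induction p arbitrary: r \<rho>)
  case (All p)
  have "(\<lambda>i. case_nat x \<rho> (case_nat 0 (\<lambda>i. Suc (r i)) i)) = case_nat x (\<lambda>i. \<rho> (r i))" for x
    by (rule ext) (auto split: nat.split)
  then show ?case by (simp add: All.IH)
qed auto

definition mix :: "(nat \<Rightarrow> 'b) \<Rightarrow> (nat \<Rightarrow> 'b) \<Rightarrow> nat \<Rightarrow> 'b" where
  "mix e \<rho> i = (if even i then e (i div 2) else \<rho> (i div 2))"

lemma mix_even: "mix e \<rho> (2 * i) = e i"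
  and mix_odd: "mix e \<rho> (Suc (2 * i)) = \<rho> i"
  by (auto simp: mix_def)

abbreviation tail :: "(nat \<Rightarrow> 'b) \<Rightarrow> nat \<Rightarrow> 'b" where
  "tail e \<equiv> \<lambda>i. e (Suc i)"

text \<open>
  Definability is relative to a guard \<open>G\<close>: a formula only has to agree with the predicate on
  environments that satisfy \<open>G\<close>. Function application and the field operations have no specified
  value outside their domains, so a predicate mentioning them is definable only where they make
  sense. The guard records what is known at a position inside a formula: passing under a
  bounded quantifier or to the right of a conjunction or implication strengthens it.

  Environments are de Bruijn style: \<open>e 0\<close> is the innermost bound variable, and \<open>tail e\<close> is the
  environment outside the binder. The rules collected in \<open>definable_intros\<close> are syntax directed.
\<close>

definition definable :: "((nat \<Rightarrow> 'a::ZF) \<Rightarrow> bool) \<Rightarrow> ((nat \<Rightarrow> 'a) \<Rightarrow> bool) \<Rightarrow> bool" where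
  "definable G P \<longleftrightarrow> (\<exists>\<phi> \<rho>. \<forall>e. G e \<longrightarrow> P e = sat elts (mix e \<rho>) \<phi>)"

definition definable_term :: "((nat \<Rightarrow> 'a::ZF) \<Rightarrow> bool) \<Rightarrow> ((nat \<Rightarrow> 'a) \<Rightarrow> 'a) \<Rightarrow> bool" where
  "definable_term G t \<longleftrightarrow> definable (\<lambda>e. G (tail e)) (\<lambda>e. e 0 = t (tail e))"

named_theorems definable_intros

lemma definable_cong:
  assumes "definable G P" "\<And>e. H e \<Longrightarrow> G e" "\<And>e. H e \<Longrightarrow> P e = Q e"
  shows "definable H Q"
  using assms unfolding definable_def by metis

lemma definable_const [definable_intros]: "definable G (\<lambda>e. b)"
proof (cases b)
  case True
  then show ?thesis unfolding definable_def by (intro exI[of _ "Eq 0 0"]) simp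
next
  case False
  then show ?thesis unfolding definable_def by (intro exI[of _ "Neg (Eq 0 0)"]) simp
qed

lemma definable_not [definable_intros]:
  assumes "definable G P" shows "definable G (\<lambda>e. \<not> P e)"
proof -
  obtain \<phi> \<rho> where "\<forall>e. G e \<longrightarrow> P e = sat elts (mix e \<rho>) \<phi>"
    using assms unfolding definable_def by blast
  then show ?thesis unfolding definable_def
    by (intro exI[of _ "Neg \<phi>"] exI[of _ \<rho>]) simp
qed

text \<open>
  The parameters of the two formulas are interleaved. The right conjunct need only be definable
  where the left one holds, since elsewhere the value of its formula is irrelevant.
\<close>

lemma definable_conj [definable_intros]:
  assumes "definable G P" "definable (\<lambda>e. G e \<and> P e) Q"
  shows "definable G (\<lambda>e. P e \<and> Q e)"
proof -
  obtain \<phi> \<rho> where 1: "\<And>e. G e \<Longrightarrow> P e = sat elts (mix e \<rho>) \<phi>"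
    using assms unfolding definable_def by blast
  obtain \<phi>' \<rho>' where 2: "\<And>e. G e \<Longrightarrow> P e \<Longrightarrow> Q e = sat elts (mix e \<rho>') \<phi>'"
    using assms unfolding definable_def by blast
  let ?r = "\<lambda>i. if even i then i else 4 * (i div 2) + 1"
  let ?r' = "\<lambda>i. if even i then i else 4 * (i div 2) + 3"
  have r: "(\<lambda>i. mix e (mix \<rho> \<rho>') (?r i)) = mix e \<rho>"
    and r': "(\<lambda>i. mix e (mix \<rho> \<rho>') (?r' i)) = mix e \<rho>'" for e
  proof -
    have "mix e (mix \<rho> \<rho>') (?r i) = mix e \<rho> i \<and> mix e (mix \<rho> \<rho>') (?r' i) = mix e \<rho>' i" for i
    proof (cases "even i")
      case False
      then obtain j where i: "i = Suc (2 * j)" by (metis oddE Suc_eq_plus1)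
      have "?r i = Suc (2 * (2 * j))" "?r' i = Suc (2 * (Suc (2 * j)))" using i by auto
      then show ?thesis by (simp only: mix_odd mix_even i)
    qed (simp add: mix_def)
    then show "(\<lambda>i. mix e (mix \<rho> \<rho>') (?r i)) = mix e \<rho>"
      "(\<lambda>i. mix e (mix \<rho> \<rho>') (?r' i)) = mix e \<rho>'" by auto
  qed
  show ?thesis unfolding definable_def
    by (intro exI[of _ "Conj (rename ?r \<phi>) (rename ?r' \<phi>')"] exI[of _ "mix \<rho> \<rho>'"])
       (auto simp: sat_rename r r' 1 2)
qed

lemma definable_all [definable_intros]:
  assumes "definable (\<lambda>e. G (tail e)) (\<lambda>e. P (tail e) (e 0))"
  shows "definable G (\<lambda>e. \<forall>x. P e x)"
proof -
  obtain \<phi> \<rho> where 1: "\<And>e. G (tail e) \<Longrightarrow>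
      P (tail e) (e 0) = sat elts (mix e \<rho>) \<phi>"
    using assms unfolding definable_def by blast
  have 2: "P e x = sat elts (mix (case_nat x e) \<rho>) \<phi>" if "G e" for e x
    using 1[of "case_nat x e"] that by simp
  \<comment> \<open>The bound variable becomes argument number \<open>0\<close>, and the other arguments move up by one.\<close>
  let ?r = "\<lambda>i. if i = 0 then 0 else if even i then i - 1 else i + 1"
  have r: "(\<lambda>i. case_nat x (mix e \<rho>) (?r i)) = mix (case_nat x e) \<rho>" for e x
  proof
    fix i :: nat
    consider "i = 0" | j where "i = 2 * Suc j" | j where "i = Suc (2 * j)"
      by (metis evenE not0_implies_Suc mult_0_right oddE Suc_eq_plus1)
    then show "case_nat x (mix e \<rho>) (?r i) = mix (case_nat x e) \<rho> i"
      by cases (simp_all add: mix_def)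
  qed
  show ?thesis unfolding definable_def
    by (intro exI[of _ "All (rename ?r \<phi>)"] exI[of _ \<rho>]) (auto simp: sat_rename r 2)
qed

text \<open>
  A predicate keeps its definability when its variables are reindexed; this is how facts about an
  outer environment are used under binders.
\<close>

lemma definable_shift:
  assumes "definable G P" "\<And>e. H e \<Longrightarrow> G (\<lambda>i. e (r i))"
  shows "definable H (\<lambda>e. P (\<lambda>i. e (r i)))"
proof -
  obtain \<phi> \<rho> where 1: "\<And>e. G e \<Longrightarrow> P e = sat elts (mix e \<rho>) \<phi>"
    using assms unfolding definable_def by blast
  let ?r = "\<lambda>i. if even i then 2 * r (i div 2) else i"
  have "(\<lambda>i. mix e \<rho> (?r i)) = mix (\<lambda>i. e (r i)) \<rho>" for e
    by (auto simp: mix_def)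
  then show ?thesis unfolding definable_def using assms(2)
    by (intro exI[of _ "rename ?r \<phi>"] exI[of _ \<rho>]) (auto simp: sat_rename 1)
qed

lemma definable_imp [definable_intros]:
  assumes "definable G P" "definable (\<lambda>e. G e \<and> P e) Q"
  shows "definable G (\<lambda>e. P e \<longrightarrow> Q e)"
  by (rule definable_cong[OF definable_not[OF definable_conj[OF assms(1) definable_not[OF assms(2)]]]])
     auto

lemma definable_disj [definable_intros]:
  assumes "definable G P" "definable (\<lambda>e. G e \<and> \<not> P e) Q"
  shows "definable G (\<lambda>e. P e \<or> Q e)"
  by (rule definable_cong[OF definable_imp[OF definable_not[OF assms(1)] assms(2)]]) auto

lemma definable_weaken:
  assumes "definable G P" "\<And>e. H e \<Longrightarrow> G e" shows "definable H P"
  using definable_cong[OF assms] by simp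

lemma definable_iff [definable_intros]:
  assumes "definable G P" "definable G Q"
  shows "definable G (\<lambda>e. P e = Q e)"
  by (rule definable_cong[OF definable_conj[OF
        definable_imp[OF assms(1) definable_weaken[OF assms(2)]]
        definable_imp[OF definable_weaken[OF assms(2)] definable_weaken[OF assms(1)]]]])
     auto

lemma definable_ex [definable_intros]:
  assumes "definable (\<lambda>e. G (tail e)) (\<lambda>e. P (tail e) (e 0))"
  shows "definable G (\<lambda>e. \<exists>x. P e x)"
  by (rule definable_cong[OF definable_not[OF definable_all[where P = "\<lambda>e x. \<not> P e x", OF definable_not[OF assms]]]])
     auto

text \<open>
  A term in argument position is eliminated through \<open>\<exists>x. x = t \<and> P x\<close>.
\<close>

lemma definable_subst:
  assumes "definable_term G t"
    and "definable (\<lambda>e. G (tail e) \<and> e 0 = t (tail e)) (\<lambda>e. P (tail e) (e 0))"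
  shows "definable G (\<lambda>e. P e (t e))"
  by (rule definable_cong[OF definable_ex[where P = "\<lambda>e x. x = t e \<and> P e x", OF
        definable_conj[OF assms[unfolded definable_term_def]]]]) auto

lemma definable_term_shift:
  assumes "definable_term G t" "\<And>e. H e \<Longrightarrow> G (\<lambda>i. e (r i))"
  shows "definable_term H (\<lambda>e. t (\<lambda>i. e (r i)))"
proof -
  have "G (\<lambda>i. e (Suc (r i)))" if "H (tail e)" for e
    using assms(2)[OF that] .
  then show ?thesis
    using definable_shift[of "\<lambda>e. G (tail e)" "\<lambda>e. e 0 = t (tail e)"
        "\<lambda>e. H (tail e)" "case_nat 0 (\<lambda>i. Suc (r i))"] assms(1)
    unfolding definable_term_def by simp
qed

lemma definable_term_weaken:
  assumes "definable_term G t" "\<And>e. H e \<Longrightarrow> G e" shows "definable_term H t"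
  using definable_term_shift[of G t H "\<lambda>i. i"] assms by simp

lemma definable_mem_var: "definable G (\<lambda>e. e i \<in> elts (e j))"
  unfolding definable_def by (intro exI[of _ "Mem (2 * i) (2 * j)"]) (simp add: mix_even)

lemma definable_eq_var: "definable G (\<lambda>e. e i = e j)"
  unfolding definable_def by (intro exI[of _ "Eq (2 * i) (2 * j)"]) (simp add: mix_even)

lemma definable_term_const [definable_intros]: "definable_term G (\<lambda>e. c)"
proof -
  have "mix e (\<lambda>_. c) 1 = c" "mix e (\<lambda>_. c) 0 = e 0" for e :: "nat \<Rightarrow> 'a"
    by (auto simp: mix_def)
  then show ?thesis unfolding definable_term_def definable_def
    by (intro exI[of _ "Eq 0 1"] exI[of _ "\<lambda>_. c"]) simp
qed

lemma definable_term_var [definable_intros]: "definable_term G (\<lambda>e. e i)"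
  unfolding definable_term_def by (rule definable_eq_var)

lemma definable_mem [definable_intros]:
  assumes s: "definable_term G s" and t: "definable_term G t"
  shows "definable G (\<lambda>e. s e \<in> elts (t e))"
  by (rule definable_subst[OF s], rule definable_subst[OF definable_term_shift[OF t]],
      simp, rule definable_mem_var)

lemma definable_eq [definable_intros]:
  assumes s: "definable_term G s" and t: "definable_term G t"
  shows "definable G (\<lambda>e. s e = t e)"
  by (rule definable_subst[OF s], rule definable_subst[OF definable_term_shift[OF t]],
      simp, rule definable_eq_var)

lemma definable_ball [definable_intros]:
  assumes "definable_term G t"
    and "definable (\<lambda>e. G (tail e) \<and> e 0 \<in> elts (t (tail e))) (\<lambda>e. P (tail e) (e 0))"
  shows "definable G (\<lambda>e. \<forall>x \<in> elts (t e). P e x)"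
  unfolding Ball_def
  by (rule definable_all, rule definable_imp[OF definable_mem[OF definable_term_var definable_term_shift[OF assms(1)]] assms(2)])

lemma definable_bex [definable_intros]:
  assumes "definable_term G t"
    and "definable (\<lambda>e. G (tail e) \<and> e 0 \<in> elts (t (tail e))) (\<lambda>e. P (tail e) (e 0))"
  shows "definable G (\<lambda>e. \<exists>x \<in> elts (t e). P e x)"
  unfolding Bex_def
  by (rule definable_ex, rule definable_conj[OF definable_mem[OF definable_term_var definable_term_shift[OF assms(1)]] assms(2)])

lemma definable_subset [definable_intros]:
  assumes s: "definable_term G s" and t: "definable_term G t"
  shows "definable G (\<lambda>e. elts (s e) \<subseteq> elts (t e))"
  unfolding subset_eq
  by (intro definable_ball s definable_mem definable_term_var definable_term_shift[OF t]) simp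

lemma definable_ex1 [definable_intros]:
  assumes "definable (\<lambda>e. G (tail e)) (\<lambda>e. P (tail e) (e 0))"
  shows "definable G (\<lambda>e. \<exists>!x. P e x)"
proof -
  have "definable (\<lambda>e. G (tail e) \<and> P (tail e) (e 0))
     (\<lambda>e. \<forall>y. P (tail e) y \<longrightarrow> y = e 0)"
    by (intro definable_intros, rule definable_shift[where r = "case_nat 0 (\<lambda>i. Suc (Suc i))", OF assms, simplified])
       (auto intro: definable_intros)
  then show ?thesis unfolding Ex1_def
    by (intro definable_ex definable_conj[OF assms])
qed

lemma elts_inject: "elts x = elts y \<longleftrightarrow> x = y"
  using ZF_extensionality by auto

lemma definable_term_The [definable_intros]:
  assumes "\<And>e. G e \<Longrightarrow> \<exists>!x. P e x"
    and "definable (\<lambda>e. G (tail e)) (\<lambda>e. P (tail e) (e 0))"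
  shows "definable_term G (\<lambda>e. THE x. P e x)"
  unfolding definable_term_def
proof (rule definable_cong[OF assms(2)])
  fix e :: "nat \<Rightarrow> 'a"
  assume "G (tail e)"
  from assms(1)[OF this] show "P (tail e) (e 0) = (e 0 = (THE x. P (tail e) x))"
    by (metis the1_equality theI')
qed assumption

definition internal :: "'a::ZF set \<Rightarrow> bool" where
  "internal S \<longleftrightarrow> S \<in> range elts"

lemma internal_elts [simp]: "internal (elts x)"
  by (simp add: internal_def)

lemma internalI: "\<exists>s. elts s = S \<Longrightarrow> internal S"
  by (auto simp: internal_def)

lemma elts_intern [simp]: "internal S \<Longrightarrow> elts (intern S) = S"
  unfolding intern_def internal_def by (auto simp: elts_inject)

lemma intern_elts [simp]: "intern (elts s) = s"
  using elts_inject elts_intern internal_elts by blast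

lemma definable_term_intern [definable_intros]:
  assumes "\<And>e. G e \<Longrightarrow> internal (S e)"
    and "definable (\<lambda>e. G (tail e)) (\<lambda>e. e 0 \<in> S (tail e))"
  shows "definable_term G (\<lambda>e. intern (S e))"
proof -
  have "definable (\<lambda>e. G (tail e)) (\<lambda>e. \<forall>z. z \<in> elts (e 0) \<longleftrightarrow> z \<in> S (tail e))"
    by (intro definable_intros, rule definable_shift[where r = "case_nat 0 (\<lambda>i. Suc (Suc i))", OF assms(2), simplified])
  then show ?thesis unfolding definable_term_def
  proof (rule definable_cong)
    fix e :: "nat \<Rightarrow> 'a"
    assume "G (tail e)"
    then have eq: "elts (intern (S (tail e))) = S (tail e)" by (rule elts_intern[OF assms(1)])
    have "(\<forall>z. z \<in> elts (e 0) \<longleftrightarrow> z \<in> S (tail e)) =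
        (elts (e 0) = elts (intern (S (tail e))))"
      unfolding eq by (simp only: set_eq_iff)
    then show "(\<forall>z. z \<in> elts (e 0) \<longleftrightarrow> z \<in> S (tail e)) = (e 0 = intern (S (tail e)))"
      by (simp only: elts_inject)
  qed assumption
qed

text \<open>
  Separation for a predicate inside a larger formula: the current environment \<open>u\<close> supplies
  infinitely many parameters at once, which the schema allows.
\<close>

lemma internal_separation_env:
  assumes "definable (\<lambda>e. G (tail e) \<and> e 0 \<in> elts (t (tail e))) (\<lambda>e. P (tail e) (e 0))"
    and "G u"
  shows "internal {x \<in> elts (t u). P u x}"
proof -
  obtain \<phi> \<rho> where 1: "\<And>e. G (tail e) \<Longrightarrow> e 0 \<in> elts (t (tail e)) \<Longrightarrow>
      P (tail e) (e 0) = sat elts (mix e \<rho>) \<phi>"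
    using assms(1) unfolding definable_def by blast
  have 2: "P u x = sat elts (mix (case_nat x u) \<rho>) \<phi>" if "x \<in> elts (t u)" for x
    using 1[of "case_nat x u"] that assms(2) by simp
  have "mix (case_nat x u) \<rho> = case_nat x (mix \<rho> u)" for x
  proof
    fix i :: nat
    consider "i = 0" | j where "i = 2 * Suc j" | j where "i = Suc (2 * j)"
      by (metis evenE not0_implies_Suc mult_0_right oddE Suc_eq_plus1)
    then show "mix (case_nat x u) \<rho> i = case_nat x (mix \<rho> u) i"
      by cases (simp_all add: mix_def)
  qed
  then have "{x \<in> elts (t u). P u x} = {x \<in> elts (t u). sat elts (case_nat x (mix \<rho> u)) \<phi>}"
    using 2 by auto
  then show ?thesis using ZF_separation[of "t u" "mix \<rho> u" \<phi>] by (auto intro: internalI)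
qed

lemma internal_separation:
  assumes "definable (\<lambda>e. e 0 \<in> elts a) (\<lambda>e. P (e 0))"
  shows "internal {x \<in> elts a. P x}"
  using internal_separation_env[of "\<lambda>_. True" "\<lambda>_. a" "\<lambda>_ x. P x" undefined] assms by simp

lemma elts_intern_eqI:
  assumes "S = {x \<in> elts a. P x}" "definable (\<lambda>e. e 0 \<in> elts a) (\<lambda>e. P (e 0))"
  shows "elts (intern S) = S"
  using internal_separation[OF assms(2)] assms(1) by simp

lemma definable_term_separation [definable_intros]:
  assumes "definable_term G t"
    and "definable (\<lambda>e. G (tail e) \<and> e 0 \<in> elts (t (tail e))) (\<lambda>e. P (tail e) (e 0))"
  shows "definable_term G (\<lambda>e. intern {x \<in> elts (t e). P e x})"
  by (rule definable_term_intern)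
     (auto intro!: internal_separation_env[where t=t and P=P, OF assms(2)] definable_conj[OF definable_mem] assms definable_term_var
        definable_term_shift[OF assms(1)])

section \<open>Elementary constructions\<close>

lemma elts_zempty [simp]: "elts (zempty :: 'a::ZF) = {}"
proof -
  have "internal {x \<in> elts (undefined :: 'a). False}" by (intro internal_separation definable_intros)
  then show ?thesis by (simp add: zempty_def)
qed

lemma eq_zempty_iff: "x = zempty \<longleftrightarrow> elts x = {}"
  by (metis elts_inject elts_zempty)

lemma internal_pair [simp]: "internal {x, y}"
  by (rule internalI, rule ZF_pairing)

lemma internal_singleton [simp]: "internal {x}"
  using internal_pair[of x x] by simp

lemma elts_zUnion [simp]: "elts (zUnion x) = (\<Union>y \<in> elts x. elts y)"
  unfolding zUnion_def by (rule elts_intern, rule internalI, rule ZF_union)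

lemma internal_Pow [simp]: "internal {y. elts y \<subseteq> elts x}"
  by (rule internalI, rule ZF_power)

lemma internal_Un [simp]: "internal (elts x \<union> elts y)"
proof -
  have "elts (zUnion (intern {x, y})) = elts x \<union> elts y" by simp
  then show ?thesis by (metis internal_elts)
qed

definition zUn :: "'a::ZF \<Rightarrow> 'a \<Rightarrow> 'a" where
  "zUn x y = intern (elts x \<union> elts y)"

lemma elts_zUn [simp]: "elts (zUn x y) = elts x \<union> elts y"
  by (simp add: zUn_def)

lemma internal_insert [simp]: "internal (insert x (elts y))"
  using internal_Un[of "intern {x}" y] by simp

lemma elts_zinter [simp]: "elts (zinter x y) = elts x \<inter> elts y"
proof -
  have "internal {z \<in> elts x. z \<in> elts y}" by (intro internal_separation definable_intros)
  then show ?thesis by (simp add: zinter_def Collect_conj_eq)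
qed

lemma elts_zdiff [simp]: "elts (zdiff x y) = elts x - elts y"
proof -
  have "internal {z \<in> elts x. z \<notin> elts y}" by (intro internal_separation definable_intros)
  then show ?thesis by (simp add: zdiff_def set_diff_eq)
qed

definition zPow :: "'a::ZF \<Rightarrow> 'a" where
  "zPow x = intern {y. elts y \<subseteq> elts x}"

lemma elts_zPow [simp]: "elts (zPow x) = {y. elts y \<subseteq> elts x}"
  by (simp add: zPow_def)

lemma zpair_inject [simp]: "zpair a b = zpair c d \<longleftrightarrow> a = c \<and> b = d"
proof -
  have "{intern {a}, intern {a, b}} = {intern {c}, intern {c, d}} \<longleftrightarrow> a = c \<and> b = d"
    by (metis (no_types, lifting) doubleton_eq_iff elts_intern internal_pair internal_singleton insert_absorb2)
  then show ?thesis unfolding zpair_def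
    by (metis elts_intern internal_pair)
qed

lemma definable_term_doubleton [definable_intros]:
  assumes s: "definable_term G s" and t: "definable_term G t"
  shows "definable_term G (\<lambda>e. intern {s e, t e})"
proof (rule definable_term_intern)
  show "definable (\<lambda>e. G (tail e)) (\<lambda>e. e 0 \<in> {s (tail e), t (tail e)})"
    unfolding insert_iff empty_iff
    by (intro definable_intros definable_term_shift[OF s] definable_term_shift[OF t]) auto
qed simp

lemma definable_term_zpair [definable_intros]:
  assumes s: "definable_term G s" and t: "definable_term G t"
  shows "definable_term G (\<lambda>e. zpair (s e) (t e))"
  using definable_term_doubleton[OF definable_term_doubleton[OF s s] definable_term_doubleton[OF s t]]
  by (simp add: zpair_def)

lemma elts_ztimes [simp]: "elts (ztimes A B) = {zpair x y | x y. x \<in> elts A \<and> y \<in> elts B}"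
proof -
  have "zpair x y \<in> elts (zPow (zPow (zUnion (intern {A, B}))))" if "x \<in> elts A" "y \<in> elts B" for x y
    using that by (auto simp: zpair_def)
  then have "{zpair x y | x y. x \<in> elts A \<and> y \<in> elts B}
      = {z \<in> elts (zPow (zPow (zUnion (intern {A, B})))). \<exists>x \<in> elts A. \<exists>y \<in> elts B. z = zpair x y}"
    by blast
  then show ?thesis unfolding ztimes_def by (rule elts_intern_eqI) (intro definable_intros)
qed

lemma definable_term_zUnion [definable_intros]:
  assumes "definable_term G t" shows "definable_term G (\<lambda>e. zUnion (t e))"
  unfolding zUnion_def
proof (rule definable_term_intern)
  show "internal (\<Union>y \<in> elts (t e). elts y)" for e by (rule internalI, rule ZF_union)
  show "definable (\<lambda>e. G (tail e)) (\<lambda>e. e 0 \<in> (\<Union>y \<in> elts (t (tail e)). elts y))"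
    unfolding UN_iff by (intro definable_intros definable_term_shift[OF assms])
qed

lemma definable_term_zdiff [definable_intros]:
  assumes s: "definable_term G s" and t: "definable_term G t"
  shows "definable_term G (\<lambda>e. zdiff (s e) (t e))"
  unfolding zdiff_def set_diff_eq
  by (intro definable_intros s definable_term_shift[OF t]) simp

lemma definable_term_zinter [definable_intros]:
  assumes s: "definable_term G s" and t: "definable_term G t"
  shows "definable_term G (\<lambda>e. zinter (s e) (t e))"
  unfolding zinter_def Int_def
  by (intro definable_intros s definable_term_shift[OF t]) simp


section \<open>Functions of the model\<close>

lemma definable_term_ztimes [definable_intros]:
  assumes s: "definable_term G s" and t: "definable_term G t"
  shows "definable_term G (\<lambda>e. ztimes (s e) (t e))"
  unfolding ztimes_def
proof (rule definable_term_intern)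
  show "internal {zpair x y |x y. x \<in> elts (s e) \<and> y \<in> elts (t e)}" for e
    by (simp only: internal_elts flip: elts_ztimes)
  have "definable (\<lambda>e. G (tail e))
     (\<lambda>e. \<exists>x \<in> elts (s (tail e)). \<exists>y \<in> elts (t (tail e)). e 0 = zpair x y)"
    by (intro definable_intros definable_term_shift[OF s] definable_term_shift[OF t]) auto
  then show "definable (\<lambda>e. G (tail e))
     (\<lambda>e. e 0 \<in> {zpair x y |x y. x \<in> elts (s (tail e)) \<and> y \<in> elts (t (tail e))})"
    by (rule definable_cong) auto
qed

lemma definable_zfun [definable_intros]:
  assumes "definable_term G f" "definable_term G s" and "definable_term G t"
  shows "definable G (\<lambda>e. zfun (f e) (s e) (t e))"
  unfolding zfun_def
  by (intro definable_intros assms(3); (rule definable_term_shift[OF assms(1)] definable_term_shift[OF assms(2)]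
     definable_term_shift[OF assms(3)])?) auto

text \<open>
  The condition under which the description in \<open>zapp\<close> denotes.
\<close>

definition in_dom :: "'a::ZF \<Rightarrow> 'a \<Rightarrow> bool" where
  "in_dom f x \<longleftrightarrow> (\<exists>!y. zpair x y \<in> elts f)"

lemma in_dom_zfun: "zfun f A B \<Longrightarrow> x \<in> elts A \<Longrightarrow> in_dom f x"
  by (simp add: in_dom_def zfun_def)

lemma definable_term_zapp [definable_intros]:
  assumes s: "definable_term G s" and t: "definable_term G t"
    and "\<And>e. G e \<Longrightarrow> in_dom (s e) (t e)"
  shows "definable_term G (\<lambda>e. zapp (s e) (t e))"
  unfolding zapp_def
  by (rule definable_term_The, rule assms(3)[unfolded in_dom_def], assumption)
     (intro definable_intros definable_term_shift[OF s] definable_term_shift[OF t], simp_all)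

lemma zfun_pair_iff:
  assumes "zfun f A B" "x \<in> elts A"
  shows "zpair x y \<in> elts f \<longleftrightarrow> y = zapp f x"
proof -
  have "\<exists>!y. zpair x y \<in> elts f" using assms by (auto simp: zfun_def)
  then show ?thesis unfolding zapp_def by (metis theI')
qed

lemma zapp_in [intro]:
  assumes "zfun f A B" "x \<in> elts A" shows "zapp f x \<in> elts B"
  using zfun_pair_iff[OF assms, of "zapp f x"] assms(1) by (auto simp: zfun_def)

lemma elts_zfun:
  assumes "zfun f A B" shows "elts f = {zpair x (zapp f x) | x. x \<in> elts A}"
  using assms zfun_pair_iff[OF assms] unfolding zfun_def by auto

lemma zfun_eqI:
  assumes "zfun f A B" "zfun g A B'" "\<And>x. x \<in> elts A \<Longrightarrow> zapp f x = zapp g x"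
  shows "f = g"
proof -
  have "elts f = elts g"
    unfolding elts_zfun[OF assms(1)] elts_zfun[OF assms(2)] using assms(3) by auto
  then show ?thesis by (simp add: elts_inject)
qed

text \<open>
  As a codomain \<open>B\<close> is given, the graph is cut out of \<open>A \<times> B\<close> by Separation.
\<close>

lemma
  assumes b: "definable_term (\<lambda>e. e 0 \<in> elts A) (\<lambda>e. b (e 0))"
    and B: "\<And>x. x \<in> elts A \<Longrightarrow> b x \<in> elts B"
  shows zfun_zlam: "zfun (zlam A b) A B"
    and zapp_zlam: "x \<in> elts A \<Longrightarrow> zapp (zlam A b) x = b x"
proof -
  have "{zpair x (b x) | x. x \<in> elts A} = {p \<in> elts (ztimes A B). \<exists>x \<in> elts A. p = zpair x (b x)}"
    using B by auto
  moreover have "internal \<dots>"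
    by (intro internal_separation definable_intros definable_term_shift[where t = "\<lambda>e. b (e 0)" and r = "\<lambda>i. i", OF b]) auto
  ultimately have "internal {zpair x (b x) | x. x \<in> elts A}" by (simp only:)
  then have e: "elts (zlam A b) = {zpair x (b x) | x. x \<in> elts A}"
    unfolding zlam_def by (rule elts_intern)
  show f: "zfun (zlam A b) A B" unfolding zfun_def e using B by auto
  show "zapp (zlam A b) x = b x" if "x \<in> elts A"
    using zfun_pair_iff[OF f that, of "b x"] e that by auto
qed

lemma zbij_iff:
  "zbij f A B \<longleftrightarrow> zfun f A B \<and>
    (\<forall>x \<in> elts A. \<forall>y \<in> elts A. zapp f x = zapp f y \<longrightarrow> x = y) \<and>
    (\<forall>y \<in> elts B. \<exists>x \<in> elts A. zapp f x = y)"
proof -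
  have "zapp f ` elts A = elts B \<longleftrightarrow> (\<forall>y \<in> elts B. \<exists>x \<in> elts A. zapp f x = y)" if "zfun f A B"
  proof -
    have "zapp f ` elts A = elts B \<longleftrightarrow> elts B \<subseteq> zapp f ` elts A" using zapp_in[OF that] by auto
    also have "\<dots> \<longleftrightarrow> (\<forall>y \<in> elts B. \<exists>x \<in> elts A. zapp f x = y)"
      by (simp add: subset_iff image_iff eq_commute Ball_def)
    finally show ?thesis .
  qed
  then show ?thesis unfolding zbij_def bij_betw_def inj_on_def by auto
qed

lemma definable_zbij [definable_intros]:
  assumes f: "definable_term G f" and s: "definable_term G s" and t: "definable_term G t"
  shows "definable G (\<lambda>e. zbij (f e) (s e) (t e))"
  unfolding zbij_iff
  by (intro definable_intros assms; (rule definable_term_shift[OF f] definable_term_shift[OF s]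
     definable_term_shift[OF t])?) (auto intro: in_dom_zfun)

section \<open>The natural numbers of the model\<close>

lemma not_mem_self: "x \<notin> elts x"
  using ZF_foundation[of "intern {x}"] by auto

lemma no_mem_cycle: "x \<in> elts y \<Longrightarrow> y \<notin> elts x"
  using ZF_foundation[of "intern {x, y}"] by auto

definition zsucc :: "'a::ZF \<Rightarrow> 'a" where
  "zsucc n = intern (insert n (elts n))"

lemma elts_zsucc [simp]: "elts (zsucc n) = insert n (elts n)"
  by (simp add: zsucc_def)

text \<open>
  Foundation excludes \<open>m \<in> n \<in> m\<close>, the only way in which two different sets could have the same
  successor.
\<close>

lemma zsucc_inject [simp]: "zsucc m = zsucc n \<longleftrightarrow> m = n"
  by (metis elts_zsucc insert_iff no_mem_cycle)

lemma zsucc_neq_zempty [simp]: "zsucc n \<noteq> zempty" "zempty \<noteq> zsucc n"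
  by (metis elts_zempty elts_zsucc insert_not_empty)+

lemma definable_term_zsucc [definable_intros]:
  assumes "definable_term G t" shows "definable_term G (\<lambda>e. zsucc (t e))"
  unfolding zsucc_def
  by (rule definable_term_intern)
    (auto simp only: internal_insert insert_iff intro!: definable_intros definable_term_shift[OF assms])

lemma inductive_iff:
  "inductive_in_model w \<longleftrightarrow> zempty \<in> elts w \<and> (\<forall>x \<in> elts w. zsucc x \<in> elts w)"
  by (simp add: inductive_in_model_def zsucc_def)

lemma elts_omega: "elts (omega :: 'a::ZF) = {n. \<forall>w. inductive_in_model w \<longrightarrow> n \<in> elts w}"
proof -
  obtain w :: 'a where w: "\<exists>e \<in> elts w. elts e = {}" "\<forall>x \<in> elts w. \<exists>s \<in> elts w. elts s = insert x (elts x)"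
    using ZF_infinity by blast
  have "inductive_in_model w"
    unfolding inductive_iff using w by (metis elts_inject elts_zempty elts_zsucc)
  then have "{n. \<forall>w. inductive_in_model w \<longrightarrow> n \<in> elts w} = {n \<in> elts w. \<forall>w. inductive_in_model w \<longrightarrow> n \<in> elts w}"
    by auto
  then show ?thesis
    unfolding omega_def inductive_iff by (rule elts_intern_eqI) (intro definable_intros)
qed

lemma zempty_omega [simp]: "zempty \<in> elts omega"
  by (auto simp: elts_omega inductive_iff)

lemma zsucc_omega [simp]: "n \<in> elts omega \<Longrightarrow> zsucc n \<in> elts omega"
  by (auto simp: elts_omega inductive_iff)

text \<open>
  The model may be nonstandard, so induction is available for definable predicates only.
\<close>

lemma omega_induct [consumes 1, case_names definable zero succ]:
  assumes n: "n \<in> elts omega"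
    and d: "definable (\<lambda>e. e 0 \<in> elts omega) (\<lambda>e. P (e 0))"
    and "P zempty" "\<And>n. n \<in> elts omega \<Longrightarrow> P n \<Longrightarrow> P (zsucc n)"
  shows "P n"
proof -
  have i: "internal {n \<in> elts omega. P n}" by (rule internal_separation[OF d])
  have "inductive_in_model (intern {n \<in> elts omega. P n})"
    unfolding inductive_iff elts_intern[OF i] using assms(3,4) by auto
  then have "n \<in> elts (intern {n \<in> elts omega. P n})" using n unfolding elts_omega by blast
  then show ?thesis using i by simp
qed

section \<open>Finite sets of the model\<close>

text \<open>
  Induction on the natural number \<open>n\<close> that is in bijection with the set; in the step to the
  successor of \<open>n\<close>, the image of \<open>n\<close> is removed.
\<close>

lemma zfinite_induct [consumes 1, case_names definable empty insert]:
  assumes "zfinite A"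
    and d: "definable (\<lambda>e. True) (\<lambda>e. P (e 0))"
    and empty: "P zempty" and insert: "\<And>A x. P A \<Longrightarrow> P (intern (insert x (elts A)))"
  shows "P A"
proof -
  have *: "\<forall>A f. zbij f n A \<longrightarrow> P A" if "n \<in> elts omega" for n
    using that
  proof (induction n rule: omega_induct)
    case definable
    have "definable (\<lambda>e. e (Suc (Suc 0)) \<in> elts omega \<and> zbij (e 0) (e (Suc (Suc 0))) (e (Suc 0))) (\<lambda>e. P (e (Suc 0)))"
      using definable_shift[where r = Suc, OF d] by simp
    then show ?case by (intro definable_intros)
  next
    case zero
    have "A = zempty" if "zbij f zempty A" for f A
      using that unfolding zbij_iff by (auto simp: eq_zempty_iff)
    then show ?case using empty by blast
  next
    case (succ n)
    show ?case
    proof (intro allI impI)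
      fix A f assume f: "zbij f (zsucc n) A"
      define A' where "A' = zdiff A (intern {zapp f n})"
      have ff: "zfun f (zsucc n) A" and inj: "\<And>x y. x \<in> elts (zsucc n) \<Longrightarrow> y \<in> elts (zsucc n) \<Longrightarrow> zapp f x = zapp f y \<Longrightarrow> x = y"
        and surj: "\<And>y. y \<in> elts A \<Longrightarrow> \<exists>x \<in> elts (zsucc n). zapp f x = y"
        using f unfolding zbij_iff by blast+
      have d': "definable_term (\<lambda>e. e 0 \<in> elts n) (\<lambda>e. zapp f (e 0))"
        using ff by (intro definable_intros) (auto intro: in_dom_zfun)
      have m: "zapp f x \<in> elts A'" if "x \<in> elts n" for x
      proof -
        have "zapp f x \<noteq> zapp f n" using inj[of x n] that not_mem_self[of n] by auto
        then show ?thesis using that zapp_in[OF ff, of x] by (auto simp: A'_def)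
      qed
      have "zbij (zlam n (zapp f)) n A'"
        unfolding zbij_iff
      proof (intro conjI ballI impI)
        show "zfun (zlam n (zapp f)) n A'" by (rule zfun_zlam[OF d' m])
        show "x = y" if "x \<in> elts n" "y \<in> elts n" "zapp (zlam n (zapp f)) x = zapp (zlam n (zapp f)) y" for x y
          using that inj[of x y] zapp_zlam[OF d' m] by auto
        show "\<exists>x \<in> elts n. zapp (zlam n (zapp f)) x = y" if "y \<in> elts A'" for y
          using that surj[of y] zapp_zlam[OF d' m] unfolding A'_def by auto
      qed
      then have "P A'" using succ by blast
      moreover have "intern (insert (zapp f n) (elts A')) = A"
        using zapp_in[OF ff, of n] by (auto simp: A'_def insert_absorb simp flip: elts_inject)
      ultimately show "P A" using insert[of A' "zapp f n"] by simp
    qed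
  qed
  then show ?thesis using assms(1) unfolding zfinite_def by blast
qed

lemma zfinite_zempty: "zfinite zempty"
proof -
  have "zbij zempty zempty zempty" by (simp add: zbij_iff zfun_def)
  then show ?thesis unfolding zfinite_def using zempty_omega by blast
qed

lemma definable_term_if [definable_intros]:
  assumes "definable G P" "definable_term (\<lambda>e. G e \<and> P e) s" "definable_term (\<lambda>e. G e \<and> \<not> P e) t"
  shows "definable_term G (\<lambda>e. if P e then s e else t e)"
proof -
  have "definable (\<lambda>e. G (tail e))
     (\<lambda>e. (P (tail e) \<longrightarrow> e 0 = s (tail e)) \<and> (\<not> P (tail e) \<longrightarrow> e 0 = t (tail e)))"
    by (intro definable_intros definable_shift[where r = Suc, OF assms(1)]
      definable_term_shift[where r = Suc, OF assms(2)] definable_term_shift[where r = Suc, OF assms(3)]) auto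
  then show ?thesis unfolding definable_term_def by (rule definable_cong) auto
qed

lemma zfinite_insert:
  assumes "zfinite A" shows "zfinite (intern (insert x (elts A)))"
proof (cases "x \<in> elts A")
  case True
  then show ?thesis using assms by (simp add: insert_absorb)
next
  case False
  obtain n f where n: "n \<in> elts omega" and f: "zbij f n A"
    using assms unfolding zfinite_def by blast
  have ff: "zfun f n A" and inj: "\<And>x y. x \<in> elts n \<Longrightarrow> y \<in> elts n \<Longrightarrow> zapp f x = zapp f y \<Longrightarrow> x = y"
      and surj: "\<And>y. y \<in> elts A \<Longrightarrow> \<exists>x \<in> elts n. zapp f x = y"
      using f unfolding zbij_iff by blast+
  define b where "b = (\<lambda>m. if m = n then x else zapp f m)"
  have d: "definable_term (\<lambda>e. e 0 \<in> elts (zsucc n)) (\<lambda>e. b (e 0))"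
    unfolding b_def by (intro definable_intros) (auto intro: in_dom_zfun[OF ff])
  have m: "b k \<in> elts (intern (insert x (elts A)))" if "k \<in> elts (zsucc n)" for k
    using that zapp_in[OF ff] by (auto simp: b_def)
  have "zbij (zlam (zsucc n) b) (zsucc n) (intern (insert x (elts A)))"
    unfolding zbij_iff
  proof (intro conjI ballI impI)
    show "zfun (zlam (zsucc n) b) (zsucc n) (intern (insert x (elts A)))" by (rule zfun_zlam[OF d m])
    show "k = l" if "k \<in> elts (zsucc n)" "l \<in> elts (zsucc n)"
      "zapp (zlam (zsucc n) b) k = zapp (zlam (zsucc n) b) l" for k l
    proof -
      have eq: "b k = b l" using that zapp_zlam[OF d m] by simp
      have new: "b j \<in> elts A" if "j \<in> elts n" for j
        using that zapp_in[OF ff, of j] not_mem_self[of n] by (auto simp: b_def)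
      consider "k = n" "l = n" | "k = n" "l \<in> elts n" | "k \<in> elts n" "l = n" | "k \<in> elts n" "l \<in> elts n"
        using \<open>k \<in> _\<close> \<open>l \<in> _\<close> by auto
      then show ?thesis
      proof cases
        case 2
        then show ?thesis using new[of l] False eq by (simp add: b_def)
      next
        case 3
        then show ?thesis using new[of k] False eq by (simp add: b_def)
      next
        case 4
        then have "k \<noteq> n" "l \<noteq> n" using not_mem_self[of n] by auto
        then show ?thesis using inj[of k l] eq 4 by (simp add: b_def)
      qed simp
    qed
    show "\<exists>k \<in> elts (zsucc n). zapp (zlam (zsucc n) b) k = y" if y: "y \<in> elts (intern (insert x (elts A)))" for y
    proof (cases "y = x")
      case True
      then show ?thesis using zapp_zlam[OF d m, of n] by (auto simp: b_def)
    next
      case F: False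
      then obtain k where "k \<in> elts n" "zapp f k = y" using y surj[of y] by auto
      moreover from this have "zapp (zlam (zsucc n) b) k = y"
        using zapp_zlam[OF d m, of k] not_mem_self[of n] by (auto simp: b_def)
      ultimately show ?thesis by auto
    qed
  qed
  then show ?thesis unfolding zfinite_def using zsucc_omega[OF n] by blast
qed

lemma zfinite_doubleton: "zfinite (intern {x, y})"
  using zfinite_insert[OF zfinite_insert[OF zfinite_zempty, of y], of x] by simp

text \<open>
  Both uses of finiteness below have this form: it turns the finite sets given by \<^bold>\<open>CMC\<close> into single
  sets, and finite subcovers into single members of a directed cover.
\<close>

lemma zUnion_zfinite_mem:
  assumes "zfinite F" "elts F \<subseteq> elts S" "elts F \<noteq> {}"
    and un: "\<And>A B. A \<in> elts S \<Longrightarrow> B \<in> elts S \<Longrightarrow> zUn A B \<in> elts S"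
  shows "zUnion F \<in> elts S"
proof -
  have "elts F \<subseteq> elts S \<longrightarrow> F = zempty \<or> zUnion F \<in> elts S"
    using assms(1)
  proof (induction F rule: zfinite_induct)
    case definable show ?case by (intro definable_intros)
  next
    case empty show ?case by simp
  next
    case (insert F x)
    have "zUnion (intern (insert x (elts F))) = (if F = zempty then x else zUn x (zUnion F))"
      by (intro ZF_extensionality) auto
    then show ?case using insert un[of x "zUnion F"] by auto
  qed
  then show ?thesis using assms by (auto simp: eq_zempty_iff)
qed


lemma definable_term_cong:
  assumes "definable_term G s" "\<And>e. G e \<Longrightarrow> s e = t e"
  shows "definable_term G t"
  using assms(1) unfolding definable_term_def by (rule definable_cong) (auto simp: assms(2))

lemma zbij_inverse:
  assumes f: "zbij f A B"
  obtains g where "zbij g B A" "\<And>x. x \<in> elts A \<Longrightarrow> zapp g (zapp f x) = x"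
    "\<And>y. y \<in> elts B \<Longrightarrow> zapp f (zapp g y) = y"
proof -
  have ff: "zfun f A B" and inj: "\<And>x y. x \<in> elts A \<Longrightarrow> y \<in> elts A \<Longrightarrow> zapp f x = zapp f y \<Longrightarrow> x = y"
    and surj: "\<And>y. y \<in> elts B \<Longrightarrow> \<exists>x \<in> elts A. zapp f x = y"
    using f unfolding zbij_iff by blast+
  define g where "g = (\<lambda>y. THE x. x \<in> elts A \<and> zapp f x = y)"
  have ex1: "\<exists>!x. x \<in> elts A \<and> zapp f x = y" if "y \<in> elts B" for y
    using surj[OF that] inj by blast
  have g: "g y \<in> elts A \<and> zapp f (g y) = y" if "y \<in> elts B" for y
    unfolding g_def by (rule theI'[OF ex1[OF that]])
  have d: "definable_term (\<lambda>e. e 0 \<in> elts B) (\<lambda>e. g (e 0))"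
    unfolding g_def
    by (rule definable_term_The, erule ex1, intro definable_intros) (erule in_dom_zfun[OF ff, OF conjunct2])
  have zg: "zfun (zlam B g) B A" by (rule zfun_zlam[OF d]) (use g in blast)
  have ag: "zapp (zlam B g) y = g y" if "y \<in> elts B" for y
    by (rule zapp_zlam[OF d _ that]) (use g in blast)
  have gf: "g (zapp f x) = x" if "x \<in> elts A" for x
    using g[OF zapp_in[OF ff that]] inj[of "g (zapp f x)" x] that by blast
  have "zbij (zlam B g) B A"
    unfolding zbij_iff
  proof (intro conjI ballI impI zg)
    fix y z assume "y \<in> elts B" "z \<in> elts B" "zapp (zlam B g) y = zapp (zlam B g) z"
    then show "y = z" using g ag by metis
  next
    fix x assume x: "x \<in> elts A"
    show "\<exists>y \<in> elts B. zapp (zlam B g) y = x"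
      using gf[OF x] ag[OF zapp_in[OF ff x]] zapp_in[OF ff x] by auto
  qed
  moreover have "zapp (zlam B g) (zapp f x) = x" if "x \<in> elts A" for x
    using ag[OF zapp_in[OF ff that]] gf[OF that] by simp
  moreover have "zapp f (zapp (zlam B g) y) = y" if "y \<in> elts B" for y
    using ag[OF that] g[OF that] by simp
  ultimately show thesis by (rule that)
qed

section \<open>The reals of the model as a linearly ordered field\<close>

text \<open>
  The carrier of \<open>R\<close> is identified with a type \<open>'r\<close> of class \<open>linordered_field\<close>: \<open>v\<close> takes an element
  of the carrier to its value in \<open>'r\<close>, and \<open>w\<close> goes back. Arithmetic is done in \<open>'r\<close>, where decision
  procedures work, and sets of the model are described through \<open>v\<close> and \<open>w\<close>. The type only serves
  this purpose; completeness still refers to subsets that belong to the model.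
\<close>

locale model_reals =
  fixes R :: "'a::ZF ord_ring" and v :: "'a \<Rightarrow> 'r::linordered_field" and w :: "'r \<Rightarrow> 'a"
  assumes complete: "complete_ordered_field R"
    and w_in [simp]: "w r \<in> carrier R"
    and v_w [simp]: "v (w r) = r"
    and w_v [simp]: "x \<in> carrier R \<Longrightarrow> w (v x) = x"
    and v_zero [simp]: "v \<zero>\<^bsub>R\<^esub> = 0"
    and v_one [simp]: "v \<one>\<^bsub>R\<^esub> = 1"
    and v_add [simp]: "x \<in> carrier R \<Longrightarrow> y \<in> carrier R \<Longrightarrow> v (x \<oplus>\<^bsub>R\<^esub> y) = v x + v y"
    and v_mult [simp]: "x \<in> carrier R \<Longrightarrow> y \<in> carrier R \<Longrightarrow> v (x \<otimes>\<^bsub>R\<^esub> y) = v x * v y"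
    and leq_iff: "x \<in> carrier R \<Longrightarrow> y \<in> carrier R \<Longrightarrow> leq R x y \<longleftrightarrow> v x \<le> v y"
begin

abbreviation Reals :: 'a where "Reals \<equiv> intern (carrier R)"

lemma internal_carrier [simp]: "internal (carrier R)"
proof -
  have "in_model R" using complete by (simp add: complete_ordered_field_def)
  then show ?thesis unfolding in_model_def by (metis internal_elts)
qed

lemma w_inject [simp]: "w r = w s \<longleftrightarrow> r = s"
  by (metis v_w)

lemma v_inject: "x \<in> carrier R \<Longrightarrow> y \<in> carrier R \<Longrightarrow> v x = v y \<longleftrightarrow> x = y"
  by (metis w_v)

lemma w_zero: "w 0 = \<zero>\<^bsub>R\<^esub>" and w_one: "w 1 = \<one>\<^bsub>R\<^esub>"
  and carrier_zero: "\<zero>\<^bsub>R\<^esub> \<in> carrier R" and carrier_one: "\<one>\<^bsub>R\<^esub> \<in> carrier R"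
  and carrier_add: "x \<in> carrier R \<Longrightarrow> y \<in> carrier R \<Longrightarrow> x \<oplus>\<^bsub>R\<^esub> y \<in> carrier R"
  and carrier_mult: "x \<in> carrier R \<Longrightarrow> y \<in> carrier R \<Longrightarrow> x \<otimes>\<^bsub>R\<^esub> y \<in> carrier R"
  and v_minus: "x \<in> carrier R \<Longrightarrow> y \<in> carrier R \<Longrightarrow> v (x \<ominus>\<^bsub>R\<^esub> y) = v x - v y"
  and carrier_minus: "x \<in> carrier R \<Longrightarrow> y \<in> carrier R \<Longrightarrow> x \<ominus>\<^bsub>R\<^esub> y \<in> carrier R"
  and v_uminus: "x \<in> carrier R \<Longrightarrow> v (\<ominus>\<^bsub>R\<^esub> x) = - v x"
  and carrier_uminus: "x \<in> carrier R \<Longrightarrow> \<ominus>\<^bsub>R\<^esub> x \<in> carrier R"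
proof -
  interpret field R using complete unfolding complete_ordered_field_def by blast
  show "w 0 = \<zero>\<^bsub>R\<^esub>" "w 1 = \<one>\<^bsub>R\<^esub>" using w_v[of "\<zero>\<^bsub>R\<^esub>"] w_v[of "\<one>\<^bsub>R\<^esub>"] by simp_all
  show "\<zero>\<^bsub>R\<^esub> \<in> carrier R" "\<one>\<^bsub>R\<^esub> \<in> carrier R" by simp_all
  show "x \<oplus>\<^bsub>R\<^esub> y \<in> carrier R" "x \<otimes>\<^bsub>R\<^esub> y \<in> carrier R" "x \<ominus>\<^bsub>R\<^esub> y \<in> carrier R"
    if "x \<in> carrier R" "y \<in> carrier R" for x y using that by auto
  show u: "v (\<ominus>\<^bsub>R\<^esub> x) = - v x" "\<ominus>\<^bsub>R\<^esub> x \<in> carrier R" if "x \<in> carrier R" for x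
  proof -
    show "\<ominus>\<^bsub>R\<^esub> x \<in> carrier R" using that by simp
    then have "v (\<ominus>\<^bsub>R\<^esub> x) + v x = v (\<ominus>\<^bsub>R\<^esub> x \<oplus>\<^bsub>R\<^esub> x)" using that by (intro v_add[symmetric])
    also have "\<dots> = 0" using that by (simp only: l_neg v_zero)
    finally show "v (\<ominus>\<^bsub>R\<^esub> x) = - v x" by (rule eq_neg_iff_add_eq_0[THEN iffD2])
  qed
  show "v (x \<ominus>\<^bsub>R\<^esub> y) = v x - v y" if "x \<in> carrier R" "y \<in> carrier R" for x y
    using that u by (simp add: a_minus_def)
qed

lemma v_absval: "x \<in> carrier R \<Longrightarrow> v (absval R x) = \<bar>v x\<bar>"
  and carrier_absval: "x \<in> carrier R \<Longrightarrow> absval R x \<in> carrier R"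
  by (auto simp: absval_def leq_iff carrier_zero v_uminus carrier_uminus)

lemma strictly_less_iff: "x \<in> carrier R \<Longrightarrow> y \<in> carrier R \<Longrightarrow> strictly_less R x y \<longleftrightarrow> v x < v y"
  by (auto simp: strictly_less_def leq_iff order_less_le v_inject)

text \<open>
  Definability of a term with values in \<open>'r\<close>, through its representative in the model.
\<close>

definition definable_real :: "((nat \<Rightarrow> 'a) \<Rightarrow> bool) \<Rightarrow> ((nat \<Rightarrow> 'a) \<Rightarrow> 'r) \<Rightarrow> bool" where
  "definable_real G t \<longleftrightarrow> definable_term G (\<lambda>e. w (t e))"

text \<open>
  The operations of \<open>R\<close> are HOL functions; the sets of the model that represent them make them
  definable.
\<close>

lemma operations_in_model:
  obtains p m l where "zfun p (ztimes Reals Reals) Reals" "zfun m (ztimes Reals Reals) Reals"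
    "\<And>r s. zapp p (zpair (w r) (w s)) = w (r + s)" "\<And>r s. zapp m (zpair (w r) (w s)) = w (r * s)"
    "\<And>r s. zpair (w r) (w s) \<in> elts l \<longleftrightarrow> r \<le> s"
proof -
  obtain C p m l where C: "elts C = carrier R"
    and pm: "zfun p (ztimes C C) C" "zfun m (ztimes C C) C"
    and ops: "\<And>x y. x \<in> elts C \<Longrightarrow> y \<in> elts C \<Longrightarrow>
           x \<oplus>\<^bsub>R\<^esub> y = zapp p (zpair x y) \<and> x \<otimes>\<^bsub>R\<^esub> y = zapp m (zpair x y) \<and>
           (leq R x y \<longleftrightarrow> zpair x y \<in> elts l)"
  proof -
    have "in_model R" using complete by (simp add: complete_ordered_field_def)
    then show thesis unfolding in_model_def by (elim exE conjE) (rule that; blast)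
  qed
  have "C = Reals" using intern_elts[of C] C by simp
  moreover have "zapp p (zpair (w r) (w s)) = w (r + s)" for r s
  proof -
    have "w (r + s) = w r \<oplus>\<^bsub>R\<^esub> w s"
      using w_v[OF carrier_add[OF w_in[of r] w_in[of s]]] by simp
    then show ?thesis using ops[of "w r" "w s"] C by simp
  qed
  moreover have "zapp m (zpair (w r) (w s)) = w (r * s)" for r s
  proof -
    have "w (r * s) = w r \<otimes>\<^bsub>R\<^esub> w s"
      using w_v[OF carrier_mult[OF w_in[of r] w_in[of s]]] by simp
    then show ?thesis using ops[of "w r" "w s"] C by simp
  qed
  moreover have "zpair (w r) (w s) \<in> elts l \<longleftrightarrow> r \<le> s" for r s
    using ops[of "w r" "w s"] C leq_iff[of "w r" "w s"] by simp
  ultimately show thesis using pm that by blast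
qed

lemma definable_real_const [definable_intros]: "definable_real G (\<lambda>e. c)"
  unfolding definable_real_def by (rule definable_term_const)

lemma definable_term_w [definable_intros]: "definable_real G t \<Longrightarrow> definable_term G (\<lambda>e. w (t e))"
  by (simp add: definable_real_def)

lemma definable_real_v [definable_intros]:
  assumes "definable_term G t" "\<And>e. G e \<Longrightarrow> t e \<in> carrier R"
  shows "definable_real G (\<lambda>e. v (t e))"
  unfolding definable_real_def by (rule definable_term_cong[OF assms(1)]) (simp add: assms(2))

lemma definable_real_shift:
  assumes "definable_real G t" "\<And>e. H e \<Longrightarrow> G (\<lambda>i. e (r i))"
  shows "definable_real H (\<lambda>e. t (\<lambda>i. e (r i)))"
  using definable_term_shift[of G "\<lambda>e. w (t e)" H r] assms by (simp add: definable_real_def)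

lemma definable_real_add [definable_intros]:
  assumes "definable_real G s" "definable_real G t"
  shows "definable_real G (\<lambda>e. s e + t e)"
proof -
  obtain p where p: "zfun p (ztimes Reals Reals) Reals" "\<And>r s. zapp p (zpair (w r) (w s)) = w (r + s)"
    using operations_in_model by metis
  have "definable_term G (\<lambda>e. zapp p (zpair (w (s e)) (w (t e))))"
    by (intro definable_intros assms) (auto intro!: in_dom_zfun[OF p(1)])
  then show ?thesis by (simp add: p(2) definable_real_def)
qed

lemma definable_real_mult [definable_intros]:
  assumes "definable_real G s" "definable_real G t"
  shows "definable_real G (\<lambda>e. s e * t e)"
proof -
  obtain p where p: "zfun p (ztimes Reals Reals) Reals" "\<And>r s. zapp p (zpair (w r) (w s)) = w (r * s)"
    using operations_in_model by metis
  have "definable_term G (\<lambda>e. zapp p (zpair (w (s e)) (w (t e))))"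
    by (intro definable_intros assms) (auto intro!: in_dom_zfun[OF p(1)])
  then show ?thesis by (simp add: p(2) definable_real_def)
qed

lemma definable_le [definable_intros]:
  assumes "definable_real G s" "definable_real G t"
  shows "definable G (\<lambda>e. s e \<le> t e)"
proof -
  obtain l where l: "\<And>r s. zpair (w r) (w s) \<in> elts l \<longleftrightarrow> r \<le> s"
    using operations_in_model by metis
  have "definable G (\<lambda>e. zpair (w (s e)) (w (t e)) \<in> elts l)"
    by (intro definable_intros assms)
  then show ?thesis by (simp add: l)
qed

lemma definable_less [definable_intros]:
  assumes "definable_real G s" "definable_real G t"
  shows "definable G (\<lambda>e. s e < t e)"
  unfolding not_le[symmetric] by (intro definable_intros assms)

lemma definable_real_eq [definable_intros]:
  assumes "definable_real G s" "definable_real G t"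
  shows "definable G (\<lambda>e. s e = t e)"
proof -
  have "definable G (\<lambda>e. w (s e) = w (t e))" by (intro definable_intros assms)
  then show ?thesis by simp
qed

lemma definable_real_uminus [definable_intros]:
  assumes "definable_real G t" shows "definable_real G (\<lambda>e. - t e)"
  using definable_real_mult[OF definable_real_const[of G "-1"] assms] by simp

lemma definable_real_diff [definable_intros]:
  assumes "definable_real G s" "definable_real G t"
  shows "definable_real G (\<lambda>e. s e - t e)"
  using definable_real_add[OF assms(1) definable_real_uminus[OF assms(2)]] by simp

lemma definable_real_abs [definable_intros]:
  assumes "definable_real G t" shows "definable_real G (\<lambda>e. \<bar>t e\<bar>)"
proof -
  have *: "definable_real (\<lambda>e. G e \<and> P e) t" for P
    using definable_real_shift[OF assms, of "\<lambda>e. G e \<and> P e" "\<lambda>i. i"] by simp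
  have "definable_term G (\<lambda>e. if t e < 0 then w (- t e) else w (t e))"
    by (intro definable_intros assms *)
  then show ?thesis unfolding definable_real_def by (rule definable_term_cong) (auto simp: abs_if)
qed

lemma definable_real_inverse [definable_intros]:
  assumes "definable_real G t" shows "definable_real G (\<lambda>e. inverse (t e))"
proof -
  have "definable_term G (\<lambda>e. THE x. x \<in> elts Reals \<and> (if t e = 0 then v x = 0 else t e * v x = 1))"
  proof (rule definable_term_The)
    fix e
    show "\<exists>!x. x \<in> elts Reals \<and> (if t e = 0 then v x = 0 else t e * v x = 1)"
    proof (rule ex1I[of _ "w (inverse (t e))"])
      fix x assume x: "x \<in> elts Reals \<and> (if t e = 0 then v x = 0 else t e * v x = 1)"
      then have "v x = inverse (t e)" by (auto split: if_splits simp: field_simps)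
      then show "x = w (inverse (t e))" using x w_v[of x] by simp
    qed auto
  next
    show "definable (\<lambda>e. G (tail e)) (\<lambda>e. e 0 \<in> elts Reals \<and>
        (if t (tail e) = 0 then v (e 0) = 0 else t (tail e) * v (e 0) = 1))"
      unfolding if_bool_eq_conj
      by (intro definable_intros definable_real_shift[OF assms]) auto
  qed
  moreover have "(THE x. x \<in> elts Reals \<and> (if r = 0 then v x = 0 else r * v x = 1)) = w (inverse r)" for r
  proof (rule the_equality)
    fix x assume x: "x \<in> elts Reals \<and> (if r = 0 then v x = 0 else r * v x = 1)"
    then have "v x = inverse r" by (auto split: if_splits simp: field_simps)
    then show "x = w (inverse r)" using x w_v[of x] by simp
  qed auto
  ultimately show ?thesis by (simp add: definable_real_def)
qed

definition rv :: "'a \<Rightarrow> 'a \<Rightarrow> 'r" where "rv f x = v (zapp f x)"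

definition real_at :: "'a \<Rightarrow> 'a \<Rightarrow> bool" where
  "real_at f x \<longleftrightarrow> in_dom f x \<and> zapp f x \<in> carrier R"

lemma real_at_zfun: "zfun f A Reals \<Longrightarrow> x \<in> elts A \<Longrightarrow> real_at f x"
  using in_dom_zfun zapp_in[of f A Reals x] by (auto simp: real_at_def)

lemma definable_real_rv [definable_intros]:
  assumes "definable_term G f" "definable_term G x" "\<And>e. G e \<Longrightarrow> real_at (f e) (x e)"
  shows "definable_real G (\<lambda>e. rv (f e) (x e))"
  unfolding rv_def by (intro definable_intros assms) (use assms(3) in \<open>auto simp: real_at_def\<close>)

lemma supremum:
  assumes "internal S" "S \<subseteq> carrier R" "S \<noteq> {}" "\<And>x. x \<in> S \<Longrightarrow> v x \<le> b"
  obtains s where "is_lub R S s"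
proof -
  have "\<exists>b \<in> carrier R. \<forall>x \<in> S. leq R x b"
    using assms by (intro bexI[of _ "w b"]) (auto simp: leq_iff subset_iff)
  moreover have "\<forall>A. elts A \<subseteq> carrier R \<and> A \<noteq> zempty \<and>
      (\<exists>b \<in> carrier R. \<forall>x \<in> elts A. leq R x b) \<longrightarrow> (\<exists>s. is_lub R (elts A) s)"
    using complete unfolding complete_ordered_field_def by (elim conjE)
  ultimately have "\<exists>s. is_lub R (elts (intern S)) s"
    using assms(1-3) by (metis elts_intern eq_zempty_iff)
  then show thesis using that assms by auto
qed

lemma is_lub_iff:
  assumes "S \<subseteq> carrier R"
  shows "is_lub R S s \<longleftrightarrow> s \<in> carrier R \<and> (\<forall>x \<in> S. v x \<le> v s) \<and> (\<forall>b. (\<forall>x \<in> S. v x \<le> b) \<longrightarrow> v s \<le> b)"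
proof -
  have "leq R x y \<longleftrightarrow> v x \<le> v y" if "x \<in> S" "y \<in> carrier R" for x y
    using that assms leq_iff by blast
  then show ?thesis unfolding is_lub_def by (metis leq_iff v_w w_in)
qed

subsection \<open>The natural numbers among the reals\<close>

text \<open>
  The natural numbers as reals, defined by leastness. They replace \<open>omega\<close> as an index set because order, addition and multiplication on it come from the field.
\<close>

definition nats :: 'a where
  "nats = intern {x \<in> elts Reals. \<forall>S. w 0 \<in> elts S \<and>
     (\<forall>y \<in> elts Reals. y \<in> elts S \<longrightarrow> w (v y + 1) \<in> elts S) \<longrightarrow> x \<in> elts S}"

definition isnat :: "'r \<Rightarrow> bool" where "isnat r \<longleftrightarrow> w r \<in> elts nats"

lemma elts_nats: "elts nats = {x \<in> elts Reals. \<forall>S. w 0 \<in> elts S \<and>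
     (\<forall>y \<in> elts Reals. y \<in> elts S \<longrightarrow> w (v y + 1) \<in> elts S) \<longrightarrow> x \<in> elts S}"
  unfolding nats_def by (intro elts_intern internal_separation definable_intros) auto

lemma nats_carrier: "x \<in> elts nats \<Longrightarrow> x \<in> carrier R"
  by (simp add: elts_nats)

lemma isnat_v: "x \<in> elts nats \<Longrightarrow> isnat (v x)"
  by (simp add: isnat_def nats_carrier)

lemma isnat_0 [simp]: "isnat 0"
  by (simp add: isnat_def elts_nats)

lemma isnat_Suc: "isnat r \<Longrightarrow> isnat (r + 1)"
  unfolding isnat_def elts_nats by (auto, metis v_w w_in)

lemma isnat_induct [consumes 1, case_names definable zero Suc]:
  assumes r: "isnat r" and d: "definable (\<lambda>e. e 0 \<in> elts nats) (\<lambda>e. P (v (e 0)))"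
    and 0: "P 0" and Suc: "\<And>r. isnat r \<Longrightarrow> P r \<Longrightarrow> P (r + 1)"
  shows "P r"
proof -
  have i: "internal {x \<in> elts nats. P (v x)}" by (rule internal_separation[OF d])
  have "w 0 \<in> {x \<in> elts nats. P (v x)}" using 0 isnat_0 by (simp add: isnat_def)
  moreover have "w (v y + 1) \<in> {x \<in> elts nats. P (v x)}" if "y \<in> {x \<in> elts nats. P (v x)}" for y
    using that Suc isnat_Suc[OF isnat_v, of y] isnat_v[of y] by (auto simp: isnat_def)
  ultimately have "w 0 \<in> elts (intern {x \<in> elts nats. P (v x)}) \<and>
     (\<forall>y \<in> elts Reals. y \<in> elts (intern {x \<in> elts nats. P (v x)}) \<longrightarrow>
        w (v y + 1) \<in> elts (intern {x \<in> elts nats. P (v x)}))"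
    unfolding elts_intern[OF i] by blast
  then have "w r \<in> elts (intern {x \<in> elts nats. P (v x)})"
    using r unfolding isnat_def elts_nats by blast
  then show ?thesis using i by simp
qed

end


lemma zlam_cong: "(\<And>x. x \<in> elts A \<Longrightarrow> b x = c x) \<Longrightarrow> zlam A b = zlam A c"
  unfolding zlam_def by (rule arg_cong[of _ _ intern]) auto

context model_reals begin

lemma definable_isnat [definable_intros]:
  "definable_real G t \<Longrightarrow> definable G (\<lambda>e. isnat (t e))"
  unfolding isnat_def by (intro definable_intros)

lemma isnat_nonneg: "isnat r \<Longrightarrow> 0 \<le> r"
proof (induction r rule: isnat_induct)
  case definable
  show ?case by (intro definable_intros) (rule nats_carrier)
qed auto

lemma isnat_pred:
  assumes "isnat r" "r \<noteq> 0" shows "isnat (r - 1)"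
proof -
  have "r = 0 \<or> isnat (r - 1)" using assms(1)
  proof (induction r rule: isnat_induct)
    case definable
    show ?case by (intro definable_intros) (auto intro: nats_carrier)
  qed auto
  then show ?thesis using assms by simp
qed

lemma isnat_less: "isnat n \<Longrightarrow> isnat m \<Longrightarrow> m < n \<Longrightarrow> m + 1 \<le> n"
proof -
  have "\<forall>x \<in> elts nats. v x < n \<longrightarrow> v x + 1 \<le> n" if "isnat n" for n
    using that
  proof (induction n rule: isnat_induct)
    case definable
    show ?case by (intro definable_intros) (auto intro: nats_carrier)
  next
    case zero
    then show ?case using isnat_nonneg isnat_v by fastforce
  next
    case (Suc n)
    show ?case
    proof (intro ballI impI)
      fix x assume x: "x \<in> elts nats" "v x < n + 1"
      show "v x + 1 \<le> n + 1"
      proof (cases "v x = 0")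
        case False
        then have "w (v x - 1) \<in> elts nats" using isnat_pred isnat_v[OF x(1)] by (auto simp: isnat_def)
        then show ?thesis using Suc(2) x by fastforce
      qed (use isnat_nonneg[OF Suc(1)] in auto)
    qed
  qed
  then show "isnat n \<Longrightarrow> isnat m \<Longrightarrow> m < n \<Longrightarrow> m + 1 \<le> n"
    unfolding isnat_def by force
qed

lemma isnat_add: assumes "isnat n" "isnat m" shows "isnat (m + n)"
  using assms(1)
proof (induction n rule: isnat_induct)
  case definable
  show ?case by (intro definable_intros) (auto intro: nats_carrier)
next
  case (Suc r)
  then show ?case using isnat_Suc[of "m + r"] by (simp add: add.assoc)
qed (use assms in simp)

lemma isnat_mult: assumes "isnat n" "isnat m" shows "isnat (m * n)"
  using assms(1)
proof (induction n rule: isnat_induct)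
  case definable
  show ?case by (intro definable_intros) (auto intro: nats_carrier)
next
  case (Suc r)
  then show ?case using isnat_add[OF assms(2), of "m * r"] by (simp add: algebra_simps)
qed simp

text \<open>
  If \<open>nats\<close> were bounded, its supremum \<open>s\<close> would be at most \<open>s - 1\<close>, since \<open>x + 1\<close> is in \<open>nats\<close> with \<open>x\<close>.
\<close>

lemma archimedes: obtains n where "isnat n" "r < n"
proof (rule ccontr)
  assume "\<not> thesis"
  then have b: "v x \<le> r" if "x \<in> elts nats" for x
    using that isnat_v[of x] \<open>\<And>n. isnat n \<Longrightarrow> r < n \<Longrightarrow> thesis\<close> by fastforce
  have sub: "elts nats \<subseteq> carrier R" using nats_carrier by auto
  have "elts nats \<noteq> {}" using isnat_0 unfolding isnat_def by auto
  then obtain s where "is_lub R (elts nats) s"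
    using supremum[OF internal_elts sub _ b] by blast
  then have s: "\<And>x. x \<in> elts nats \<Longrightarrow> v x \<le> v s" "\<And>b. (\<And>x. x \<in> elts nats \<Longrightarrow> v x \<le> b) \<Longrightarrow> v s \<le> b"
    unfolding is_lub_iff[OF sub] by blast+
  have "v x \<le> v s - 1" if "x \<in> elts nats" for x
    using s(1)[of "w (v x + 1)"] isnat_Suc[OF isnat_v[OF that]] by (simp add: isnat_def algebra_simps)
  then have "v s \<le> v s - 1" by (rule s(2))
  then show False by simp
qed

text \<open>
  An injective pairing function on \<open>nats\<close>: with \<open>k = m + n\<close>, the value lies in \<open>[k\<^sup>2, (k + 1)\<^sup>2)\<close>, which
  determines \<open>k\<close> and then \<open>m\<close>.
\<close>

definition pair_code :: "'r \<Rightarrow> 'r \<Rightarrow> 'r" where "pair_code m n = (m + n) * (m + n) + m"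

lemma isnat_pair_code: "isnat m \<Longrightarrow> isnat n \<Longrightarrow> isnat (pair_code m n)"
  unfolding pair_code_def by (intro isnat_add isnat_mult)

lemma pair_code_inject:
  assumes n: "isnat m" "isnat n" "isnat m'" "isnat n'" and eq: "pair_code m n = pair_code m' n'"
  shows "m = m' \<and> n = n'"
proof -
  have lt: "pair_code m n < pair_code m' n'"
    if "isnat m" "isnat n" "isnat m'" "isnat n'" "m + n < m' + n'" for m n m' n'
  proof -
    have nn: "0 \<le> m" "0 \<le> n" "0 \<le> m'" "0 \<le> n'" using that isnat_nonneg by auto
    have "m + n + 1 \<le> m' + n'" using that isnat_less isnat_add by blast
    then have "(m + n + 1) * (m + n + 1) \<le> (m' + n') * (m' + n')"
      using nn by (intro mult_mono) auto
    then show ?thesis using nn unfolding pair_code_def by (simp add: algebra_simps)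
  qed
  have "m + n = m' + n'" using lt[OF n] lt[OF n(3,4,1,2)] eq by (metis linorder_neqE not_less_iff_gr_or_eq)
  then show ?thesis using eq by (simp add: pair_code_def)
qed

text \<open>
  The bijection \<open>n \<mapsto> n\<close> is defined by recursion, that is, as the least relation \<open>E\<close> containing \<open>(0, 0)\<close>
  and closed under \<open>(n, x) \<mapsto> (n + 1, x + 1)\<close>. Leastness gives inversion: every pair of \<open>E\<close> arises in
  one of these two ways. Inversion makes all four properties of a bijection provable by induction,
  on \<open>omega\<close> for totality and uniqueness of values, and on \<open>nats\<close> for surjectivity and injectivity.
\<close>

lemma omega_nats_bij: obtains h where "zbij h omega nats"
proof -
  let ?S = "{p \<in> elts (ztimes omega nats). \<forall>S.
    zpair zempty (w 0) \<in> elts S \<and> (\<forall>n \<in> elts omega. \<forall>x \<in> elts nats.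
      zpair n x \<in> elts S \<longrightarrow> zpair (zsucc n) (w (v x + 1)) \<in> elts S) \<longrightarrow> p \<in> elts S}"
  define E :: 'a where "E = intern ?S"
  have E: "elts E = ?S"
    unfolding E_def by (intro elts_intern internal_separation definable_intros) (auto intro: nats_carrier)
  have w0: "w 0 \<in> elts nats" using isnat_0 by (simp add: isnat_def)
  have wS: "w (v x + 1) \<in> elts nats" if "x \<in> elts nats" for x
    using isnat_Suc[OF isnat_v[OF that]] by (simp add: isnat_def)
  have zero: "zpair zempty (w 0) \<in> elts E" unfolding E using w0 by auto
  have step: "zpair (zsucc n) (w (v x + 1)) \<in> elts E" if "zpair n x \<in> elts E" for n x
  proof -
    have nx: "n \<in> elts omega" "x \<in> elts nats" using that unfolding E by auto
    then have "zpair (zsucc n) (w (v x + 1)) \<in> elts (ztimes omega nats)" using wS by auto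
    then show ?thesis using that nx unfolding E by blast
  qed
  have inv: "(n = zempty \<and> x = w 0) \<or> (\<exists>m y. zpair m y \<in> elts E \<and> n = zsucc m \<and> x = w (v y + 1))"
    if "zpair n x \<in> elts E" for n x
  proof -
    let ?P = "\<lambda>p. p = zpair zempty (w 0) \<or> (\<exists>m \<in> elts omega. \<exists>y \<in> elts nats. zpair m y \<in> elts E \<and> p = zpair (zsucc m) (w (v y + 1)))"
    have i: "internal {p \<in> elts (ztimes omega nats). ?P p}"
      by (intro internal_separation definable_intros) (auto intro: nats_carrier)
    have sub: "{p \<in> elts (ztimes omega nats). ?P p} \<subseteq> elts E" using zero step by auto
    have "zpair zempty (w 0) \<in> elts (intern {p \<in> elts (ztimes omega nats). ?P p}) \<and>
      (\<forall>n \<in> elts omega. \<forall>x \<in> elts nats. zpair n x \<in> elts (intern {p \<in> elts (ztimes omega nats). ?P p}) \<longrightarrow>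
         zpair (zsucc n) (w (v x + 1)) \<in> elts (intern {p \<in> elts (ztimes omega nats). ?P p}))"
      unfolding elts_intern[OF i]
    proof (intro conjI ballI impI)
      show "zpair zempty (w 0) \<in> {p \<in> elts (ztimes omega nats). ?P p}" using w0 by auto
      fix n x assume nx: "n \<in> elts omega" "x \<in> elts nats" "zpair n x \<in> {p \<in> elts (ztimes omega nats). ?P p}"
      then have "zpair n x \<in> elts E" using sub by blast
      moreover have "zpair (zsucc n) (w (v x + 1)) \<in> elts (ztimes omega nats)"
        using nx wS by auto
      ultimately show "zpair (zsucc n) (w (v x + 1)) \<in> {p \<in> elts (ztimes omega nats). ?P p}"
        using nx(1,2) by blast
    qed
    then have "zpair n x \<in> elts (intern {p \<in> elts (ztimes omega nats). ?P p})"
      using that unfolding E by blast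
    then show ?thesis unfolding elts_intern[OF i] by auto
  qed
  have tot: "\<exists>x \<in> elts nats. zpair n x \<in> elts E" if "n \<in> elts omega" for n
    using that
  proof (induction n rule: omega_induct)
    case definable show ?case by (intro definable_intros)
  qed (use zero w0 step wS in blast)+
  have fn: "\<forall>x \<in> elts nats. \<forall>y \<in> elts nats. zpair n x \<in> elts E \<longrightarrow> zpair n y \<in> elts E \<longrightarrow> x = y" if "n \<in> elts omega" for n
    using that
  proof (induction n rule: omega_induct)
    case definable show ?case by (intro definable_intros)
  next
    case zero
    have "x = w 0" if "zpair zempty x \<in> elts E" for x using inv[OF that] by simp
    then show ?case by blast
  next
    case (succ n)
    show ?case
    proof (intro ballI impI)
      fix x y assume xy: "zpair (zsucc n) x \<in> elts E" "zpair (zsucc n) y \<in> elts E"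
      have "\<exists>y. zpair n y \<in> elts E \<and> x = w (v y + 1)" if "zpair (zsucc n) x \<in> elts E" for x
        using inv[OF that] by auto
      with xy obtain x' y' where xy: "zpair n x' \<in> elts E" "x = w (v x' + 1)" "zpair n y' \<in> elts E" "y = w (v y' + 1)"
        by blast
      then have "x' \<in> elts nats" "y' \<in> elts nats" unfolding E by auto
      then show "x = y" using succ xy by blast
    qed
  qed
  have sur: "\<exists>n \<in> elts omega. zpair n (w r) \<in> elts E" if "isnat r" for r
    using that
  proof (induction r rule: isnat_induct)
    case definable show ?case by (intro definable_intros) (auto intro: nats_carrier)
  next
    case (Suc r)
    then obtain n where "n \<in> elts omega" "zpair n (w r) \<in> elts E" by blast
    then show ?case using step[of n "w r"] zsucc_omega by auto
  qed (use zero in auto)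
  have inj: "\<forall>m \<in> elts omega. \<forall>n \<in> elts omega. zpair m (w r) \<in> elts E \<longrightarrow> zpair n (w r) \<in> elts E \<longrightarrow> m = n" if "isnat r" for r
    using that
  proof (induction r rule: isnat_induct)
    case definable show ?case by (intro definable_intros) (auto intro: nats_carrier)
  next
    case zero
    have "m = zempty" if e: "zpair m (w 0) \<in> elts E" for m
    proof (rule ccontr)
      assume "m \<noteq> zempty"
      then obtain k y where "zpair k y \<in> elts E" "(0::'r) = v y + 1" using inv[OF e] by auto
      then have "isnat (v y)" "(0::'r) = v y + 1" unfolding E using isnat_v by auto
      then show False using isnat_nonneg[of "v y"] by simp
    qed
    then show ?case by blast
  next
    case (Suc r)
    have "\<exists>k. zpair k (w r) \<in> elts E \<and> m = zsucc k" if e: "zpair m (w (r + 1)) \<in> elts E" for m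
    proof -
      have "r + 1 \<noteq> 0" using isnat_nonneg[OF Suc(1)] by auto
      then obtain k y where k: "zpair k y \<in> elts E" "m = zsucc k" "w (r + 1) = w (v y + 1)" using inv[OF e] by auto
      moreover have "y \<in> carrier R" using k(1) nats_carrier unfolding E by auto
      then have "y = w r" using k(3) w_v[of y] by simp
      ultimately show ?thesis by blast
    qed
    note pred = this
    have dom: "k \<in> elts omega" if "zpair k x \<in> elts E" for k x using that unfolding E by auto
    show ?case
    proof (intro ballI impI)
      fix m n assume "zpair m (w (r + 1)) \<in> elts E" "zpair n (w (r + 1)) \<in> elts E"
      then obtain k l where kl: "zpair k (w r) \<in> elts E" "m = zsucc k" "zpair l (w r) \<in> elts E" "n = zsucc l"
        using pred by meson
      then show "m = n" using Suc(2) dom by blast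
    qed
  qed
  have f: "zfun E omega nats"
    unfolding zfun_def
  proof (intro conjI ballI)
    show "elts E \<subseteq> elts (ztimes omega nats)" unfolding E by auto
    fix n assume n: "n \<in> elts (omega :: 'a)"
    have "x \<in> elts nats" if "zpair n x \<in> elts E" for x using that unfolding E by auto
    then show "\<exists>!x. zpair n x \<in> elts E" using tot[OF n] fn[OF n] by blast
  qed
  have "zbij E omega nats"
    unfolding zbij_iff
  proof (intro conjI f ballI impI)
    fix m n assume mn: "m \<in> elts omega" "n \<in> elts omega" "zapp E m = zapp E n"
    have "isnat (v (zapp E n))" using zapp_in[OF f mn(2)] isnat_v by blast
    moreover have "w (v (zapp E n)) = zapp E n" using zapp_in[OF f mn(2)] nats_carrier by auto
    ultimately show "m = n"
      using inj[of "v (zapp E n)"] zfun_pair_iff[OF f mn(1), of "zapp E n"] zfun_pair_iff[OF f mn(2), of "zapp E n"] mn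
      by auto
  next
    fix x assume x: "x \<in> elts nats"
    then obtain n where n: "n \<in> elts omega" "zpair n (w (v x)) \<in> elts E" using sur[OF isnat_v[OF x]] by blast
    then have "zapp E n = x" using zfun_pair_iff[OF f n(1), of x] nats_carrier[OF x] by simp
    then show "\<exists>n \<in> elts omega. zapp E n = x" using n(1) by blast
  qed
  then show thesis by (rule that)
qed

end


section \<open>Open and clopen sets\<close>

lemma topology_zUnion: "topology_on X T \<Longrightarrow> elts S \<subseteq> elts T \<Longrightarrow> zUnion S \<in> elts T"
  and topology_zinter: "topology_on X T \<Longrightarrow> A \<in> elts T \<Longrightarrow> B \<in> elts T \<Longrightarrow> zinter A B \<in> elts T"
  and topology_space: "topology_on X T \<Longrightarrow> X \<in> elts T"
  and topology_zempty: "topology_on X T \<Longrightarrow> zempty \<in> elts T"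
  and topology_subset: "topology_on X T \<Longrightarrow> A \<in> elts T \<Longrightarrow> elts A \<subseteq> elts X"
  by (simp_all add: topology_on_def)

lemma topology_zUn:
  assumes "topology_on X T" "A \<in> elts T" "B \<in> elts T" shows "zUn A B \<in> elts T"
proof -
  have "zUnion (intern {A, B}) \<in> elts T" using assms by (intro topology_zUnion) auto
  moreover have "zUnion (intern {A, B}) = zUn A B" by (intro ZF_extensionality) auto
  ultimately show ?thesis by simp
qed

text \<open>
  The set \<open>G\<close> is the union of all open sets contained in it; no neighbourhoods are chosen.
\<close>

lemma open_locally:
  assumes T: "topology_on X T" and loc: "\<And>x. x \<in> elts G \<Longrightarrow> \<exists>W \<in> elts T. x \<in> elts W \<and> elts W \<subseteq> elts G"
  shows "G \<in> elts T"
proof -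
  let ?S = "{W \<in> elts T. elts W \<subseteq> elts G}"
  define S where "S = intern ?S"
  have S: "elts S = ?S"
    unfolding S_def by (intro elts_intern internal_separation definable_intros)
  have "zUnion S = G"
    by (rule ZF_extensionality, unfold elts_zUnion S) (use loc in blast)
  moreover have "zUnion S \<in> elts T" by (intro topology_zUnion[OF T]) (auto simp: S)
  ultimately show ?thesis by simp
qed

lemma clopen_iff:
  "topology_on X T \<Longrightarrow> clopen_in X T A \<longleftrightarrow> A \<in> elts T \<and> zdiff X A \<in> elts T"
  by (auto simp: clopen_in_def dest: topology_subset)

lemma clopen_zempty: "topology_on X T \<Longrightarrow> clopen_in X T zempty"
proof -
  assume T: "topology_on X T"
  have "zdiff X zempty = X" by (intro ZF_extensionality) simp
  then show ?thesis using T by (simp add: clopen_iff topology_space topology_zempty)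
qed

lemma clopen_complement:
  assumes "topology_on X T" "clopen_in X T A" shows "clopen_in X T (zdiff X A)"
proof -
  have "zdiff X (zdiff X A) = A" using assms(2) by (intro ZF_extensionality) (auto simp: clopen_in_def)
  then show ?thesis using assms by (simp add: clopen_iff)
qed

lemma clopen_zinter:
  assumes T: "topology_on X T" and "clopen_in X T A" "clopen_in X T B" shows "clopen_in X T (zinter A B)"
proof -
  have "zdiff X (zinter A B) = zUn (zdiff X A) (zdiff X B)" by (intro ZF_extensionality) auto
  then show ?thesis using assms by (simp add: clopen_iff topology_zUn topology_zinter)
qed

lemma clopen_zUn:
  assumes T: "topology_on X T" and "clopen_in X T A" "clopen_in X T B" shows "clopen_in X T (zUn A B)"
proof -
  have "zdiff X (zUn A B) = zinter (zdiff X A) (zdiff X B)" by (intro ZF_extensionality) auto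
  then show ?thesis using assms by (simp add: clopen_iff topology_zUn topology_zinter)
qed

lemma clopen_zdiff:
  assumes T: "topology_on X T" and "clopen_in X T A" "clopen_in X T B" shows "clopen_in X T (zdiff A B)"
proof -
  have "zdiff A B = zinter A (zdiff X B)"
    using assms(2) by (intro ZF_extensionality) (auto simp: clopen_in_def)
  then show ?thesis using assms by (simp add: clopen_zinter clopen_complement)
qed

definition clopens :: "'a::ZF \<Rightarrow> 'a \<Rightarrow> 'a" where
  "clopens X T = intern {A. clopen_in X T A}"

lemma definable_clopen [definable_intros]:
  "definable_term G A \<Longrightarrow> definable G (\<lambda>e. clopen_in X T (A e))"
  unfolding clopen_in_def by (intro definable_intros) (auto elim: definable_term_weaken)

lemma elts_clopens [simp]: "elts (clopens X T) = {A. clopen_in X T A}"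
proof -
  have "{A. clopen_in X T A} = {A \<in> elts T. clopen_in X T A}" by (auto simp: clopen_in_def)
  then show ?thesis unfolding clopens_def by (rule elts_intern_eqI) (intro definable_intros)
qed

section \<open>Choosing sequences of clopen sets with CMC\<close>

locale cmc_space = model_reals R v w
  for R :: "'a::ZF ord_ring" and v :: "'a \<Rightarrow> 'r::linordered_field" and w :: "'r \<Rightarrow> 'a" +
  fixes X T :: 'a
  assumes top: "topology_on X T" and cmc: "CMC TYPE('a)"
begin

abbreviation clopen :: "'a \<Rightarrow> bool" where "clopen \<equiv> clopen_in X T"

lemma clopen_subset: "clopen D \<Longrightarrow> elts D \<subseteq> elts X"
  by (simp add: clopen_in_def)

text \<open>
  The only use of \<^bold>\<open>CMC\<close>. It provides finite non-empty sets of candidates for each \<open>n\<close>; since the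
  property in question is closed under binary unions, the union of such a finite set is again a
  candidate, and this choice is canonical.
\<close>

lemma nat_indexed_choice:
  fixes \<Phi> :: "'r \<Rightarrow> 'a \<Rightarrow> bool"
  assumes d: "definable (\<lambda>e. e 0 \<in> elts nats \<and> e (Suc 0) \<in> elts S) (\<lambda>e. \<Phi> (v (e 0)) (e (Suc 0)))"
    and ex: "\<And>n. isnat n \<Longrightarrow> \<exists>D \<in> elts S. \<Phi> n D"
    and un: "\<And>n D E. isnat n \<Longrightarrow> D \<in> elts S \<Longrightarrow> E \<in> elts S \<Longrightarrow> \<Phi> n D \<Longrightarrow> \<Phi> n E \<Longrightarrow>
      zUn D E \<in> elts S \<and> \<Phi> n (zUn D E)"
  obtains F where "zfun F nats S" "\<And>n. isnat n \<Longrightarrow> \<Phi> n (zapp F (w n))"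
proof -
  obtain h where h: "zbij h omega nats" by (rule omega_nats_bij)
  obtain g where g: "zbij g nats omega" "\<And>y. y \<in> elts nats \<Longrightarrow> zapp h (zapp g y) = y"
    using zbij_inverse[OF h] by metis
  have hf: "zfun h omega nats" and gf: "zfun g nats omega" using h g(1) unfolding zbij_iff by blast+
  define A where "A = (\<lambda>k. intern {D \<in> elts S. \<Phi> (v (zapp h k)) D})"
  have A: "elts (A k) = {D \<in> elts S. \<Phi> (v (zapp h k)) D}" if k: "k \<in> elts omega" for k
  proof -
    have "zapp h k \<in> elts nats" using zapp_in[OF hf k] .
    then have "definable (\<lambda>e. e 0 \<in> elts S) (\<lambda>e. \<Phi> (v (zapp h k)) (e 0))"
      using definable_subst[where P = "\<lambda>e x. \<Phi> (v x) (e 0)" and t = "\<lambda>_. zapp h k" and G = "\<lambda>e. e 0 \<in> elts S",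
          OF definable_term_const] definable_weaken[OF d, of "\<lambda>e. e (Suc 0) \<in> elts S \<and> e 0 = zapp h k"] by simp
    then show ?thesis unfolding A_def by (intro elts_intern internal_separation)
  qed
  have dA: "definable_term (\<lambda>e. e 0 \<in> elts omega) (\<lambda>e. A (e 0))"
    unfolding A_def
  proof (rule definable_term_separation[OF definable_term_const])
    show "definable (\<lambda>e. e (Suc 0) \<in> elts omega \<and> e 0 \<in> elts S) (\<lambda>e. \<Phi> (v (zapp h (e (Suc 0)))) (e 0))"
    proof (rule definable_subst[where P = "\<lambda>e x. \<Phi> (v x) (e 0)"])
      show "definable_term (\<lambda>e. e (Suc 0) \<in> elts omega \<and> e 0 \<in> elts S) (\<lambda>e. zapp h (e (Suc 0)))"
        by (intro definable_intros) (auto intro: in_dom_zfun[OF hf])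
    qed (rule definable_weaken[OF d], use zapp_in[OF hf] in auto)
  qed
  have A_Pow: "A k \<in> elts (zPow S)" if "k \<in> elts omega" for k using A[OF that] by auto
  have Az: "zapp (zlam omega A) k = A k" if "k \<in> elts omega" for k
    by (rule zapp_zlam[OF dA A_Pow that])
  have "A k \<noteq> zempty" if k: "k \<in> elts omega" for k
    using ex[OF isnat_v[OF zapp_in[OF hf k]]] A[OF k] by (auto simp: eq_zempty_iff)
  then obtain F C where F: "zfun F omega C" and F': "\<And>k. k \<in> elts omega \<Longrightarrow>
      zapp F k \<noteq> zempty \<and> zfinite (zapp F k) \<and> elts (zapp F k) \<subseteq> elts (A k)"
    using cmc zfun_zlam[OF dA A_Pow] Az unfolding CMC_def by (metis (no_types, lifting))
  have U: "zUnion (zapp F k) \<in> elts (A k)" if k: "k \<in> elts omega" for k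
  proof (rule zUnion_zfinite_mem)
    show "zfinite (zapp F k)" "elts (zapp F k) \<subseteq> elts (A k)" "elts (zapp F k) \<noteq> {}"
      using F'[OF k] by (auto simp: eq_zempty_iff)
    show "zUn D E \<in> elts (A k)" if "D \<in> elts (A k)" "E \<in> elts (A k)" for D E
      using that un isnat_v[OF zapp_in[OF hf k]] unfolding A[OF k] by blast
  qed
  define b where "b = (\<lambda>x. zUnion (zapp F (zapp g x)))"
  have db: "definable_term (\<lambda>e. e 0 \<in> elts nats) (\<lambda>e. b (e 0))"
    unfolding b_def by (intro definable_intros) (auto intro: in_dom_zfun[OF gf] in_dom_zfun[OF F] zapp_in[OF gf])
  have bA: "b x \<in> elts S \<and> \<Phi> (v x) (b x)" if x: "x \<in> elts nats" for x
    using U[OF zapp_in[OF gf x]] A[OF zapp_in[OF gf x]] g(2)[OF x] unfolding b_def by simp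
  show thesis
  proof (rule that)
    show "zfun (zlam nats b) nats S" by (rule zfun_zlam[OF db]) (use bA in blast)
    show "\<Phi> n (zapp (zlam nats b) (w n))" if "isnat n" for n
    proof -
      have n: "w n \<in> elts nats" using that by (simp add: isnat_def)
      have "zapp (zlam nats b) (w n) = b (w n)" by (rule zapp_zlam[OF db _ n]) (use bA in blast)
      then show ?thesis using bA[OF n] by simp
    qed
  qed
qed

section \<open>Functions whose level sets are separated by clopen sets\<close>

text \<open>
  The sets \<open>P\<close> and \<open>Q\<close> may be arbitrary HOL sets,
  but the separating set belongs to the model.
\<close>

definition sep :: "'a set \<Rightarrow> 'a set \<Rightarrow> bool" where
  "sep P Q \<longleftrightarrow> (\<exists>D. clopen D \<and> P \<subseteq> elts D \<and> elts D \<inter> Q = {})"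

lemma sepE: assumes "sep P Q" obtains D where "clopen D" "P \<subseteq> elts D" "elts D \<inter> Q = {}"
  using assms unfolding sep_def by blast

lemma sep_mono: "sep P Q \<Longrightarrow> P' \<subseteq> P \<Longrightarrow> Q' \<subseteq> Q \<Longrightarrow> sep P' Q'"
  unfolding sep_def by blast

lemma sep_swap: assumes "sep P Q" "Q \<subseteq> elts X" shows "sep Q P"
proof -
  obtain D where D: "clopen D" "P \<subseteq> elts D" "elts D \<inter> Q = {}" using assms(1) by (rule sepE)
  show ?thesis unfolding sep_def
    by (intro exI[of _ "zdiff X D"]) (use D assms(2) clopen_complement[OF top] in auto)
qed

lemma sep_empty_left: "sep {} Q"
  unfolding sep_def by (intro exI[of _ zempty]) (simp add: clopen_zempty top)

lemma sep_empty_right: "P \<subseteq> elts X \<Longrightarrow> sep P {}"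
  using sep_swap[OF sep_empty_left] by simp

lemma sep_cases:
  assumes E: "clopen E" and 1: "sep (P \<inter> elts E) (Q \<inter> elts E)" and 2: "sep (P - elts E) (Q - elts E)"
  shows "sep P Q"
proof -
  obtain D where D: "clopen D" "P \<inter> elts E \<subseteq> elts D" "elts D \<inter> (Q \<inter> elts E) = {}" using 1 by (rule sepE)
  obtain D' where D': "clopen D'" "P - elts E \<subseteq> elts D'" "elts D' \<inter> (Q - elts E) = {}" using 2 by (rule sepE)
  show ?thesis unfolding sep_def
    by (intro exI[of _ "zUn (zinter D E) (zdiff D' E)"] conjI clopen_zUn clopen_zinter clopen_zdiff top D D' E)
       (use D D' in auto)
qed

text \<open>
  Under \<^bold>\<open>CMC\<close> these are exactly the members of \<open>U_aleph0\<close> (see \<open>carrier_U_aleph0\<close>). They are automatically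
  continuous (\<open>sepfun_cont\<close>). Unlike the definition by countable covers, this one involves no
  countability, so closure properties and definability become simple.
\<close>

definition sepfun :: "'a \<Rightarrow> bool" where
  "sepfun f \<longleftrightarrow> zfun f X Reals \<and>
     (\<forall>a b. a < b \<longrightarrow> sep {x \<in> elts X. rv f x \<le> a} {x \<in> elts X. b \<le> rv f x})"

lemma sepfun_zfun: "sepfun f \<Longrightarrow> zfun f X Reals"
  by (simp add: sepfun_def)

lemma sepfun_sep: "sepfun f \<Longrightarrow> a < b \<Longrightarrow> sep {x \<in> elts X. rv f x \<le> a} {x \<in> elts X. b \<le> rv f x}"
  by (simp add: sepfun_def)

lemma sepfun_real_at: "sepfun f \<Longrightarrow> x \<in> elts X \<Longrightarrow> real_at f x"
  by (rule real_at_zfun[OF sepfun_zfun])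

definition realfun :: "('a \<Rightarrow> 'r) \<Rightarrow> 'a" where
  "realfun b = zlam X (\<lambda>x. w (b x))"

lemma
  assumes "definable_real (\<lambda>e. e 0 \<in> elts X) (\<lambda>e. b (e 0))"
  shows zfun_realfun: "zfun (realfun b) X Reals"
    and rv_realfun: "x \<in> elts X \<Longrightarrow> rv (realfun b) x = b x"
proof -
  have "zapp (realfun b) x = w (b x)" if "x \<in> elts X" for x
    unfolding realfun_def by (rule zapp_zlam[OF assms[unfolded definable_real_def], of Reals]) (use that in auto)
  then show "x \<in> elts X \<Longrightarrow> rv (realfun b) x = b x" by (simp add: rv_def)
  show "zfun (realfun b) X Reals"
    unfolding realfun_def by (rule zfun_zlam[OF assms[unfolded definable_real_def]]) simp
qed

lemma sepfun_realfunI: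
  assumes "definable_real (\<lambda>e. e 0 \<in> elts X) (\<lambda>e. b (e 0))"
    and "\<And>r s. r < s \<Longrightarrow> sep {x \<in> elts X. b x \<le> r} {x \<in> elts X. s \<le> b x}"
  shows "sepfun (realfun b)"
proof -
  have "{x \<in> elts X. rv (realfun b) x \<le> r} = {x \<in> elts X. b x \<le> r}"
    "{x \<in> elts X. r \<le> rv (realfun b) x} = {x \<in> elts X. r \<le> b x}" for r
    using rv_realfun[OF assms(1)] by auto
  then show ?thesis unfolding sepfun_def using assms zfun_realfun by simp
qed

lemma sepfun_reflect:
  assumes f: "sepfun f" shows "sepfun (realfun (\<lambda>x. c - rv f x))"
proof (rule sepfun_realfunI)
  show "definable_real (\<lambda>e. e 0 \<in> elts X) (\<lambda>e. c - rv f (e 0))"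
    by (intro definable_intros) (rule sepfun_real_at[OF f])
  fix r s :: 'r assume "r < s"
  then have "sep {x \<in> elts X. rv f x \<le> c - s} {x \<in> elts X. c - r \<le> rv f x}"
    by (intro sepfun_sep[OF f]) simp
  then have "sep {x \<in> elts X. c - r \<le> rv f x} {x \<in> elts X. rv f x \<le> c - s}" by (rule sep_swap) auto
  then show "sep {x \<in> elts X. c - rv f x \<le> r} {x \<in> elts X. s \<le> c - rv f x}"
    by (rule sep_mono) (auto simp: algebra_simps)
qed

subsection \<open>Partitions into countably many clopen pieces\<close>

abbreviation piece :: "'a \<Rightarrow> 'r \<Rightarrow> 'a set" where "piece B n \<equiv> elts (zapp B (w n))"

text \<open>
  Empty pieces are allowed.
\<close>

definition clopen_partition :: "'a \<Rightarrow> bool" where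
  "clopen_partition B \<longleftrightarrow> zfun B nats (clopens X T) \<and>
    (\<forall>x \<in> elts X. \<exists>n. isnat n \<and> x \<in> piece B n) \<and>
    (\<forall>m n x. isnat m \<longrightarrow> isnat n \<longrightarrow> x \<in> piece B m \<longrightarrow> x \<in> piece B n \<longrightarrow> m = n)"

lemma clopen_partitionD:
  assumes "clopen_partition B"
  shows "zfun B nats (clopens X T)"
    and "x \<in> elts X \<Longrightarrow> \<exists>n. isnat n \<and> x \<in> piece B n"
    and "isnat m \<Longrightarrow> isnat n \<Longrightarrow> x \<in> piece B m \<Longrightarrow> x \<in> piece B n \<Longrightarrow> m = n"
  using assms unfolding clopen_partition_def by blast+

lemma clopen_differences:
  assumes F: "zfun F nats (clopens X T)"
    and mono: "\<And>m n. isnat m \<Longrightarrow> isnat n \<Longrightarrow> m < n \<Longrightarrow> piece F m \<subseteq> piece F n"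
    and cover: "\<And>x. x \<in> elts X \<Longrightarrow> \<exists>n. isnat n \<and> x \<in> piece F n"
  obtains B where "clopen_partition B"
    "\<And>n x. isnat n \<Longrightarrow> x \<in> piece B n \<longleftrightarrow>
      x \<in> piece F n \<and> (n \<noteq> 0 \<longrightarrow> x \<notin> piece F (n - 1))"
proof -
  have w: "w n \<in> elts nats" if "isnat n" for n using that by (simp add: isnat_def)
  have cl: "clopen (zapp F (w n))" if "isnat n" for n using zapp_in[OF F w[OF that]] by simp
  define b where "b = (\<lambda>y. if v y = 0 then zapp F y else zdiff (zapp F y) (zapp F (w (v y - 1))))"
  have db: "definable_term (\<lambda>e. e 0 \<in> elts nats) (\<lambda>e. b (e 0))"
    unfolding b_def
    by (intro definable_intros)
       (auto intro: in_dom_zfun[OF F] nats_carrier dest: isnat_pred[OF isnat_v] intro!: w)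
  have bc: "b y \<in> elts (clopens X T)" if y: "y \<in> elts nats" for y
  proof -
    have "w (v y) = y" using nats_carrier[OF y] by simp
    then show ?thesis
      using cl[OF isnat_v[OF y]] cl[OF isnat_pred[OF isnat_v[OF y]]] clopen_zdiff[OF top] unfolding b_def by simp
  qed
  define B where "B = zlam nats b"
  have B: "zapp B (w n) = b (w n)" if "isnat n" for n
    unfolding B_def by (rule zapp_zlam[OF db bc w[OF that]])
  have Bn: "x \<in> piece B n \<longleftrightarrow> x \<in> piece F n \<and> (n \<noteq> 0 \<longrightarrow> x \<notin> piece F (n - 1))" if "isnat n" for n x
    unfolding B[OF that] b_def by simp
  show thesis
  proof (rule that[of B])
    have z: "zfun B nats (clopens X T)" unfolding B_def by (rule zfun_zlam[OF db bc])
    have c: "\<exists>n. isnat n \<and> x \<in> piece B n" if x: "x \<in> elts X" for x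
    proof -
      obtain n where n: "isnat n" "x \<in> piece F n" using cover[OF x] by blast
      have "x \<in> piece F n \<longrightarrow> (\<exists>m. isnat m \<and> x \<in> piece B m)"
        using n(1)
      proof (induction n rule: isnat_induct)
        case definable
        show ?case by (intro definable_intros) (auto intro: nats_carrier intro!: in_dom_zfun[OF F] w isnat_v)
      next
        case zero
        show ?case using Bn[OF isnat_0, of x] isnat_0 by (metis (no_types))
      next
        case (Suc r)
        then show ?case using Bn[OF isnat_Suc[OF Suc(1)], of x] isnat_Suc[OF Suc(1)] by auto
      qed
      then show ?thesis using n(2) by blast
    qed
    have dis: False if "isnat m" "isnat n" "m < n" "x \<in> piece B m" "x \<in> piece B n" for m n x
    proof -
      have n: "isnat (n - 1)" "n \<noteq> 0" "m \<le> n - 1"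
        using that isnat_pred[of n] isnat_nonneg[of m] isnat_less[of n m] by auto
      have "x \<in> piece F m" using that(4) Bn[OF that(1)] by blast
      then have "x \<in> piece F (n - 1)"
        using mono[OF that(1) n(1)] n(3) by (cases "m = n - 1") auto
      then show False using that(5) Bn[OF that(2)] n(2) by blast
    qed
    have "m = n" if "isnat m" "isnat n" "x \<in> piece B m" "x \<in> piece B n" for m n x
      using dis[of m n x] dis[of n m x] that by (cases m n rule: linorder_cases) auto
    then show "clopen_partition B" unfolding clopen_partition_def using z c by blast
  qed (rule Bn)
qed

text \<open>
  Choose \<open>F n\<close> separating \<open>{f \<le> n h}\<close> from \<open>{(n + 1) h \<le> f}\<close>; such sets increase with \<open>n\<close>, and on their
  differences \<open>f\<close> is known up to an error of \<open>h\<close>. The first piece contains all points at which \<open>f\<close> is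
  negative, which is why it has no lower bound.
\<close>

lemma clopen_partition_of_sepfun:
  assumes f: "sepfun f" and h: "0 < h"
  obtains B where "clopen_partition B"
    "\<And>n x. isnat n \<Longrightarrow> x \<in> piece B n \<Longrightarrow> x \<in> elts X \<and> rv f x < (n + 1) * h \<and> (n \<noteq> 0 \<longrightarrow> (n - 1) * h < rv f x)"
proof -
  define \<Phi> where "\<Phi> = (\<lambda>n D. \<forall>x \<in> elts X. (rv f x \<le> n * h \<longrightarrow> x \<in> elts D) \<and> ((n + 1) * h \<le> rv f x \<longrightarrow> x \<notin> elts D))"
  obtain F where F: "zfun F nats (clopens X T)" and \<Phi>: "\<And>n. isnat n \<Longrightarrow> \<Phi> n (zapp F (w n))"
  proof (rule nat_indexed_choice[of "clopens X T" \<Phi>])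
    show "definable (\<lambda>e. e 0 \<in> elts nats \<and> e (Suc 0) \<in> elts (clopens X T)) (\<lambda>e. \<Phi> (v (e 0)) (e (Suc 0)))"
      unfolding \<Phi>_def by (intro definable_intros) (auto intro: sepfun_real_at[OF f] nats_carrier)
    show "\<exists>D \<in> elts (clopens X T). \<Phi> n D" if "isnat n" for n
    proof -
      have "n * h < (n + 1) * h" using h by simp
      then obtain D where "clopen D" "{x \<in> elts X. rv f x \<le> n * h} \<subseteq> elts D" "elts D \<inter> {x \<in> elts X. (n + 1) * h \<le> rv f x} = {}"
        using sepE[OF sepfun_sep[OF f]] by blast
      then show ?thesis unfolding \<Phi>_def by auto
    qed
    show "zUn D E \<in> elts (clopens X T) \<and> \<Phi> n (zUn D E)"
      if "D \<in> elts (clopens X T)" "E \<in> elts (clopens X T)" "\<Phi> n D" "\<Phi> n E" for n D E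
      using that clopen_zUn[OF top] unfolding \<Phi>_def by auto
  qed blast
  have w: "w n \<in> elts nats" if "isnat n" for n using that by (simp add: isnat_def)
  have cl: "clopen (zapp F (w n))" if "isnat n" for n using zapp_in[OF F w[OF that]] by simp
  have lo: "x \<in> piece F n" if "isnat n" "x \<in> elts X" "rv f x \<le> n * h" for n x
    using \<Phi>[OF that(1)] that unfolding \<Phi>_def by blast
  have hi: "x \<in> elts X \<and> rv f x < (n + 1) * h" if "isnat n" "x \<in> piece F n" for n x
    using \<Phi>[OF that(1)] that(2) clopen_subset[OF cl[OF that(1)]] unfolding \<Phi>_def by (meson not_less subsetD)
  have mono: "piece F m \<subseteq> piece F n" if mn: "isnat m" "isnat n" "m < n" for m n
  proof
    fix x assume x: "x \<in> piece F m"
    have "(m + 1) * h \<le> n * h" using isnat_less[OF mn(2,1,3)] h by (intro mult_right_mono) auto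
    then show "x \<in> piece F n" using hi[OF mn(1) x] by (intro lo mn) auto
  qed
  have cover: "\<exists>n. isnat n \<and> x \<in> piece F n" if x: "x \<in> elts X" for x
  proof -
    obtain n where n: "isnat n" "rv f x / h < n" by (rule archimedes)
    have "x \<in> piece F n" using n h by (intro lo x) (auto simp: field_simps)
    then show ?thesis using n(1) by blast
  qed
  obtain B where PB: "clopen_partition B" and B4:
    "\<And>n x. isnat n \<Longrightarrow> x \<in> piece B n \<longleftrightarrow>
      x \<in> piece F n \<and> (n \<noteq> 0 \<longrightarrow> x \<notin> piece F (n - 1))"
    by (rule clopen_differences[OF F mono cover]) blast+
  note B = clopen_partitionD[OF PB] B4
  show thesis
  proof (rule that[OF PB])
    show "x \<in> elts X \<and> rv f x < (n + 1) * h \<and> (n \<noteq> 0 \<longrightarrow> (n - 1) * h < rv f x)"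
      if n: "isnat n" "x \<in> piece B n" for n x
    proof -
      have x: "x \<in> elts X" "rv f x < (n + 1) * h" using hi[OF n(1)] n(2) B(4)[OF n(1)] by blast+
      moreover have "(n - 1) * h < rv f x" if "n \<noteq> 0"
        using lo[OF isnat_pred[OF n(1) that] x(1)] n(2) B(4)[OF n(1)] that by (meson not_less)
      ultimately show ?thesis by blast
    qed
  qed
qed

text \<open>
  Clopen sets may be prescribed independently on the pieces of a partition: the result is open,
  and so is its complement, which is glued from the complements.
\<close>

lemma clopen_glue:
  assumes PB: "clopen_partition B" and E: "zfun E nats (clopens X T)"
  obtains D where "clopen D" "\<And>n x. isnat n \<Longrightarrow> x \<in> piece B n \<Longrightarrow> x \<in> elts D \<longleftrightarrow> x \<in> piece E n"
proof -
  note B = clopen_partitionD(1)[OF PB] and cover = clopen_partitionD(2)[OF PB]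
    and disjoint = clopen_partitionD(3)[OF PB]
  let ?S = "{x \<in> elts X. \<exists>n \<in> elts nats. x \<in> elts (zapp B n) \<and> x \<in> elts (zapp E n)}"
  define D where "D = intern ?S"
  have D: "elts D = ?S"
    unfolding D_def by (intro elts_intern internal_separation definable_intros) (auto intro: in_dom_zfun[OF B] in_dom_zfun[OF E])
  have w: "w n \<in> elts nats" if "isnat n" for n using that by (simp add: isnat_def)
  have clB: "clopen (zapp B n)" if "n \<in> elts nats" for n using zapp_in[OF B that] by simp
  have clE: "clopen (zapp E n)" if "n \<in> elts nats" for n using zapp_in[OF E that] by simp
  have iff: "x \<in> elts D \<longleftrightarrow> x \<in> piece E n" if n: "isnat n" "x \<in> piece B n" for n x
  proof
    assume "x \<in> elts D"
    then obtain m where m: "m \<in> elts nats" "x \<in> elts (zapp B m)" "x \<in> elts (zapp E m)" unfolding D by blast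
    then have "v m = n" using disjoint[OF isnat_v[OF m(1)] n(1), of x] n(2) nats_carrier[OF m(1)] by simp
    then show "x \<in> piece E n" using m nats_carrier[OF m(1)] by auto
  next
    assume "x \<in> piece E n"
    then show "x \<in> elts D" unfolding D using n w[OF n(1)] clopen_subset[OF clB] by blast
  qed
  have "D \<in> elts T"
  proof (rule open_locally[OF top])
    fix x assume "x \<in> elts D"
    then obtain m where m: "m \<in> elts nats" "x \<in> elts (zapp B m)" "x \<in> elts (zapp E m)" unfolding D by blast
    show "\<exists>W \<in> elts T. x \<in> elts W \<and> elts W \<subseteq> elts D"
    proof (intro bexI[of _ "zinter (zapp B m) (zapp E m)"] conjI)
      show "zinter (zapp B m) (zapp E m) \<in> elts T"
        using clopen_zinter[OF top clB[OF m(1)] clE[OF m(1)]] by (simp add: clopen_in_def)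
      show "elts (zinter (zapp B m) (zapp E m)) \<subseteq> elts D"
        unfolding D using m(1) clopen_subset[OF clB[OF m(1)]] by auto
    qed (use m in simp)
  qed
  moreover have "zdiff X D \<in> elts T"
  proof (rule open_locally[OF top])
    fix x assume x: "x \<in> elts (zdiff X D)"
    then obtain n where n: "isnat n" "x \<in> piece B n" using cover by auto
    have wn: "w n \<in> elts nats" by (rule w[OF n(1)])
    show "\<exists>W \<in> elts T. x \<in> elts W \<and> elts W \<subseteq> elts (zdiff X D)"
    proof (intro bexI[of _ "zdiff (zapp B (w n)) (zapp E (w n))"] conjI)
      show "zdiff (zapp B (w n)) (zapp E (w n)) \<in> elts T"
        using clopen_zdiff[OF top clB[OF wn] clE[OF wn]] by (simp add: clopen_in_def)
      show "elts (zdiff (zapp B (w n)) (zapp E (w n))) \<subseteq> elts (zdiff X D)"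
        using iff[OF n(1)] clopen_subset[OF clB[OF wn]] by auto
    qed (use x n iff[OF n] in simp)
  qed
  ultimately have "clopen D" by (simp add: clopen_iff[OF top])
  then show thesis using iff that by blast
qed

text \<open>
  Separation is local with respect to \<open>f\<close>: it suffices to separate \<open>P\<close> from \<open>Q\<close> within the strips on which
  \<open>f\<close> varies by at most \<open>2 h\<close>. Choose a separating set \<open>E n\<close> for the strip around \<open>n h\<close> and glue the
  sets \<open>E n\<close> along the partition given by \<open>f\<close>.
\<close>

lemma sep_patch_nonneg:
  assumes f: "sepfun f" and h: "0 < h" and P: "internal P" "P \<subseteq> elts X" and Q: "internal Q" "Q \<subseteq> elts X"
    and nonneg: "\<And>x. x \<in> P \<union> Q \<Longrightarrow> 0 \<le> rv f x"
    and win: "\<And>t. sep (P \<inter> {x. t \<le> rv f x \<and> rv f x \<le> t + 2 * h}) (Q \<inter> {x. t \<le> rv f x \<and> rv f x \<le> t + 2 * h})"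
  shows "sep P Q"
proof -
  obtain p q where p: "P = elts p" and q: "Q = elts q" using P(1) Q(1) unfolding internal_def by auto
  obtain B where PB: "clopen_partition B" and B4:
    "\<And>n x. isnat n \<Longrightarrow> x \<in> piece B n \<Longrightarrow> x \<in> elts X \<and> rv f x < (n + 1) * h \<and> (n \<noteq> 0 \<longrightarrow> (n - 1) * h < rv f x)"
    using clopen_partition_of_sepfun[OF f h] by blast
  note B = clopen_partitionD[OF PB] B4
  define \<Phi> where "\<Phi> = (\<lambda>n D. \<forall>x \<in> elts X. (n - 1) * h \<le> rv f x \<and> rv f x \<le> (n + 1) * h \<longrightarrow>
      (x \<in> elts p \<longrightarrow> x \<in> elts D) \<and> (x \<in> elts q \<longrightarrow> x \<notin> elts D))"
  obtain E where E: "zfun E nats (clopens X T)" and \<Phi>: "\<And>n. isnat n \<Longrightarrow> \<Phi> n (zapp E (w n))"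
  proof (rule nat_indexed_choice[of "clopens X T" \<Phi>])
    show "definable (\<lambda>e. e 0 \<in> elts nats \<and> e (Suc 0) \<in> elts (clopens X T)) (\<lambda>e. \<Phi> (v (e 0)) (e (Suc 0)))"
      unfolding \<Phi>_def by (intro definable_intros) (auto intro: sepfun_real_at[OF f] nats_carrier)
    show "\<exists>D \<in> elts (clopens X T). \<Phi> n D" if "isnat n" for n
    proof -
      have e: "(n - 1) * h + 2 * h = (n + 1) * h" by (simp add: algebra_simps)
      show ?thesis using sepE[OF win[of "(n - 1) * h", unfolded e]] unfolding \<Phi>_def p q
        by (smt (verit) Int_iff disjoint_iff elts_clopens mem_Collect_eq subset_iff)
    qed
    show "zUn D E \<in> elts (clopens X T) \<and> \<Phi> n (zUn D E)"
      if "D \<in> elts (clopens X T)" "E \<in> elts (clopens X T)" "\<Phi> n D" "\<Phi> n E" for n D E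
      using that clopen_zUn[OF top] unfolding \<Phi>_def by auto
  qed blast
  obtain D where D: "clopen D" "\<And>n x. isnat n \<Longrightarrow> x \<in> piece B n \<Longrightarrow> x \<in> elts D \<longleftrightarrow> x \<in> piece E n"
    using clopen_glue[OF PB E] by blast
  have "(x \<in> P \<longrightarrow> x \<in> elts D) \<and> (x \<in> Q \<longrightarrow> x \<notin> elts D)" if x: "x \<in> P \<union> Q" for x
  proof -
    have xX: "x \<in> elts X" using x P Q by auto
    then obtain n where n: "isnat n" "x \<in> piece B n" using B(2) by blast
    \<comment> \<open>The piece with index \<open>0\<close> has no lower bound of its own; there the sign of \<open>f\<close> is used.\<close>
    have "(n - 1) * h \<le> rv f x"
    proof (cases "n = 0")
      case True
      then show ?thesis using nonneg[OF x] h by simp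
    qed (use B(4)[OF n] in auto)
    moreover have "rv f x \<le> (n + 1) * h" using B(4)[OF n] by auto
    ultimately show ?thesis using \<Phi>[OF n(1)] xX D(2)[OF n] unfolding \<Phi>_def p q by blast
  qed
  then show ?thesis unfolding sep_def using D(1) by blast
qed

lemma internal_Collect_rv:
  assumes "internal P" "P \<subseteq> elts X" "sepfun f"
    and "definable (\<lambda>e. e 0 \<in> elts X) (\<lambda>e. C (e 0))"
  shows "internal {x \<in> P. C x}"
proof -
  obtain p where p: "P = elts p" using assms(1) unfolding internal_def by auto
  show ?thesis unfolding p
    by (rule internal_separation) (rule definable_weaken[OF assms(4)], use assms(2) p in blast)
qed

text \<open>
  Two applications of the non-negative case: a clopen set \<open>E\<close> with \<open>f < \<delta>\<close> on \<open>E\<close> and \<open>f > 0\<close> outside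
  splits the space, \<open>\<delta> - f\<close> is used on \<open>E\<close> and \<open>f\<close> itself outside.
\<close>

lemma sep_patch:
  assumes f: "sepfun f" and \<delta>: "0 < \<delta>" and P: "internal P" "P \<subseteq> elts X" and Q: "internal Q" "Q \<subseteq> elts X"
    and win: "\<And>t. sep (P \<inter> {x. t \<le> rv f x \<and> rv f x \<le> t + \<delta>}) (Q \<inter> {x. t \<le> rv f x \<and> rv f x \<le> t + \<delta>})"
  shows "sep P Q"
proof -
  define h where "h = \<delta> / 2"
  have h: "0 < h" "\<delta> = 2 * h" using \<delta> by (auto simp: h_def)
  obtain E where E: "clopen E" "{x \<in> elts X. rv f x \<le> 0} \<subseteq> elts E" "elts E \<inter> {x \<in> elts X. \<delta> \<le> rv f x} = {}"
    using sepE[OF sepfun_sep[OF f \<delta>]] by blast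
  have i: "internal {x \<in> S. x \<in> elts E}" "internal {x \<in> S. x \<notin> elts E}" if "internal S" "S \<subseteq> elts X" for S
    by (intro internal_Collect_rv[OF that f] definable_intros)+
  define g where "g = realfun (\<lambda>x. \<delta> - rv f x)"
  have g: "rv g x = \<delta> - rv f x" if "x \<in> elts X" for x
    unfolding g_def by (rule rv_realfun[OF _ that]) (intro definable_intros, rule sepfun_real_at[OF f])
  have "sep {x \<in> P. x \<in> elts E} {x \<in> Q. x \<in> elts E}"
  proof (rule sep_patch_nonneg[OF sepfun_reflect[OF f, of \<delta>, folded g_def] h(1) i(1)[OF P] _ i(1)[OF Q]])
    show "0 \<le> rv g x" if "x \<in> {x \<in> P. x \<in> elts E} \<union> {x \<in> Q. x \<in> elts E}" for x
    proof -
      have "x \<in> elts X" "x \<in> elts E" using that P Q by auto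
      then show ?thesis using g[of x] E(3) by (auto simp: disjoint_iff)
    qed
    show "sep ({x \<in> P. x \<in> elts E} \<inter> {x. t \<le> rv g x \<and> rv g x \<le> t + 2 * h})
       ({x \<in> Q. x \<in> elts E} \<inter> {x. t \<le> rv g x \<and> rv g x \<le> t + 2 * h})" for t
      by (rule sep_mono[OF win[of "-t"]]) (use P Q g h in \<open>auto simp: subset_iff\<close>)
  qed (use P Q in auto)
  then have 1: "sep (P \<inter> elts E) (Q \<inter> elts E)" by (simp add: Collect_conj_eq)
  have "sep {x \<in> P. x \<notin> elts E} {x \<in> Q. x \<notin> elts E}"
  proof (rule sep_patch_nonneg[OF f h(1) i(2)[OF P] _ i(2)[OF Q]])
    show "0 \<le> rv f x" if "x \<in> {x \<in> P. x \<notin> elts E} \<union> {x \<in> Q. x \<notin> elts E}" for x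
    proof -
      have "x \<in> elts X" "x \<notin> elts E" using that P Q by auto
      then show ?thesis using E(2) by (cases "rv f x \<le> 0") (auto simp: subset_iff)
    qed
    show "sep ({x \<in> P. x \<notin> elts E} \<inter> {x. t \<le> rv f x \<and> rv f x \<le> t + 2 * h})
       ({x \<in> Q. x \<notin> elts E} \<inter> {x. t \<le> rv f x \<and> rv f x \<le> t + 2 * h})" for t
      by (rule sep_mono[OF win[of t]]) (use h in auto)
  qed (use P Q in auto)
  then have 2: "sep (P - elts E) (Q - elts E)" by (simp add: set_diff_eq)
  show ?thesis by (rule sep_cases[OF E(1) 1 2])
qed

end


section \<open>Closure under the ring operations\<close>

context model_reals begin

lemma definable_real_if [definable_intros]:
  assumes "definable G P" "definable_real (\<lambda>e. G e \<and> P e) s" "definable_real (\<lambda>e. G e \<and> \<not> P e) t"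
  shows "definable_real G (\<lambda>e. if P e then s e else t e)"
  using definable_term_if[OF assms(1) assms(2,3)[unfolded definable_real_def]]
  unfolding definable_real_def by (rule definable_term_cong) auto

end

context cmc_space begin

lemma definable_real_sepfun:
  "sepfun f \<Longrightarrow> definable_real (\<lambda>e. e 0 \<in> elts X) (\<lambda>e. rv f (e 0))"
  by (intro definable_intros) (rule sepfun_real_at)

lemma sepfun_const: "sepfun (realfun (\<lambda>x. c))"
proof (rule sepfun_realfunI)
  fix r s :: 'r assume "r < s"
  then show "sep {x \<in> elts X. c \<le> r} {x \<in> elts X. s \<le> c}"
    by (cases "c \<le> r") (auto intro: sep_empty_left sep_empty_right)
qed (intro definable_intros)

lemma sepfun_indicator:
  assumes D: "clopen D" shows "sepfun (realfun (\<lambda>x. if x \<in> elts D then 1 else 0))"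
proof (rule sepfun_realfunI)
  let ?b = "\<lambda>x. if x \<in> elts D then 1 else 0 :: 'r"
  fix r s :: 'r assume rs: "r < s"
  consider "1 \<le> r" | "r < 1" "0 \<le> r" | "r < 0" by fastforce
  then show "sep {x \<in> elts X. ?b x \<le> r} {x \<in> elts X. s \<le> ?b x}"
  proof cases
    case 1
    then have *: "{x \<in> elts X. s \<le> ?b x} = {}" using rs by auto
    show ?thesis unfolding * by (rule sep_empty_right) auto
  next
    case 2
    then show ?thesis unfolding sep_def
      by (intro exI[of _ "zdiff X D"] conjI clopen_complement[OF top D])
         (use rs in auto)
  next
    case 3
    then have *: "{x \<in> elts X. ?b x \<le> r} = {}" by auto
    show ?thesis unfolding * by (rule sep_empty_left)
  qed
qed (intro definable_intros)

lemma internal_le: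
  assumes "definable_real (\<lambda>e. e 0 \<in> elts X) (\<lambda>e. b (e 0))"
  shows "internal {x \<in> elts X. b x \<le> r}" "internal {x \<in> elts X. r \<le> b x}"
  by (intro internal_separation definable_intros assms)+

text \<open>
  On a strip \<open>t \<le> f \<le> t + \<delta>\<close>, the condition \<open>f + g \<le> r\<close> implies \<open>g \<le> r - t\<close>, while \<open>s \<le> f + g\<close> implies
  \<open>s - t - \<delta> \<le> g\<close>. For small \<open>\<delta>\<close> these are separated level sets of \<open>g\<close>.
\<close>

lemma sepfun_add:
  assumes f: "sepfun f" and g: "sepfun g" shows "sepfun (realfun (\<lambda>x. rv f x + rv g x))"
proof -
  have d: "definable_real (\<lambda>e. e 0 \<in> elts X) (\<lambda>e. rv f (e 0) + rv g (e 0))"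
    by (intro definable_real_add definable_real_sepfun f g)
  show ?thesis
  proof (rule sepfun_realfunI[OF d])
    fix r s :: 'r assume rs: "r < s"
    define \<delta> where "\<delta> = (s - r) / 2"
    have \<delta>: "0 < \<delta>" "r + \<delta> < s" using rs by (auto simp: \<delta>_def field_simps)
    show "sep {x \<in> elts X. rv f x + rv g x \<le> r} {x \<in> elts X. s \<le> rv f x + rv g x}"
    proof (rule sep_patch[OF f \<delta>(1) internal_le(1)[OF d] _ internal_le(2)[OF d]])
      fix t
      have "r - t < s - t - \<delta>" using \<delta> by simp
      then show "sep ({x \<in> elts X. rv f x + rv g x \<le> r} \<inter> {x. t \<le> rv f x \<and> rv f x \<le> t + \<delta>})
          ({x \<in> elts X. s \<le> rv f x + rv g x} \<inter> {x. t \<le> rv f x \<and> rv f x \<le> t + \<delta>})"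
        by (rule sep_mono[OF sepfun_sep[OF g]]) auto
    qed auto
  qed
qed

lemma sep_patch2:
  assumes f: "sepfun f" and g: "sepfun g" and \<delta>: "0 < \<delta>"
    and P: "internal P" "P \<subseteq> elts X" and Q: "internal Q" "Q \<subseteq> elts X"
    and win: "\<And>t u. sep {x \<in> P. (t \<le> rv f x \<and> rv f x \<le> t + \<delta>) \<and> u \<le> rv g x \<and> rv g x \<le> u + \<delta>}
      {x \<in> Q. (t \<le> rv f x \<and> rv f x \<le> t + \<delta>) \<and> u \<le> rv g x \<and> rv g x \<le> u + \<delta>}"
  shows "sep P Q"
proof (rule sep_patch[OF f \<delta> P Q])
  fix t
  have i: "internal {x \<in> S. t \<le> rv f x \<and> rv f x \<le> t + \<delta>}" if "internal S" "S \<subseteq> elts X" for S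
    by (intro internal_Collect_rv[OF that f] definable_intros) (auto intro: sepfun_real_at[OF f])
  have "sep {x \<in> P. t \<le> rv f x \<and> rv f x \<le> t + \<delta>} {x \<in> Q. t \<le> rv f x \<and> rv f x \<le> t + \<delta>}"
    by (rule sep_patch[OF g \<delta> i[OF P] _ i[OF Q]], use P Q in auto)
       (rule sep_mono[OF win], auto)
  then show "sep (P \<inter> {x. t \<le> rv f x \<and> rv f x \<le> t + \<delta>}) (Q \<inter> {x. t \<le> rv f x \<and> rv f x \<le> t + \<delta>})"
    by (rule sep_mono) auto
qed

text \<open>
  A first patching along strips of width \<open>1\<close> bounds \<open>f\<close> and \<open>g\<close> by a constant \<open>c\<close>. A second one, along strips of
  width \<open>\<delta>\<close> depending on \<open>c\<close>, makes \<open>f g\<close> vary by less than \<open>s - r\<close>, so that one of the two sets to be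
  separated is empty.
\<close>

lemma sepfun_mult:
  assumes f: "sepfun f" and g: "sepfun g" shows "sepfun (realfun (\<lambda>x. rv f x * rv g x))"
proof -
  have d: "definable_real (\<lambda>e. e 0 \<in> elts X) (\<lambda>e. rv f (e 0) * rv g (e 0))"
    by (intro definable_real_mult definable_real_sepfun f g)
  show ?thesis
  proof (rule sepfun_realfunI[OF d])
    fix r s :: 'r assume rs: "r < s"
    let ?P = "{x \<in> elts X. rv f x * rv g x \<le> r}" and ?Q = "{x \<in> elts X. s \<le> rv f x * rv g x}"
    show "sep ?P ?Q"
    proof (rule sep_patch2[OF f g zero_less_one internal_le(1)[OF d] _ internal_le(2)[OF d]])
      fix t u :: 'r
      let ?W = "\<lambda>x. (t \<le> rv f x \<and> rv f x \<le> t + 1) \<and> u \<le> rv g x \<and> rv g x \<le> u + 1"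
      define c where "c = \<bar>t\<bar> + \<bar>u\<bar> + 1"
      \<comment> \<open>On a square of side \<open>\<delta>\<close> the product varies by at most \<open>2 c \<delta> = 2 (s - r) / 3\<close>.\<close>
      define \<delta> where "\<delta> = (s - r) / (3 * c)"
      have c: "0 < c" by (simp add: c_def)
      then have \<delta>: "0 < \<delta>" "c * \<delta> + c * \<delta> < s - r" using rs by (auto simp: \<delta>_def field_simps)
      have i: "internal {x \<in> S. ?W x}" if "internal S" "S \<subseteq> elts X" for S
        by (intro internal_Collect_rv[OF that f] definable_intros)
           (auto intro: sepfun_real_at[OF f] sepfun_real_at[OF g])
      show "sep {x \<in> ?P. ?W x} {x \<in> ?Q. ?W x}"
      proof (rule sep_patch2[OF f g \<delta>(1) i[OF internal_le(1)[OF d]] _ i[OF internal_le(2)[OF d]]])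
        fix t' u' :: 'r
        let ?V = "\<lambda>x. (t' \<le> rv f x \<and> rv f x \<le> t' + \<delta>) \<and> u' \<le> rv g x \<and> rv g x \<le> u' + \<delta>"
        have False if x: "x \<in> {x \<in> {x \<in> ?P. ?W x}. ?V x}" and y: "y \<in> {x \<in> {x \<in> ?Q. ?W x}. ?V x}" for x y
        proof -
          have "\<bar>rv f y\<bar> \<le> c" "\<bar>rv g x\<bar> \<le> c" using x y by (auto simp: c_def)
          moreover have "\<bar>rv g y - rv g x\<bar> \<le> \<delta>" "\<bar>rv f y - rv f x\<bar> \<le> \<delta>" using x y by auto
          ultimately have "\<bar>rv f y * (rv g y - rv g x)\<bar> \<le> c * \<delta>" "\<bar>rv g x * (rv f y - rv f x)\<bar> \<le> c * \<delta>"
            unfolding abs_mult using c \<delta>(1) by (auto intro!: mult_mono)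
          moreover have "rv f y * rv g y - rv f x * rv g x = rv f y * (rv g y - rv g x) + rv g x * (rv f y - rv f x)"
            by (simp add: algebra_simps)
          ultimately have "rv f y * rv g y - rv f x * rv g x \<le> c * \<delta> + c * \<delta>" by linarith
          then show False using x y \<delta>(2) by auto
        qed
        then have "{x \<in> {x \<in> ?P. ?W x}. ?V x} = {} \<or> {x \<in> {x \<in> ?Q. ?W x}. ?V x} = {}" by blast
        then show "sep {x \<in> {x \<in> ?P. ?W x}. ?V x} {x \<in> {x \<in> ?Q. ?W x}. ?V x}"
        proof
          assume *: "{x \<in> {x \<in> ?P. ?W x}. ?V x} = {}"
          show ?thesis unfolding * by (rule sep_empty_left)
        next
          assume *: "{x \<in> {x \<in> ?Q. ?W x}. ?V x} = {}"
          show ?thesis unfolding * by (rule sep_empty_right) auto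
        qed
      qed auto
    qed auto
  qed
qed

text \<open>
  Inversion reverses the order of positive numbers, so sublevel sets of the inverse are superlevel sets of \<open>g\<close>.
\<close>

lemma sepfun_inverse:
  assumes g: "sepfun g" and pos: "\<And>x. x \<in> elts X \<Longrightarrow> 0 < rv g x"
  shows "sepfun (realfun (\<lambda>x. inverse (rv g x)))"
proof (rule sepfun_realfunI)
  show "definable_real (\<lambda>e. e 0 \<in> elts X) (\<lambda>e. inverse (rv g (e 0)))"
    by (intro definable_real_inverse definable_real_sepfun g)
  fix r s :: 'r assume rs: "r < s"
  show "sep {x \<in> elts X. inverse (rv g x) \<le> r} {x \<in> elts X. s \<le> inverse (rv g x)}"
  proof (cases "0 < r")
    case True
    have "inverse s < inverse r" using True rs by simp
    from sep_swap[OF sepfun_sep[OF g this]]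
    have "sep {x \<in> elts X. inverse r \<le> rv g x} {x \<in> elts X. rv g x \<le> inverse s}" by auto
    then show ?thesis
    proof (rule sep_mono)
      show "{x \<in> elts X. inverse (rv g x) \<le> r} \<subseteq> {x \<in> elts X. inverse r \<le> rv g x}"
        using True pos by (auto simp: field_simps)
      show "{x \<in> elts X. s \<le> inverse (rv g x)} \<subseteq> {x \<in> elts X. rv g x \<le> inverse s}"
        using True rs pos by (auto simp: field_simps)
    qed
  next
    case False
    have "\<not> inverse (rv g x) \<le> r" if "x \<in> elts X" for x
      using pos[OF that] False by (meson inverse_positive_iff_positive not_le order_trans not_less)
    then have *: "{x \<in> elts X. inverse (rv g x) \<le> r} = {}" by blast
    show ?thesis unfolding * by (rule sep_empty_left)
  qed
qed

end

subsection \<open>Continuity\<close>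

lemma elts_topology_of_base: "elts (topology_of_base B) = {zUnion S | S. elts S \<subseteq> elts B}"
proof -
  have "zUnion S \<in> elts (zPow (zUnion B))" if "elts S \<subseteq> elts B" for S using that by auto
  then have "{zUnion S | S. elts S \<subseteq> elts B} = {U \<in> elts (zPow (zUnion B)). \<exists>S. elts S \<subseteq> elts B \<and> U = zUnion S}"
    by blast
  then show ?thesis unfolding topology_of_base_def by (rule elts_intern_eqI) (intro definable_intros)
qed

lemma topology_of_base_iff:
  "U \<in> elts (topology_of_base B) \<longleftrightarrow> (\<forall>x \<in> elts U. \<exists>V \<in> elts B. x \<in> elts V \<and> elts V \<subseteq> elts U)"
proof
  assume "U \<in> elts (topology_of_base B)"
  then obtain S where "elts S \<subseteq> elts B" "U = zUnion S" unfolding elts_topology_of_base by blast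
  then show "\<forall>x \<in> elts U. \<exists>V \<in> elts B. x \<in> elts V \<and> elts V \<subseteq> elts U" by auto
next
  assume *: "\<forall>x \<in> elts U. \<exists>V \<in> elts B. x \<in> elts V \<and> elts V \<subseteq> elts U"
  let ?S = "{V \<in> elts B. elts V \<subseteq> elts U}"
  define S where "S = intern ?S"
  have S: "elts S = ?S"
    unfolding S_def by (intro elts_intern internal_separation definable_intros)
  have "zUnion S = U" by (rule ZF_extensionality, unfold elts_zUnion S) (use * in blast)
  then show "U \<in> elts (topology_of_base B)" unfolding elts_topology_of_base using S by blast
qed

context model_reals begin

lemma real_topD:
  assumes U: "U \<in> elts (real_top R)" and x: "x \<in> elts U" "x \<in> carrier R"
  obtains a b where "a < v x" "v x < b" "\<And>y. y \<in> carrier R \<Longrightarrow> a < v y \<Longrightarrow> v y < b \<Longrightarrow> y \<in> elts U"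
proof -
  let ?I = "\<lambda>a b. {x \<in> carrier R. strictly_less R a x \<and> strictly_less R x b}"
  have I: "?I a b = {x \<in> elts Reals. v a < v x \<and> v x < v b}" if "a \<in> carrier R" "b \<in> carrier R" for a b
    using that by (auto simp: strictly_less_iff)
  have iI: "internal {x \<in> elts Reals. v a < v x \<and> v x < v b}" for a b
  proof -
    have "internal {x \<in> elts Reals. v a < v x \<and> v x < v b}"
      by (intro internal_separation definable_intros) auto
    then show ?thesis .
  qed
  have "{intern (?I a b) | a b. a \<in> carrier R \<and> b \<in> carrier R} =
    {J \<in> elts (zPow Reals). \<exists>a \<in> elts Reals. \<exists>b \<in> elts Reals. J = intern {x \<in> elts Reals. v a < v x \<and> v x < v b}}"
    (is "?L = ?R")
  proof
    show "?L \<subseteq> ?R"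
    proof
      fix J assume "J \<in> ?L"
      then obtain a b where "a \<in> carrier R" "b \<in> carrier R" "J = intern (?I a b)" by blast
      then show "J \<in> ?R" using I[of a b] elts_intern[OF iI[of a b]] by auto
    qed
    show "?R \<subseteq> ?L"
    proof
      fix J assume "J \<in> ?R"
      then obtain a b where "a \<in> carrier R" "b \<in> carrier R"
        "J = intern {x \<in> elts Reals. v a < v x \<and> v x < v b}" by auto
      then have "J = intern (?I a b)" "a \<in> carrier R" "b \<in> carrier R" using I[of a b] by auto
      then show "J \<in> ?L" by blast
    qed
  qed
  moreover have "internal \<dots>"
    by (intro internal_separation definable_intros) auto
  ultimately have i: "internal ?L" by (simp only:)
  obtain V where V: "V \<in> ?L" "x \<in> elts V" "elts V \<subseteq> elts U"
    using U x(1) unfolding real_top_def topology_of_base_iff elts_intern[OF i] by blast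
  then obtain a b where ab: "a \<in> carrier R" "b \<in> carrier R" "V = intern (?I a b)" by blast
  then have V': "elts V = {x \<in> elts Reals. v a < v x \<and> v x < v b}" using iI[of a b] I[OF ab(1,2)] by simp
  show thesis by (rule that[of "v a" "v b"]) (use V(2,3) V' in auto)
qed

end

context cmc_space begin

text \<open>
  Around a point where \<open>a < f < b\<close>, the difference of a clopen set separating \<open>{f \<le> f x}\<close> from \<open>{b \<le> f}\<close> and
  one separating \<open>{f \<le> a}\<close> from \<open>{f x \<le> f}\<close> is a neighbourhood on which these inequalities persist.
\<close>

lemma sepfun_cont:
  assumes f: "sepfun f" shows "cont f X T Reals (real_top R)"
  unfolding cont_def
proof (intro conjI ballI)
  show ff: "zfun f X Reals" by (rule sepfun_zfun[OF f])
  fix U assume U: "U \<in> elts (real_top R)"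
  have pre: "elts (zpreimage f X U) = {x \<in> elts X. zapp f x \<in> elts U}"
    unfolding zpreimage_def by (intro elts_intern internal_separation definable_intros) (rule in_dom_zfun[OF ff])
  show "zpreimage f X U \<in> elts T"
  proof (rule open_locally[OF top])
    fix x assume "x \<in> elts (zpreimage f X U)"
    then have x: "x \<in> elts X" "zapp f x \<in> elts U" by (auto simp: pre)
    have fR: "zapp f y \<in> carrier R" if "y \<in> elts X" for y using zapp_in[OF ff that] by simp
    obtain a b where ab: "a < rv f x" "rv f x < b" "\<And>y. y \<in> carrier R \<Longrightarrow> a < v y \<Longrightarrow> v y < b \<Longrightarrow> y \<in> elts U"
      using real_topD[OF U x(2) fR[OF x(1)]] unfolding rv_def by blast
    obtain D where D: "clopen D" "{y \<in> elts X. rv f y \<le> a} \<subseteq> elts D" "elts D \<inter> {y \<in> elts X. rv f x \<le> rv f y} = {}"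
      using sepE[OF sepfun_sep[OF f ab(1)]] by blast
    obtain E where E: "clopen E" "{y \<in> elts X. rv f y \<le> rv f x} \<subseteq> elts E" "elts E \<inter> {y \<in> elts X. b \<le> rv f y} = {}"
      using sepE[OF sepfun_sep[OF f ab(2)]] by blast
    show "\<exists>W \<in> elts T. x \<in> elts W \<and> elts W \<subseteq> elts (zpreimage f X U)"
    proof (intro bexI[of _ "zdiff E D"] conjI)
      show "zdiff E D \<in> elts T" using clopen_zdiff[OF top E(1) D(1)] by (simp add: clopen_in_def)
      show "x \<in> elts (zdiff E D)" using x(1) D(3) E(2) by auto
      show "elts (zdiff E D) \<subseteq> elts (zpreimage f X U)"
      proof
        fix y assume y: "y \<in> elts (zdiff E D)"
        then have yX: "y \<in> elts X" using clopen_subset[OF E(1)] by auto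
        then have "a < rv f y" "rv f y < b" using y D(2) E(3) by (force simp: not_le[symmetric])+
        then show "y \<in> elts (zpreimage f X U)" using ab(3)[OF fR[OF yX]] yX by (simp add: pre rv_def)
      qed
    qed
  qed
qed

text \<open>
  A bounded oscillation exists as a real number because the set of differences belongs to the
  model and \<open>R\<close> is complete.
\<close>

lemma osc_le_iff:
  assumes f: "zfun f X Reals" and A: "elts A \<subseteq> elts X" and \<epsilon>: "\<epsilon> \<in> carrier R" "0 \<le> v \<epsilon>"
  shows "(\<exists>s. has_osc R f A s \<and> leq R s \<epsilon>) \<longleftrightarrow> (\<forall>x \<in> elts A. \<forall>y \<in> elts A. \<bar>rv f x - rv f y\<bar> \<le> v \<epsilon>)"
proof (cases "A = zempty")
  case True
  then show ?thesis using \<epsilon> carrier_zero by (simp add: has_osc_def leq_iff)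
next
  case False
  let ?S = "{absval R (zapp f x \<ominus>\<^bsub>R\<^esub> zapp f y) | x y. x \<in> elts A \<and> y \<in> elts A}"
  have fR: "zapp f y \<in> carrier R" if "y \<in> elts A" for y using zapp_in[OF f] that A by auto
  have S: "absval R (zapp f x \<ominus>\<^bsub>R\<^esub> zapp f y) = w \<bar>rv f x - rv f y\<bar>" if "x \<in> elts A" "y \<in> elts A" for x y
    using fR[OF that(1)] fR[OF that(2)]
    by (metis carrier_absval carrier_minus rv_def v_absval v_minus w_v)
  have S': "?S = {z \<in> elts Reals. \<exists>x \<in> elts A. \<exists>y \<in> elts A. z = w \<bar>rv f x - rv f y\<bar>}"
  proof (intro Set.set_eqI)
    fix z
    have "z \<in> ?S \<longleftrightarrow> (\<exists>x \<in> elts A. \<exists>y \<in> elts A. z = absval R (zapp f x \<ominus>\<^bsub>R\<^esub> zapp f y))" by blast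
    also have "\<dots> \<longleftrightarrow> (\<exists>x \<in> elts A. \<exists>y \<in> elts A. z = w \<bar>rv f x - rv f y\<bar>)"
      by (intro bex_cong refl) (simp only: S)
    also have "\<dots> \<longleftrightarrow> z \<in> {z \<in> elts Reals. \<exists>x \<in> elts A. \<exists>y \<in> elts A. z = w \<bar>rv f x - rv f y\<bar>}"
      by auto
    finally show "z \<in> ?S \<longleftrightarrow> \<dots>" .
  qed
  have "internal {z \<in> elts Reals. \<exists>x \<in> elts A. \<exists>y \<in> elts A. z = w \<bar>rv f x - rv f y\<bar>}"
    by (intro internal_separation definable_intros) (use A in \<open>auto intro!: real_at_zfun[OF f]\<close>)
  then have i: "internal ?S" unfolding S' .
  have sub: "?S \<subseteq> carrier R" unfolding S' by auto
  have all: "(\<forall>z \<in> ?S. v z \<le> b) \<longleftrightarrow> (\<forall>x \<in> elts A. \<forall>y \<in> elts A. \<bar>rv f x - rv f y\<bar> \<le> b)" for b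
  proof
    assume "\<forall>z \<in> ?S. v z \<le> b"
    moreover have "w \<bar>rv f x - rv f y\<bar> \<in> ?S" if "x \<in> elts A" "y \<in> elts A" for x y
      unfolding S[OF that, symmetric] using that by blast
    ultimately have "v (w \<bar>rv f x - rv f y\<bar>) \<le> b" if "x \<in> elts A" "y \<in> elts A" for x y
      using that by blast
    then show "\<forall>x \<in> elts A. \<forall>y \<in> elts A. \<bar>rv f x - rv f y\<bar> \<le> b" by simp
  qed (auto simp: S')
  have ne: "?S \<noteq> {}" using False unfolding eq_zempty_iff by blast
  show ?thesis
  proof
    assume "\<exists>s. has_osc R f A s \<and> leq R s \<epsilon>"
    then obtain s where s: "is_lub R ?S s" "leq R s \<epsilon>" using False by (auto simp: has_osc_def)
    then have "\<forall>z \<in> ?S. v z \<le> v s" "v s \<le> v \<epsilon>" using is_lub_iff[OF sub] leq_iff[OF _ \<epsilon>(1)] by auto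
    then have "\<forall>z \<in> ?S. v z \<le> v \<epsilon>" by force
    then show "\<forall>x \<in> elts A. \<forall>y \<in> elts A. \<bar>rv f x - rv f y\<bar> \<le> v \<epsilon>" unfolding all .
  next
    assume "\<forall>x \<in> elts A. \<forall>y \<in> elts A. \<bar>rv f x - rv f y\<bar> \<le> v \<epsilon>"
    then have b: "\<forall>z \<in> ?S. v z \<le> v \<epsilon>" unfolding all .
    then obtain s where s: "is_lub R ?S s" using supremum[OF i sub ne, of "v \<epsilon>"] by blast
    then have "s \<in> carrier R" "v s \<le> v \<epsilon>" using is_lub_iff[OF sub] b by blast+
    then show "\<exists>s. has_osc R f A s \<and> leq R s \<epsilon>"
      using s False leq_iff[OF _ \<epsilon>(1)] unfolding has_osc_def by auto
  qed
qed

subsection \<open>Countable clopen covers\<close>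

lemma zcountable_iff: "zcountable A \<longleftrightarrow>
   (\<exists>i. zfun i A nats \<and> (\<forall>x \<in> elts A. \<forall>y \<in> elts A. zapp i x = zapp i y \<longrightarrow> x = y))"
proof -
  obtain h where h: "zbij h omega nats" by (rule omega_nats_bij)
  obtain g where g: "zbij g nats omega" "\<And>x. x \<in> elts omega \<Longrightarrow> zapp g (zapp h x) = x" "\<And>y. y \<in> elts nats \<Longrightarrow> zapp h (zapp g y) = y"
    using zbij_inverse[OF h] by metis
  have hf: "zfun h omega nats" and gf: "zfun g nats omega" using h g(1) unfolding zbij_iff by blast+
  show ?thesis
  proof
    assume "zcountable A"
    then obtain f B where B: "elts B \<subseteq> elts omega" and f: "zbij f A B" unfolding zcountable_def by blast
    have ff: "zfun f A B" and inj: "\<And>x y. x \<in> elts A \<Longrightarrow> y \<in> elts A \<Longrightarrow> zapp f x = zapp f y \<Longrightarrow> x = y"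
      using f unfolding zbij_iff by blast+
    have fo: "zapp f x \<in> elts omega" if "x \<in> elts A" for x using zapp_in[OF ff that] B by blast
    have d: "definable_term (\<lambda>e. e 0 \<in> elts A) (\<lambda>e. zapp h (zapp f (e 0)))"
      by (intro definable_intros) (auto intro: in_dom_zfun[OF ff] in_dom_zfun[OF hf] fo)
    have r: "zapp h (zapp f x) \<in> elts nats" if "x \<in> elts A" for x by (rule zapp_in[OF hf fo[OF that]])
    have "x = y" if "x \<in> elts A" "y \<in> elts A" "zapp h (zapp f x) = zapp h (zapp f y)" for x y
      using g(2)[OF fo[OF that(1)]] g(2)[OF fo[OF that(2)]] inj that by metis
    then show "\<exists>i. zfun i A nats \<and> (\<forall>x \<in> elts A. \<forall>y \<in> elts A. zapp i x = zapp i y \<longrightarrow> x = y)"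
      using zfun_zlam[OF d r] zapp_zlam[OF d r] by (intro exI[of _ "zlam A (\<lambda>x. zapp h (zapp f x))"]) auto
  next
    assume "\<exists>i. zfun i A nats \<and> (\<forall>x \<in> elts A. \<forall>y \<in> elts A. zapp i x = zapp i y \<longrightarrow> x = y)"
    then obtain i where i: "zfun i A nats" and inj: "\<And>x y. x \<in> elts A \<Longrightarrow> y \<in> elts A \<Longrightarrow> zapp i x = zapp i y \<Longrightarrow> x = y"
      by blast
    have it: "zapp i x \<in> elts nats" if "x \<in> elts A" for x using zapp_in[OF i that] .
    let ?S = "{n \<in> elts omega. \<exists>x \<in> elts A. zapp g (zapp i x) = n}"
    define B where "B = intern ?S"
    have B: "elts B = ?S"
      unfolding B_def by (intro elts_intern internal_separation definable_intros)
        (auto intro: in_dom_zfun[OF i] in_dom_zfun[OF gf] it)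
    have d: "definable_term (\<lambda>e. e 0 \<in> elts A) (\<lambda>e. zapp g (zapp i (e 0)))"
      by (intro definable_intros) (auto intro: in_dom_zfun[OF i] in_dom_zfun[OF gf] it)
    have r: "zapp g (zapp i x) \<in> elts B" if "x \<in> elts A" for x unfolding B using zapp_in[OF gf it[OF that]] that by blast
    have "x = y" if "x \<in> elts A" "y \<in> elts A" "zapp g (zapp i x) = zapp g (zapp i y)" for x y
      using g(3)[OF it[OF that(1)]] g(3)[OF it[OF that(2)]] inj that by metis
    then have "zbij (zlam A (\<lambda>x. zapp g (zapp i x))) A B"
      unfolding zbij_iff using zfun_zlam[OF d r] zapp_zlam[OF d r] B by auto
    then show "zcountable A" unfolding zcountable_def using B by blast
  qed
qed

text \<open>
  Intersect the partitions given by \<open>f\<close> and \<open>-f\<close>: at every point one of them bounds \<open>f\<close> from both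
  sides, unless both indices are \<open>0\<close>, and then \<open>\<bar>f\<bar> < h\<close>. A non-empty intersection determines its two
  indices, and these are coded by a single natural number.
\<close>

lemma sepfun_countable_cover:
  assumes f: "sepfun f" and \<epsilon>: "0 < \<epsilon>"
  obtains \<A> where "zcountable \<A>" "zUnion \<A> = X" "\<And>A. A \<in> elts \<A> \<Longrightarrow> clopen A"
    "\<And>A x y. A \<in> elts \<A> \<Longrightarrow> x \<in> elts A \<Longrightarrow> y \<in> elts A \<Longrightarrow> \<bar>rv f x - rv f y\<bar> \<le> \<epsilon>"
proof -
  define h where "h = \<epsilon> / 2"
  have h: "0 < h" "\<epsilon> = h + h" using \<epsilon> by (auto simp: h_def)
  define g where "g = realfun (\<lambda>x. 0 - rv f x)"
  have g: "sepfun g" unfolding g_def by (rule sepfun_reflect[OF f])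
  have gx: "rv g x = - rv f x" if "x \<in> elts X" for x
    unfolding g_def by (subst rv_realfun[OF _ that]) (auto intro!: definable_intros sepfun_real_at[OF f])
  obtain B where PB: "clopen_partition B" and B4:
    "\<And>n x. isnat n \<Longrightarrow> x \<in> piece B n \<Longrightarrow> x \<in> elts X \<and> rv f x < (n + 1) * h \<and> (n \<noteq> 0 \<longrightarrow> (n - 1) * h < rv f x)"
    using clopen_partition_of_sepfun[OF f h(1)] by blast
  note B = clopen_partitionD[OF PB] B4
  obtain C where PC: "clopen_partition C" and C4:
    "\<And>n x. isnat n \<Longrightarrow> x \<in> piece C n \<Longrightarrow> x \<in> elts X \<and> rv g x < (n + 1) * h \<and> (n \<noteq> 0 \<longrightarrow> (n - 1) * h < rv g x)"
    using clopen_partition_of_sepfun[OF g h(1)] by blast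
  note C = clopen_partitionD[OF PC] C4
  have wv: "w (v m) = m" "isnat (v m)" if "m \<in> elts nats" for m using that nats_carrier isnat_v by auto
  have wn: "w n \<in> elts nats" if "isnat n" for n using that by (simp add: isnat_def)
  have BC: "clopen (zinter (zapp B m) (zapp C n))" if "m \<in> elts nats" "n \<in> elts nats" for m n
    using zapp_in[OF B(1) that(1)] zapp_in[OF C(1) that(2)] clopen_zinter[OF top] by simp
  let ?S = "{A \<in> elts (clopens X T). A \<noteq> zempty \<and> (\<exists>m \<in> elts nats. \<exists>n \<in> elts nats. A = zinter (zapp B m) (zapp C n))}"
  define \<A> where "\<A> = intern ?S"
  have \<A>: "elts \<A> = ?S"
    unfolding \<A>_def by (intro elts_intern internal_separation definable_intros) (auto intro: in_dom_zfun[OF B(1)] in_dom_zfun[OF C(1)])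
  let ?code = "\<lambda>A z. z \<in> elts nats \<and> (\<exists>m \<in> elts nats. \<exists>n \<in> elts nats. A = zinter (zapp B m) (zapp C n) \<and> v z = pair_code (v m) (v n))"
  define \<iota> where "\<iota> = (\<lambda>A. THE z. ?code A z)"
  have uniq: "m = m' \<and> n = n'" if mn: "m \<in> elts nats" "n \<in> elts nats" "m' \<in> elts nats" "n' \<in> elts nats"
    "zinter (zapp B m) (zapp C n) = zinter (zapp B m') (zapp C n')" "zinter (zapp B m) (zapp C n) \<noteq> zempty" for m n m' n'
  proof -
    obtain x where "x \<in> elts (zinter (zapp B m) (zapp C n))" using mn(6) by (auto simp: eq_zempty_iff)
    then have "x \<in> elts (zapp B m)" "x \<in> elts (zapp B m')" "x \<in> elts (zapp C n)" "x \<in> elts (zapp C n')"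
      using mn(5) by (metis IntD1 IntD2 elts_zinter)+
    then have "v m = v m'" "v n = v n'" using B(3)[of "v m" "v m'" x] C(3)[of "v n" "v n'" x] wv mn(1-4) by auto
    then show ?thesis using wv mn(1-4) by metis
  qed
  have ex1: "\<exists>!z. ?code A z"
    if A: "A \<in> elts \<A>" for A
  proof -
    obtain m n where mn: "m \<in> elts nats" "n \<in> elts nats" "A = zinter (zapp B m) (zapp C n)" "A \<noteq> zempty"
      using A unfolding \<A> by blast
    show ?thesis
    proof (rule ex1I[of _ "w (pair_code (v m) (v n))"])
      show "?code A (w (pair_code (v m) (v n)))"
        using mn wn[OF isnat_pair_code[OF wv(2)[OF mn(1)] wv(2)[OF mn(2)]]] by auto
      fix z assume z: "?code A z"
      then obtain m' n' where "m' \<in> elts nats" "n' \<in> elts nats" "A = zinter (zapp B m') (zapp C n')" "v z = pair_code (v m') (v n')"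
        by blast
      moreover from this have "m = m' \<and> n = n'" using uniq mn by metis
      ultimately show "z = w (pair_code (v m) (v n))" using z wv(1) by metis
    qed
  qed
  have \<iota>: "?code A (\<iota> A)"
    if "A \<in> elts \<A>" for A
    unfolding \<iota>_def by (rule theI'[OF ex1[OF that]])
  have d: "definable_term (\<lambda>e. e 0 \<in> elts \<A>) (\<lambda>e. \<iota> (e 0))"
    unfolding \<iota>_def pair_code_def
    by (rule definable_term_The, erule ex1[unfolded pair_code_def], intro definable_intros)
       (auto intro: in_dom_zfun[OF B(1)] in_dom_zfun[OF C(1)] nats_carrier)
  have r: "\<iota> A \<in> elts nats" if "A \<in> elts \<A>" for A using \<iota>[OF that] by blast
  show thesis
  proof (rule that[of \<A>])
    have "A = A'" if AA: "A \<in> elts \<A>" "A' \<in> elts \<A>" "\<iota> A = \<iota> A'" for A A'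
    proof -
      obtain m n where mn: "m \<in> elts nats" "n \<in> elts nats" "A = zinter (zapp B m) (zapp C n)" "v (\<iota> A) = pair_code (v m) (v n)"
        using \<iota>[OF AA(1)] by blast
      obtain m' n' where mn': "m' \<in> elts nats" "n' \<in> elts nats" "A' = zinter (zapp B m') (zapp C n')" "v (\<iota> A') = pair_code (v m') (v n')"
        using \<iota>[OF AA(2)] by blast
      have "pair_code (v m) (v n) = pair_code (v m') (v n')" using mn(4) mn'(4) AA(3) by simp
      from pair_code_inject[OF _ _ _ _ this] have "v m = v m'" "v n = v n'" using wv(2) mn mn' by auto
      then have "m = m'" "n = n'" using wv(1) mn(1,2) mn'(1,2) by metis+
      then show ?thesis using mn(3) mn'(3) by simp
    qed
    then show "zcountable \<A>" unfolding zcountable_iff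
      using zfun_zlam[OF d r] zapp_zlam[OF d r] by (intro exI[of _ "zlam \<A> \<iota>"]) auto
    show "zUnion \<A> = X"
    proof (rule ZF_extensionality, rule Set.set_eqI)
      fix x
      show "x \<in> elts (zUnion \<A>) \<longleftrightarrow> x \<in> elts X"
      proof
        assume "x \<in> elts (zUnion \<A>)"
        then show "x \<in> elts X" unfolding elts_zUnion \<A> using clopen_subset by auto
      next
        assume x: "x \<in> elts X"
        obtain m where m: "isnat m" "x \<in> piece B m" using B(2)[OF x] by blast
        obtain n where n: "isnat n" "x \<in> piece C n" using C(2)[OF x] by blast
        have "x \<in> elts (zinter (zapp B (w m)) (zapp C (w n)))" using m n by simp
        moreover from this have "zinter (zapp B (w m)) (zapp C (w n)) \<in> elts \<A>"
          unfolding \<A> using BC[OF wn[OF m(1)] wn[OF n(1)]] wn[OF m(1)] wn[OF n(1)]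
          by (auto simp: eq_zempty_iff)
        ultimately show "x \<in> elts (zUnion \<A>)" unfolding elts_zUnion by blast
      qed
    qed
    show "clopen A" if "A \<in> elts \<A>" for A using that unfolding \<A> by auto
    show "\<bar>rv f x - rv f y\<bar> \<le> \<epsilon>" if A: "A \<in> elts \<A>" and xy: "x \<in> elts A" "y \<in> elts A" for A x y
    proof -
      obtain m n where mn: "m \<in> elts nats" "n \<in> elts nats" "A = zinter (zapp B m) (zapp C n)"
        using A unfolding \<A> by blast
      have b: "rv f z < (v m + 1) * h \<and> (v m \<noteq> 0 \<longrightarrow> (v m - 1) * h < rv f z) \<and>
          - rv f z < (v n + 1) * h \<and> (v n \<noteq> 0 \<longrightarrow> (v n - 1) * h < - rv f z)" if "z \<in> elts A" for z
        using B(4)[of "v m" z] C(4)[of "v n" z] wv mn that gx[of z] by auto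
      consider "v m \<noteq> 0" | "v n \<noteq> 0" | "v m = 0" "v n = 0" by blast
      then show ?thesis
      proof cases
        case 1
        then have "\<bar>rv f x - rv f y\<bar> \<le> (v m + 1) * h - (v m - 1) * h"
          using b[OF xy(1)] b[OF xy(2)] by linarith
        also have "\<dots> = \<epsilon>" by (simp add: algebra_simps h)
        finally show ?thesis .
      next
        case 2
        then have "\<bar>rv f x - rv f y\<bar> \<le> (v n + 1) * h - (v n - 1) * h"
          using b[OF xy(1)] b[OF xy(2)] by linarith
        also have "\<dots> = \<epsilon>" by (simp add: algebra_simps h)
        finally show ?thesis .
      next
        case 3
        then show ?thesis using b[OF xy(1)] b[OF xy(2)] h by auto
      qed
    qed
  qed
qed

text \<open>
  Enumerate the cover and make it disjoint by removing from each set the earlier ones. As \<open>f\<close> varies by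
  less than \<open>b - a\<close> on each resulting piece, the union of those pieces that meet \<open>{f \<le> a}\<close> misses
  \<open>{b \<le> f}\<close>, and it is clopen by gluing. No choice is involved, because the enumeration is given.
\<close>

lemma countable_cover_sep:
  assumes f: "zfun f X Reals" and \<A>: "zcountable \<A>" "zUnion \<A> = X" "\<And>A. A \<in> elts \<A> \<Longrightarrow> clopen A"
    and osc: "\<And>A x y. A \<in> elts \<A> \<Longrightarrow> x \<in> elts A \<Longrightarrow> y \<in> elts A \<Longrightarrow> rv f x - rv f y < b - a"
  shows "sep {x \<in> elts X. rv f x \<le> a} {x \<in> elts X. b \<le> rv f x}"
proof -
  obtain i where i: "zfun i \<A> nats" and inj: "\<And>A B. A \<in> elts \<A> \<Longrightarrow> B \<in> elts \<A> \<Longrightarrow> zapp i A = zapp i B \<Longrightarrow> A = B"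
    using \<A>(1) unfolding zcountable_iff by blast
  define \<iota> where "\<iota> = (\<lambda>A. v (zapp i A))"
  have \<iota>: "isnat (\<iota> A)" "w (\<iota> A) = zapp i A" if "A \<in> elts \<A>" for A
    using zapp_in[OF i that] isnat_v nats_carrier by (auto simp: \<iota>_def)
  have \<iota>_inj: "A = B" if "A \<in> elts \<A>" "B \<in> elts \<A>" "\<iota> A = \<iota> B" for A B
    using inj[OF that(1,2)] \<iota>(2) that by metis
  have ra: "real_at i A" if "A \<in> elts \<A>" for A
    using in_dom_zfun[OF i that] zapp_in[OF i that] nats_carrier by (auto simp: real_at_def)
  have \<iota>_rv: "\<iota> A = rv i A" for A by (simp add: \<iota>_def rv_def)
  define G where "G = (\<lambda>r. intern {x \<in> elts X. \<exists>A \<in> elts \<A>. \<iota> A \<le> r \<and> x \<in> elts A})"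
  have G: "elts (G r) = {x \<in> elts X. \<exists>A \<in> elts \<A>. \<iota> A \<le> r \<and> x \<in> elts A}" for r
    unfolding G_def \<iota>_rv by (intro elts_intern internal_separation definable_intros) (auto intro: ra)
  have Gd: "definable_term (\<lambda>e. e 0 \<in> elts nats) (\<lambda>e. G (v (e 0)))"
    unfolding G_def \<iota>_rv by (intro definable_intros) (auto intro: ra nats_carrier)
  have AX: "elts A \<subseteq> elts X" if "A \<in> elts \<A>" for A using \<A>(3)[OF that] clopen_subset by blast
  have step: "clopen D" if D: "\<And>x. x \<in> elts D \<longleftrightarrow> x \<in> elts E \<or> (\<exists>A \<in> elts \<A>. \<iota> A = r \<and> x \<in> elts A)" and E: "clopen E" for D E r
  proof (cases "\<exists>A \<in> elts \<A>. \<iota> A = r")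
    case True
    then obtain A where A: "A \<in> elts \<A>" "\<iota> A = r" by blast
    have "x \<in> elts D \<longleftrightarrow> x \<in> elts (zUn E A)" for x
      unfolding D elts_zUn Un_iff using A \<iota>_inj by blast
    then have "D = zUn E A" by (intro ZF_extensionality Set.set_eqI)
    then show ?thesis using clopen_zUn[OF top E \<A>(3)[OF A(1)]] by simp
  next
    case False
    then have "D = E" using D by (intro ZF_extensionality Set.set_eqI) blast
    then show ?thesis using E by simp
  qed
  have Gc: "clopen (G r)" if "isnat r" for r
    using that
  proof (induction r rule: isnat_induct)
    case definable
    show ?case by (rule definable_clopen[OF Gd])
  next
    case zero
    show ?case
    proof (rule step[OF _ clopen_zempty[OF top]])
      show "x \<in> elts (G 0) \<longleftrightarrow> x \<in> elts zempty \<or> (\<exists>A \<in> elts \<A>. \<iota> A = 0 \<and> x \<in> elts A)" for x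
      proof -
        have "\<iota> A \<le> 0 \<longleftrightarrow> \<iota> A = 0" if "A \<in> elts \<A>" for A
          using isnat_nonneg[OF \<iota>(1)[OF that]] by auto
        then show ?thesis unfolding G elts_zempty using AX by blast
      qed
    qed
  next
    case (Suc r)
    have *: "\<iota> A \<le> r + 1 \<longleftrightarrow> \<iota> A \<le> r \<or> \<iota> A = r + 1" if "A \<in> elts \<A>" for A
    proof (cases "r < \<iota> A")
      case True
      then have "r + 1 \<le> \<iota> A" by (rule isnat_less[OF \<iota>(1)[OF that] Suc(1)])
      then show ?thesis using True by auto
    next
      case False
      then show ?thesis using add_increasing2[of 1 "\<iota> A" r] by (auto simp: not_less)
    qed
    show ?case
    proof (rule step[OF _ Suc(2)])
      show "x \<in> elts (G (r + 1)) \<longleftrightarrow> x \<in> elts (G r) \<or> (\<exists>A \<in> elts \<A>. \<iota> A = r + 1 \<and> x \<in> elts A)" for x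
        unfolding G using * AX by blast
    qed
  qed
  have w: "w n \<in> elts nats" if "isnat n" for n using that by (simp add: isnat_def)
  define F where "F = zlam nats (\<lambda>y. G (v y))"
  have Gr: "G (v y) \<in> elts (clopens X T)" if "y \<in> elts nats" for y using Gc[OF isnat_v[OF that]] by simp
  have F: "zfun F nats (clopens X T)" unfolding F_def by (rule zfun_zlam[OF Gd Gr])
  have Fn: "zapp F (w n) = G n" if "isnat n" for n
    unfolding F_def using zapp_zlam[OF Gd Gr w[OF that]] by simp
  have cover: "\<exists>n. isnat n \<and> x \<in> piece F n" if x: "x \<in> elts X" for x
  proof -
    obtain A where A: "A \<in> elts \<A>" "x \<in> elts A" using x \<A>(2) by (metis UN_E elts_zUnion)
    have "x \<in> elts (G (\<iota> A))" unfolding G using x A by blast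
    then show ?thesis using Fn[OF \<iota>(1)[OF A(1)]] \<iota>(1)[OF A(1)] by metis
  qed
  have mono: "piece F m \<subseteq> piece F n" if "isnat m" "isnat n" "m < n" for m n
    using that by (auto simp: Fn G) (metis less_imp_le order_trans)
  obtain B where PB: "clopen_partition B" and B4:
    "\<And>n x. isnat n \<Longrightarrow> x \<in> piece B n \<longleftrightarrow>
      x \<in> piece F n \<and> (n \<noteq> 0 \<longrightarrow> x \<notin> piece F (n - 1))"
    by (rule clopen_differences[OF F mono cover]) blast+
  note B = clopen_partitionD[OF PB] B4
  have piece: "\<exists>A \<in> elts \<A>. \<iota> A = n \<and> x \<in> elts A" if n: "isnat n" "x \<in> piece B n" for n x
  proof -
    have xF: "x \<in> elts (G n)" "n \<noteq> 0 \<longrightarrow> x \<notin> piece F (n - 1)" using n B(4) Fn by auto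
    then obtain A where A: "A \<in> elts \<A>" "\<iota> A \<le> n" "x \<in> elts A" unfolding G by blast
    have "\<iota> A = n"
    proof (rule ccontr)
      assume "\<iota> A \<noteq> n"
      then have lt: "\<iota> A < n" using A(2) by simp
      then have n0: "n \<noteq> 0" using isnat_nonneg[OF \<iota>(1)[OF A(1)]] by auto
      have "\<iota> A + 1 \<le> n" by (rule isnat_less[OF n(1) \<iota>(1)[OF A(1)] lt])
      then have "\<iota> A \<le> n - 1" by simp
      then have "x \<in> elts (G (n - 1))" using A AX unfolding G by blast
      then show False using xF(2) n0 Fn[OF isnat_pred[OF n(1) n0]] by simp
    qed
    then show ?thesis using A by blast
  qed
  \<comment> \<open>A piece is taken as a whole or not at all.\<close>
  define c where "c = (\<lambda>n. if \<exists>z \<in> elts (zapp B n). rv f z \<le> a then X else zempty)"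
  have ra': "real_at f z" if "z \<in> elts (zapp B n)" "n \<in> elts nats" for z n
    by (rule real_at_zfun[OF f]) (use zapp_in[OF B(1) that(2)] that(1) clopen_subset in auto)
  have cd: "definable_term (\<lambda>e. e 0 \<in> elts nats) (\<lambda>e. c (e 0))"
    unfolding c_def by (intro definable_intros) (auto intro: in_dom_zfun[OF B(1)] ra')
  have "clopen X" using clopen_complement[OF top clopen_zempty[OF top]]
    by (metis Diff_empty elts_inject elts_zdiff elts_zempty)
  then have cr: "c n \<in> elts (clopens X T)" if "n \<in> elts nats" for n
    unfolding c_def using clopen_zempty[OF top] by simp
  obtain D where D: "clopen D" "\<And>n x. isnat n \<Longrightarrow> x \<in> piece B n \<Longrightarrow> x \<in> elts D \<longleftrightarrow> x \<in> elts (zapp (zlam nats c) (w n))"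
    using clopen_glue[OF PB zfun_zlam[OF cd cr]] by blast
  have "(rv f x \<le> a \<longrightarrow> x \<in> elts D) \<and> (b \<le> rv f x \<longrightarrow> x \<notin> elts D)" if x: "x \<in> elts X" for x
  proof -
    obtain n where n: "isnat n" "x \<in> piece B n" using B(2)[OF x] by blast
    have "zapp (zlam nats c) (w n) = c (w n)" by (rule zapp_zlam[OF cd cr w[OF n(1)]])
    then have "x \<in> elts D \<longleftrightarrow> x \<in> elts (c (w n))" using D(2)[OF n] by (simp only:)
    also have "\<dots> \<longleftrightarrow> (\<exists>z \<in> piece B n. rv f z \<le> a)" using x by (simp add: c_def)
    finally have "x \<in> elts D \<longleftrightarrow> (\<exists>z \<in> piece B n. rv f z \<le> a)" .
    moreover have "rv f x < b" if z: "z \<in> piece B n" "rv f z \<le> a" for z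
    proof -
      obtain A A' where A: "A \<in> elts \<A>" "\<iota> A = n" "x \<in> elts A" "A' \<in> elts \<A>" "\<iota> A' = n" "z \<in> elts A'"
        using piece[OF n] piece[OF n(1) z(1)] by blast
      then have "rv f x - rv f z < b - a" using osc[of A x z] \<iota>_inj[of A A'] by auto
      then show ?thesis using z(2) by linarith
    qed
    ultimately show ?thesis using n(2) by (meson not_le)
  qed
  then show ?thesis unfolding sep_def using D(1) by blast
qed

theorem carrier_U_aleph0: "carrier (U_aleph0 R X T) = {f. sepfun f}"
proof -
  let ?C = "\<lambda>f \<epsilon>. \<exists>\<A>. zcountable \<A> \<and> zUnion \<A> = X \<and>
             (\<forall>A \<in> elts \<A>. clopen A \<and> (\<exists>s. has_osc R f A s \<and> leq R s \<epsilon>))"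
  have "(f \<in> C_set R X T \<and> (\<forall>\<epsilon> \<in> carrier R. strictly_less R \<zero>\<^bsub>R\<^esub> \<epsilon> \<longrightarrow> ?C f \<epsilon>)) \<longleftrightarrow> sepfun f" for f
  proof
    assume f: "sepfun f"
    have ff: "zfun f X Reals" by (rule sepfun_zfun[OF f])
    have "?C f \<epsilon>" if \<epsilon>: "\<epsilon> \<in> carrier R" "strictly_less R \<zero>\<^bsub>R\<^esub> \<epsilon>" for \<epsilon>
    proof -
      have "0 < v \<epsilon>" using \<epsilon> carrier_zero by (simp add: strictly_less_iff)
      from sepfun_countable_cover[OF f this]
      obtain \<A> where \<A>: "zcountable \<A>" "zUnion \<A> = X" "\<And>A. A \<in> elts \<A> \<Longrightarrow> clopen A"
        "\<And>A x y. A \<in> elts \<A> \<Longrightarrow> x \<in> elts A \<Longrightarrow> y \<in> elts A \<Longrightarrow> \<bar>rv f x - rv f y\<bar> \<le> v \<epsilon>" by blast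
      have "\<exists>s. has_osc R f A s \<and> leq R s \<epsilon>" if "A \<in> elts \<A>" for A
        using osc_le_iff[OF ff clopen_subset[OF \<A>(3)[OF that]] \<epsilon>(1)] \<A>(4)[OF that] \<open>0 < v \<epsilon>\<close> by simp
      then show ?thesis using \<A> by blast
    qed
    then show "f \<in> C_set R X T \<and> (\<forall>\<epsilon> \<in> carrier R. strictly_less R \<zero>\<^bsub>R\<^esub> \<epsilon> \<longrightarrow> ?C f \<epsilon>)"
      using sepfun_cont[OF f] by (simp add: C_set_def)
  next
    assume f: "f \<in> C_set R X T \<and> (\<forall>\<epsilon> \<in> carrier R. strictly_less R \<zero>\<^bsub>R\<^esub> \<epsilon> \<longrightarrow> ?C f \<epsilon>)"
    then have ff: "zfun f X Reals" by (simp add: C_set_def cont_def)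
    have "sep {x \<in> elts X. rv f x \<le> a} {x \<in> elts X. b \<le> rv f x}" if ab: "a < b" for a b
    proof -
      define \<epsilon> where "\<epsilon> = w ((b - a) / 2)"
      have \<epsilon>: "\<epsilon> \<in> carrier R" "strictly_less R \<zero>\<^bsub>R\<^esub> \<epsilon>" "0 < v \<epsilon>" "v \<epsilon> < b - a"
        using ab carrier_zero by (auto simp: \<epsilon>_def strictly_less_iff field_simps)
      then obtain \<A> where \<A>: "zcountable \<A>" "zUnion \<A> = X" "\<And>A. A \<in> elts \<A> \<Longrightarrow> clopen A"
        "\<And>A. A \<in> elts \<A> \<Longrightarrow> \<exists>s. has_osc R f A s \<and> leq R s \<epsilon>" using f by blast
      show ?thesis
      proof (rule countable_cover_sep[OF ff \<A>(1-3)])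
        fix A x y assume A: "A \<in> elts \<A>" "x \<in> elts A" "y \<in> elts A"
        have "\<bar>rv f x - rv f y\<bar> \<le> v \<epsilon>"
          using osc_le_iff[OF ff clopen_subset[OF \<A>(3)[OF A(1)]] \<epsilon>(1)] \<A>(4)[OF A(1)] \<epsilon>(3) A by auto
        then show "rv f x - rv f y < b - a" using \<epsilon>(4) by linarith
      qed
    qed
    then show "sepfun f" unfolding sepfun_def using ff by blast
  qed
  then show ?thesis by (simp add: U_aleph0_def set_eq_iff)
qed

end


section \<open>Ideals of the ring\<close>

context cmc_space begin

abbreviation U :: "'a ring" where "U \<equiv> U_aleph0 R X T"

lemma sepfun_eqI:
  assumes "sepfun f" "sepfun g" "\<And>x. x \<in> elts X \<Longrightarrow> rv f x = rv g x"
  shows "f = g"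
proof (rule zfun_eqI[OF sepfun_zfun[OF assms(1)] sepfun_zfun[OF assms(2)]])
  fix x assume x: "x \<in> elts X"
  have "zapp f x \<in> carrier R" "zapp g x \<in> carrier R"
    using zapp_in[OF sepfun_zfun[OF assms(1)] x] zapp_in[OF sepfun_zfun[OF assms(2)] x] by auto
  then show "zapp f x = zapp g x" using assms(3)[OF x] by (simp add: rv_def v_inject)
qed

lemma
  assumes f: "sepfun f" and g: "sepfun g"
  shows U_add: "f \<oplus>\<^bsub>U\<^esub> g = realfun (\<lambda>x. rv f x + rv g x)"
    and U_mult: "f \<otimes>\<^bsub>U\<^esub> g = realfun (\<lambda>x. rv f x * rv g x)"
proof -
  have c: "zapp f x \<in> carrier R" "zapp g x \<in> carrier R" if x: "x \<in> elts X" for x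
    using zapp_in[OF sepfun_zfun[OF f] x] zapp_in[OF sepfun_zfun[OF g] x] by auto
  have "zapp f x \<oplus>\<^bsub>R\<^esub> zapp g x = w (rv f x + rv g x)" if x: "x \<in> elts X" for x
    using w_v[OF carrier_add[OF c[OF x]]] v_add[OF c[OF x]] by (simp add: rv_def)
  then show "f \<oplus>\<^bsub>U\<^esub> g = realfun (\<lambda>x. rv f x + rv g x)"
    unfolding U_aleph0_def realfun_def by (simp cong: zlam_cong)
  have "zapp f x \<otimes>\<^bsub>R\<^esub> zapp g x = w (rv f x * rv g x)" if x: "x \<in> elts X" for x
    using w_v[OF carrier_mult[OF c[OF x]]] v_mult[OF c[OF x]] by (simp add: rv_def)
  then show "f \<otimes>\<^bsub>U\<^esub> g = realfun (\<lambda>x. rv f x * rv g x)"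
    unfolding U_aleph0_def realfun_def by (simp cong: zlam_cong)
qed

lemma U_zero: "\<zero>\<^bsub>U\<^esub> = realfun (\<lambda>x. 0)" and U_one: "\<one>\<^bsub>U\<^esub> = realfun (\<lambda>x. 1)"
  by (simp_all add: U_aleph0_def realfun_def w_zero w_one)

lemma sepfun_U_add [intro]: "sepfun f \<Longrightarrow> sepfun g \<Longrightarrow> sepfun (f \<oplus>\<^bsub>U\<^esub> g)"
  and sepfun_U_mult [intro]: "sepfun f \<Longrightarrow> sepfun g \<Longrightarrow> sepfun (f \<otimes>\<^bsub>U\<^esub> g)"
  by (simp_all add: U_add U_mult sepfun_add sepfun_mult)

lemma sepfun_U_zero [simp, intro]: "sepfun \<zero>\<^bsub>U\<^esub>" and sepfun_U_one [simp, intro]: "sepfun \<one>\<^bsub>U\<^esub>"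
  by (simp_all add: U_zero U_one sepfun_const)

lemma rv_U_add [simp]: "sepfun f \<Longrightarrow> sepfun g \<Longrightarrow> x \<in> elts X \<Longrightarrow> rv (f \<oplus>\<^bsub>U\<^esub> g) x = rv f x + rv g x"
  and rv_U_mult [simp]: "sepfun f \<Longrightarrow> sepfun g \<Longrightarrow> x \<in> elts X \<Longrightarrow> rv (f \<otimes>\<^bsub>U\<^esub> g) x = rv f x * rv g x"
  by (simp_all add: U_add U_mult rv_realfun definable_real_add definable_real_mult definable_real_sepfun)

lemma rv_const: "x \<in> elts X \<Longrightarrow> rv (realfun (\<lambda>x. c)) x = c"
  by (rule rv_realfun[OF definable_real_const])

lemma rv_U_zero [simp]: "x \<in> elts X \<Longrightarrow> rv \<zero>\<^bsub>U\<^esub> x = 0"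
  and rv_U_one [simp]: "x \<in> elts X \<Longrightarrow> rv \<one>\<^bsub>U\<^esub> x = 1"
  by (simp_all add: U_zero U_one rv_const)

lemma ring_U: "ring U"
proof (rule ringI)
  show "abelian_group U"
  proof (rule abelian_groupI, unfold carrier_U_aleph0 mem_Collect_eq)
    fix f assume f: "sepfun f"
    define g where "g = realfun (\<lambda>x. 0 - rv f x)"
    have g: "sepfun g" unfolding g_def by (rule sepfun_reflect[OF f])
    have gx: "rv g x = - rv f x" if "x \<in> elts X" for x
      unfolding g_def by (subst rv_realfun[OF _ that]) (auto intro!: definable_intros sepfun_real_at[OF f])
    have "g \<oplus>\<^bsub>U\<^esub> f = \<zero>\<^bsub>U\<^esub>" by (rule sepfun_eqI) (use f g gx in auto)
    then show "\<exists>g \<in> {f. sepfun f}. g \<oplus>\<^bsub>U\<^esub> f = \<zero>\<^bsub>U\<^esub>" using g by blast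
  qed (auto intro!: sepfun_eqI simp: sepfun_U_add)
  show "monoid U"
    by (rule monoidI) (auto intro!: sepfun_eqI simp: carrier_U_aleph0 sepfun_U_mult)
qed (auto intro!: sepfun_eqI simp: carrier_U_aleph0 sepfun_U_mult sepfun_U_add algebra_simps)

text \<open>
  A positive member is invertible in the ring. Sums of squares produce such members from
  functions without common zeros.
\<close>

lemma ideal_U_eq_carrier:
  assumes J: "ideal J U" and k: "k \<in> J" and pos: "\<And>x. x \<in> elts X \<Longrightarrow> 0 < rv k x"
  shows "J = carrier U"
proof -
  interpret ideal J U by (rule J)
  have sk: "sepfun k" using k a_subset carrier_U_aleph0 by auto
  define i where "i = realfun (\<lambda>x. inverse (rv k x))"
  have si: "sepfun i" unfolding i_def by (rule sepfun_inverse[OF sk pos])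
  have ix: "rv i x = inverse (rv k x)" if "x \<in> elts X" for x
    unfolding i_def by (rule rv_realfun[OF definable_real_inverse[OF definable_real_sepfun[OF sk]] that])
  have "i \<otimes>\<^bsub>U\<^esub> k = \<one>\<^bsub>U\<^esub>"
  proof (rule sepfun_eqI)
    fix x assume x: "x \<in> elts X"
    then show "rv (i \<otimes>\<^bsub>U\<^esub> k) x = rv \<one>\<^bsub>U\<^esub> x" using si sk ix[OF x] pos[OF x] by simp
  qed (use si sk in auto)
  then have "\<one>\<^bsub>U\<^esub> \<in> J" using I_l_closed[OF k, of i] si carrier_U_aleph0 by simp
  then show ?thesis by (rule one_imp_carrier)
qed

lemma sum_squares_in_ideal:
  assumes J: "ideal J U" and f: "f \<in> J" and g: "g \<in> J"
  shows "(f \<otimes>\<^bsub>U\<^esub> f) \<oplus>\<^bsub>U\<^esub> (g \<otimes>\<^bsub>U\<^esub> g) \<in> J"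
proof -
  interpret ideal J U by (rule J)
  show ?thesis
    by (intro additive_subgroup.a_closed[OF additive_subgroup_axioms] I_l_closed f g a_Hcarr)
qed

definition U_set :: 'a where
  "U_set = intern (carrier U)"

lemma definable_sepfun [definable_intros]:
  assumes "definable_term G f" shows "definable G (\<lambda>e. sepfun (f e))"
proof -
  have *: "sepfun f \<longleftrightarrow> zfun f X Reals \<and> (\<forall>a \<in> elts Reals. \<forall>b \<in> elts Reals. v a < v b \<longrightarrow>
    (\<exists>D \<in> elts (clopens X T). \<forall>x \<in> elts X. (rv f x \<le> v a \<longrightarrow> x \<in> elts D) \<and> (v b \<le> rv f x \<longrightarrow> x \<notin> elts D)))" for f
  proof -
    have "(\<forall>a b. a < b \<longrightarrow> sep {x \<in> elts X. rv f x \<le> a} {x \<in> elts X. b \<le> rv f x}) \<longleftrightarrow>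
        (\<forall>a \<in> elts Reals. \<forall>b \<in> elts Reals. v a < v b \<longrightarrow> sep {x \<in> elts X. rv f x \<le> v a} {x \<in> elts X. v b \<le> rv f x})"
      (is "?L \<longleftrightarrow> ?R")
    proof
      assume r: ?R
      show ?L
      proof (intro allI impI)
        fix a b :: 'r assume "a < b"
        then show "sep {x \<in> elts X. rv f x \<le> a} {x \<in> elts X. b \<le> rv f x}"
          using bspec[OF bspec[OF r, of "w a"], of "w b"] by simp
      qed
    qed simp
    also have "\<dots> \<longleftrightarrow> (\<forall>a \<in> elts Reals. \<forall>b \<in> elts Reals. v a < v b \<longrightarrow>
      (\<exists>D \<in> elts (clopens X T). \<forall>x \<in> elts X. (rv f x \<le> v a \<longrightarrow> x \<in> elts D) \<and> (v b \<le> rv f x \<longrightarrow> x \<notin> elts D)))"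
      unfolding sep_def by (intro ball_cong refl imp_cong) auto
    finally show ?thesis unfolding sepfun_def by (rule conj_cong[OF refl])
  qed
  have "definable (\<lambda>e. True) (\<lambda>e. sepfun (e 0))"
    unfolding * by (intro definable_intros) (auto intro: real_at_zfun)
  then show ?thesis
    by (intro definable_subst[where P = "\<lambda>e x. sepfun x", OF assms]) (rule definable_weaken, auto)
qed

lemma elts_U_set: "elts U_set = carrier U"
proof -
  have "carrier U = {f \<in> elts (zPow (ztimes X Reals)). sepfun f}"
    unfolding carrier_U_aleph0 using sepfun_zfun by (auto simp: zfun_def)
  then show ?thesis unfolding U_set_def by (rule elts_intern_eqI) (intro definable_intros)
qed

definition indicator_fun :: "'a \<Rightarrow> 'a" where
  "indicator_fun D = realfun (\<lambda>x. if x \<in> elts D then 1 else 0)"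

lemma sepfun_indicator_fun: "clopen D \<Longrightarrow> sepfun (indicator_fun D)"
  unfolding indicator_fun_def by (rule sepfun_indicator)

lemma rv_indicator_fun: "x \<in> elts X \<Longrightarrow> rv (indicator_fun D) x = (if x \<in> elts D then 1 else 0)"
  unfolding indicator_fun_def by (rule rv_realfun) (intro definable_intros)

text \<open>
  The function \<open>f\<^sup>2 / (f\<^sup>2 + g\<^sup>2)\<close> is \<open>0\<close> on the first set and \<open>1\<close> on the second. Adding to the
  denominator the indicator of the complement of \<open>D\<close> makes the denominator positive on the whole space without
  changing it on \<open>D\<close>.
\<close>

lemma separate_zero_sets:
  assumes f: "sepfun f" and g: "sepfun g" and D: "clopen D"
    and disj: "\<And>x. x \<in> elts D \<Longrightarrow> rv f x \<noteq> 0 \<or> rv g x \<noteq> 0"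
  shows "sep {x \<in> elts D. rv f x = 0} {x \<in> elts D. rv g x = 0}"
proof -
  define c where "c = indicator_fun (zdiff X D)"
  have c: "sepfun c" unfolding c_def by (rule sepfun_indicator_fun[OF clopen_complement[OF top D]])
  have cx: "rv c x = (if x \<in> elts D then 0 else 1)" if "x \<in> elts X" for x
    unfolding c_def using rv_indicator_fun[OF that, of "zdiff X D"] that by simp
  define k where "k = ((f \<otimes>\<^bsub>U\<^esub> f) \<oplus>\<^bsub>U\<^esub> (g \<otimes>\<^bsub>U\<^esub> g)) \<oplus>\<^bsub>U\<^esub> c"
  have k: "sepfun k" unfolding k_def by (intro sepfun_U_add sepfun_U_mult f g c)
  have kx: "rv k x = rv f x * rv f x + rv g x * rv g x + rv c x" if "x \<in> elts X" for x
    unfolding k_def using that f g c by (simp add: sepfun_U_add sepfun_U_mult)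
  have pos: "0 < rv k x" if x: "x \<in> elts X" for x
  proof (cases "x \<in> elts D")
    case True
    then show ?thesis unfolding kx[OF x] cx[OF x] using disj[OF True] by (simp add: sum_squares_gt_zero_iff)
  next
    case False
    then show ?thesis unfolding kx[OF x] cx[OF x] by (simp add: add_nonneg_pos)
  qed
  define i where "i = realfun (\<lambda>x. inverse (rv k x))"
  have i: "sepfun i" unfolding i_def by (rule sepfun_inverse[OF k pos])
  have ix: "rv i x = inverse (rv k x)" if "x \<in> elts X" for x
    unfolding i_def by (rule rv_realfun[OF definable_real_inverse[OF definable_real_sepfun[OF k]] that])
  define h where "h = (f \<otimes>\<^bsub>U\<^esub> f) \<otimes>\<^bsub>U\<^esub> i"
  have h: "sepfun h" unfolding h_def by (intro sepfun_U_mult f i)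
  have hx: "rv h x = rv f x * rv f x * inverse (rv k x)" if "x \<in> elts X" for x
    unfolding h_def using that f i by (simp add: sepfun_U_mult ix)
  have DX: "x \<in> elts X" if "x \<in> elts D" for x using that clopen_subset[OF D] by blast
  show ?thesis
  proof (rule sep_mono[OF sepfun_sep[OF h zero_less_one]])
    show "{x \<in> elts D. rv f x = 0} \<subseteq> {x \<in> elts X. rv h x \<le> 0}" using hx DX by auto
    show "{x \<in> elts D. rv g x = 0} \<subseteq> {x \<in> elts X. 1 \<le> rv h x}"
    proof
      fix x assume "x \<in> {x \<in> elts D. rv g x = 0}"
      then have x: "x \<in> elts D" "rv g x = 0" "x \<in> elts X" using DX by auto
      have "rv k x = rv f x * rv f x" unfolding kx[OF x(3)] cx[OF x(3)] using x by simp
      moreover have "rv f x \<noteq> 0" using disj[OF x(1)] x(2) by simp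
      ultimately have "rv h x = 1" unfolding hx[OF x(3)] by (metis mult_eq_0_iff right_inverse)
      then show "x \<in> {x \<in> elts X. 1 \<le> rv h x}" using x(3) by simp
    qed
  qed
qed

end

section \<open>The Banaschewski compactification\<close>

lemma zero_dim_clopen:
  assumes "zero_dim Y S" "V \<in> elts S" "y \<in> elts V"
  obtains A where "clopen_in Y S A" "y \<in> elts A" "elts A \<subseteq> elts V"
proof -
  have "is_base (clopens Y S) S" using assms(1) by (simp add: zero_dim_def clopens_def)
  then obtain C where "elts C \<subseteq> elts (clopens Y S)" "V = zUnion C" using assms(2) unfolding is_base_def by blast
  then show thesis using assms(3) that by auto
qed

lemma elts_zimage:
  assumes "zfun f A B" shows "elts (zimage f A) = {zapp f x | x. x \<in> elts A}"
proof -
  have "{zapp f x | x. x \<in> elts A} = {y \<in> elts B. \<exists>x \<in> elts A. zapp f x = y}" using zapp_in[OF assms] by blast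
  then show ?thesis
    unfolding zimage_def by (rule elts_intern_eqI) (intro definable_intros, rule in_dom_zfun[OF assms], simp_all)
qed

lemma elts_zpreimage:
  assumes "zfun f A B" shows "elts (zpreimage f A V) = {x \<in> elts A. zapp f x \<in> elts V}"
  unfolding zpreimage_def by (intro elts_intern internal_separation definable_intros) (rule in_dom_zfun[OF assms])

lemma elts_subspace_top: "elts (subspace_top S A) = {zinter V A | V. V \<in> elts S}"
proof -
  have "zinter V A \<in> elts (zPow A)" for V by simp
  then have "{zinter V A | V. V \<in> elts S} = {W \<in> elts (zPow A). \<exists>V \<in> elts S. W = zinter V A}" by blast
  then show ?thesis unfolding subspace_top_def by (rule elts_intern_eqI) (intro definable_intros)
qed

locale banaschewski_space = cmc_space R v w X T
  for R :: "'a::ZF ord_ring" and v :: "'a \<Rightarrow> 'r::linordered_field" and w :: "'r \<Rightarrow> 'a" and X T +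
  fixes Y S \<beta> :: 'a
  assumes banaschewski: "Banaschewski X T Y S \<beta>" and nonempty: "X \<noteq> zempty"
begin

lemma topY: "topology_on Y S" and compactY: "compact_top Y S" and zero_dimY: "zero_dim Y S" and T1Y: "T1 Y S"
  and embedding: "embedding \<beta> X T Y S" and dense: "dense_in S (zimage \<beta> X)"
  using banaschewski by (simp_all add: Banaschewski_def compactification_def)

lemma extension:
  "topology_on K TK \<Longrightarrow> compact_top K TK \<Longrightarrow> zero_dim K TK \<Longrightarrow> T1 K TK \<Longrightarrow> cont f X T K TK \<Longrightarrow>
    \<exists>g. cont g Y S K TK \<and> (\<forall>x \<in> elts X. zapp g (zapp \<beta> x) = zapp f x)"
  using banaschewski by (simp add: Banaschewski_def)

lemma \<beta>_fun: "zfun \<beta> X Y"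
  using embedding by (simp add: embedding_def)

lemma dense_point:
  assumes "V \<in> elts S" "y \<in> elts V" obtains x where "x \<in> elts X" "zapp \<beta> x \<in> elts V"
proof -
  have "zinter V (zimage \<beta> X) \<noteq> zempty" using dense assms unfolding dense_in_def by (auto simp: eq_zempty_iff)
  then show thesis using that elts_zimage[OF \<beta>_fun] by (auto simp: eq_zempty_iff)
qed

definition trace :: "'a \<Rightarrow> 'a" where "trace V = zpreimage \<beta> X V"

lemma elts_trace [simp]: "elts (trace V) = {x \<in> elts X. zapp \<beta> x \<in> elts V}"
  unfolding trace_def by (rule elts_zpreimage[OF \<beta>_fun])

lemma trace_open:
  assumes "V \<in> elts S" shows "trace V \<in> elts T"
proof -
  have c: "cont \<beta> X T (zimage \<beta> X) (subspace_top S (zimage \<beta> X))"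
    using embedding by (simp add: embedding_def homeo_map_def)
  have "zinter V (zimage \<beta> X) \<in> elts (subspace_top S (zimage \<beta> X))" using assms elts_subspace_top by blast
  then have "zpreimage \<beta> X (zinter V (zimage \<beta> X)) \<in> elts T" using c by (simp add: cont_def)
  moreover have "zpreimage \<beta> X (zinter V (zimage \<beta> X)) = trace V"
    by (rule ZF_extensionality) (auto simp: elts_zpreimage[OF \<beta>_fun] elts_zimage[OF \<beta>_fun])
  ultimately show ?thesis by simp
qed

lemma trace_clopen:
  assumes "clopen_in Y S V" shows "clopen (trace V)"
proof -
  have "zdiff X (trace V) = trace (zdiff Y V)"
    using zapp_in[OF \<beta>_fun] by (intro ZF_extensionality) auto
  then show ?thesis using assms trace_open by (simp add: clopen_iff[OF top] clopen_iff[OF topY])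
qed

text \<open>
  A clopen set is the preimage of a point under a continuous map to the discrete two-point space; the
  extension of this map to the compactification gives the required set.
\<close>

lemma extend_clopen:
  assumes D: "clopen D"
  obtains V where "clopen_in Y S V" "\<And>x. x \<in> elts X \<Longrightarrow> zapp \<beta> x \<in> elts V \<longleftrightarrow> x \<in> elts D"
proof -
  define one :: 'a where "one = zsucc zempty"
  have one: "one \<noteq> zempty" by (simp add: one_def)
  let ?S = "{zempty, one}"
  define K where "K = intern ?S"
  have K: "elts K = ?S" by (simp add: K_def)
  have topK: "topology_on K (zPow K)" by (auto simp: topology_on_def)
  have cl: "clopen_in K (zPow K) A" if "elts A \<subseteq> elts K" for A using that by (auto simp: clopen_in_def)
  have compactK: "compact_top K (zPow K)"
    unfolding compact_top_def
  proof (intro allI impI)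
    fix C assume C: "elts C \<subseteq> elts (zPow K) \<and> zUnion C = K"
    then have "zempty \<in> elts (zUnion C)" "one \<in> elts (zUnion C)" using K by auto
    then obtain A B where AB: "A \<in> elts C" "zempty \<in> elts A" "B \<in> elts C" "one \<in> elts B" by auto
    have "zUnion (intern {A, B}) = K"
      using AB C by (intro ZF_extensionality) (auto simp: K)
    then show "\<exists>F. elts F \<subseteq> elts C \<and> zfinite F \<and> zUnion F = K"
      using AB zfinite_doubleton by (intro exI[of _ "intern {A, B}"]) auto
  qed
  have zdK: "zero_dim K (zPow K)"
    unfolding zero_dim_def is_base_def clopens_def[symmetric]
  proof (intro conjI ballI)
    show "elts (clopens K (zPow K)) \<subseteq> elts (zPow K)" by (auto simp: clopen_in_def)
    fix A assume "A \<in> elts (zPow K)"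
    moreover have "A = zUnion (intern {A})" by (rule ZF_extensionality) simp
    ultimately show "\<exists>C. elts C \<subseteq> elts (clopens K (zPow K)) \<and> A = zUnion C"
      using cl by (intro exI[of _ "intern {A}"]) auto
  qed
  have T1K: "T1 K (zPow K)"
    unfolding T1_def
  proof (intro ballI impI)
    fix x y assume "x \<in> elts K" "y \<in> elts K" "x \<noteq> y"
    then show "\<exists>A \<in> elts (zPow K). x \<in> elts A \<and> y \<notin> elts A"
      by (intro bexI[of _ "intern {x}"]) auto
  qed
  define b where "b = (\<lambda>x. if x \<in> elts D then one else zempty)"
  have bd: "definable_term (\<lambda>e. e 0 \<in> elts X) (\<lambda>e. b (e 0))" unfolding b_def by (intro definable_intros)
  have bK: "b x \<in> elts K" for x by (simp add: b_def K)
  have f: "zfun (zlam X b) X K" by (rule zfun_zlam[OF bd bK])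
  have fx: "zapp (zlam X b) x = b x" if "x \<in> elts X" for x by (rule zapp_zlam[OF bd bK that])
  have "cont (zlam X b) X T K (zPow K)"
    unfolding cont_def
  proof (intro conjI ballI f)
    fix A assume "A \<in> elts (zPow K)"
    have pre: "elts (zpreimage (zlam X b) X A) = {x \<in> elts X. b x \<in> elts A}"
      using fx by (auto simp: elts_zpreimage[OF f])
    show "zpreimage (zlam X b) X A \<in> elts T"
    proof (rule open_locally[OF top])
      fix x assume "x \<in> elts (zpreimage (zlam X b) X A)"
      then have x: "x \<in> elts X" "b x \<in> elts A" by (auto simp: pre)
      show "\<exists>W \<in> elts T. x \<in> elts W \<and> elts W \<subseteq> elts (zpreimage (zlam X b) X A)"
      proof (cases "x \<in> elts D")
        case True
        then show ?thesis unfolding pre using x D clopen_subset[OF D]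
          by (intro bexI[of _ D]) (auto simp: b_def clopen_in_def)
      next
        case False
        then show ?thesis unfolding pre using x D
          by (intro bexI[of _ "zdiff X D"]) (auto simp: b_def clopen_in_def)
      qed
    qed
  qed
  from extension[OF topK compactK zdK T1K this]
  obtain g where g: "cont g Y S K (zPow K)" and gx: "\<And>x. x \<in> elts X \<Longrightarrow> zapp g (zapp \<beta> x) = b x"
    using fx by auto
  have gf: "zfun g Y K" using g by (simp add: cont_def)
  define V where "V = zpreimage g Y (intern {one})"
  have V: "elts V = {y \<in> elts Y. zapp g y = one}" unfolding V_def by (simp add: elts_zpreimage[OF gf])
  have "V \<in> elts S" using g unfolding V_def cont_def by (simp add: K)
  moreover have "zdiff Y V = zpreimage g Y (intern {zempty})"
    by (rule ZF_extensionality) (use zapp_in[OF gf] K one in \<open>auto simp: V elts_zpreimage[OF gf]\<close>)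
  moreover have "zpreimage g Y (intern {zempty}) \<in> elts S" using g unfolding cont_def by (simp add: K)
  ultimately have "clopen_in Y S V" by (simp add: clopen_iff[OF topY])
  moreover have "zapp \<beta> x \<in> elts V \<longleftrightarrow> x \<in> elts D" if "x \<in> elts X" for x
    unfolding V using gx[OF that] zapp_in[OF \<beta>_fun that] one by (simp add: b_def)
  ultimately show thesis by (rule that)
qed

lemma separate_points:
  assumes "y \<in> elts Y" "z \<in> elts Y" "y \<noteq> z"
  obtains V where "clopen_in Y S V" "y \<in> elts V" "z \<notin> elts V"
proof -
  obtain A where "A \<in> elts S" "y \<in> elts A" "z \<notin> elts A" using T1Y assms unfolding T1_def by blast
  then show thesis using zero_dim_clopen[OF zero_dimY] that by blast
qed

subsection \<open>The ideal of functions vanishing at a point of the compactification\<close>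

text \<open>
  The point \<open>y\<close> lies in the closure, in the compactification, of the zero set of \<open>f\<close>.
\<close>

definition vanishes :: "'a \<Rightarrow> 'a \<Rightarrow> bool" where
  "vanishes y f \<longleftrightarrow> (\<forall>V \<in> elts (clopens Y S). y \<in> elts V \<longrightarrow> (\<exists>x \<in> elts X. zapp \<beta> x \<in> elts V \<and> rv f x = 0))"

lemma not_vanishes_iff: "\<not> vanishes y f \<longleftrightarrow>
  (\<exists>V. clopen_in Y S V \<and> y \<in> elts V \<and> (\<forall>x \<in> elts X. zapp \<beta> x \<in> elts V \<longrightarrow> rv f x \<noteq> 0))"
  unfolding vanishes_def by auto

text \<open>
  It suffices that the closures of two zero sets meet only in the closure of their intersection.
  If \<open>f\<close> and \<open>g\<close> had no common zero near \<open>y\<close>, their zero sets there would be separated by a clopen set.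
  The point \<open>y\<close> lies in the extension of this clopen set to the compactification or outside it; either way it has
  a neighbourhood that contains no zero of \<open>g\<close> or no zero of \<open>f\<close>, respectively.
\<close>

lemma vanishes_add:
  assumes f: "sepfun f" "vanishes y f" and g: "sepfun g" "vanishes y g"
  shows "vanishes y (f \<oplus>\<^bsub>U\<^esub> g)"
proof (rule ccontr)
  assume "\<not> vanishes y (f \<oplus>\<^bsub>U\<^esub> g)"
  then obtain V where V: "clopen_in Y S V" "y \<in> elts V"
    "\<And>x. x \<in> elts X \<Longrightarrow> zapp \<beta> x \<in> elts V \<Longrightarrow> rv (f \<oplus>\<^bsub>U\<^esub> g) x \<noteq> 0" unfolding not_vanishes_iff by blast
  have "sep {x \<in> elts (trace V). rv f x = 0} {x \<in> elts (trace V). rv g x = 0}"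
  proof (rule separate_zero_sets[OF f(1) g(1) trace_clopen[OF V(1)]])
    show "rv f x \<noteq> 0 \<or> rv g x \<noteq> 0" if "x \<in> elts (trace V)" for x
      using V(3)[of x] that f(1) g(1) by auto
  qed
  then obtain D where D: "clopen D" "{x \<in> elts (trace V). rv f x = 0} \<subseteq> elts D" "elts D \<inter> {x \<in> elts (trace V). rv g x = 0} = {}"
    by (rule sepE)
  obtain W where W: "clopen_in Y S W" "\<And>x. x \<in> elts X \<Longrightarrow> zapp \<beta> x \<in> elts W \<longleftrightarrow> x \<in> elts D"
    using extend_clopen[OF D(1)] by blast
  show False
  proof (cases "y \<in> elts W")
    case True
    then have "zinter V W \<in> elts (clopens Y S)" "y \<in> elts (zinter V W)"
      using clopen_zinter[OF topY V(1) W(1)] V(2) by auto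
    then obtain x where "x \<in> elts X" "zapp \<beta> x \<in> elts (zinter V W)" "rv g x = 0"
      using g(2) unfolding vanishes_def by blast
    then show False using W(2)[of x] D(3) by auto
  next
    case False
    then have "zdiff V W \<in> elts (clopens Y S)" "y \<in> elts (zdiff V W)"
      using clopen_zdiff[OF topY V(1) W(1)] V(2) by auto
    then obtain x where "x \<in> elts X" "zapp \<beta> x \<in> elts (zdiff V W)" "rv f x = 0"
      using f(2) unfolding vanishes_def by blast
    then show False using W(2)[of x] D(2) by auto
  qed
qed

lemma vanishes_zero:
  assumes "y \<in> elts Y" shows "vanishes y \<zero>\<^bsub>U\<^esub>"
  unfolding vanishes_def
proof (intro ballI impI)
  fix V assume V: "V \<in> elts (clopens Y S)" "y \<in> elts V"
  then obtain x where "x \<in> elts X" "zapp \<beta> x \<in> elts V" using dense_point[of V y] by (auto simp: clopen_in_def)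
  then show "\<exists>x \<in> elts X. zapp \<beta> x \<in> elts V \<and> rv \<zero>\<^bsub>U\<^esub> x = 0" by auto
qed

lemma vanishes_mult:
  assumes "sepfun f" "vanishes y f" "sepfun g"
  shows "vanishes y (g \<otimes>\<^bsub>U\<^esub> f)" "vanishes y (f \<otimes>\<^bsub>U\<^esub> g)"
proof -
  have "rv (g \<otimes>\<^bsub>U\<^esub> f) x = 0" "rv (f \<otimes>\<^bsub>U\<^esub> g) x = 0" if "x \<in> elts X" "rv f x = 0" for x using that assms by auto
  then show "vanishes y (g \<otimes>\<^bsub>U\<^esub> f)" "vanishes y (f \<otimes>\<^bsub>U\<^esub> g)" using assms(2) unfolding vanishes_def by metis+
qed

text \<open>
  If \<open>y \<notin> V\<close>, every neighbourhood of \<open>y\<close> contains a non-empty open set disjoint from \<open>V\<close>, and by density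
  this open set contains a point of the space.
\<close>

lemma vanishes_indicator_iff:
  assumes V: "clopen_in Y S V" and y: "y \<in> elts Y"
  shows "vanishes y (indicator_fun (trace V)) \<longleftrightarrow> y \<notin> elts V"
proof
  assume *: "vanishes y (indicator_fun (trace V))"
  show "y \<notin> elts V"
  proof
    assume "y \<in> elts V"
    then obtain x where "x \<in> elts X" "zapp \<beta> x \<in> elts V" "rv (indicator_fun (trace V)) x = 0"
      using * V unfolding vanishes_def by auto
    then show False by (simp add: rv_indicator_fun)
  qed
next
  assume yV: "y \<notin> elts V"
  show "vanishes y (indicator_fun (trace V))"
    unfolding vanishes_def
  proof (intro ballI impI)
    fix W assume "W \<in> elts (clopens Y S)" "y \<in> elts W"
    then have "zdiff W V \<in> elts S" "y \<in> elts (zdiff W V)"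
      using clopen_zdiff[OF topY _ V, of W] yV by (auto simp: clopen_in_def)
    then obtain x where "x \<in> elts X" "zapp \<beta> x \<in> elts (zdiff W V)" by (rule dense_point)
    then show "\<exists>x \<in> elts X. zapp \<beta> x \<in> elts W \<and> rv (indicator_fun (trace V)) x = 0"
      by (auto simp: rv_indicator_fun)
  qed
qed

definition point_ideal :: "'a \<Rightarrow> 'a" where
  "point_ideal y = intern {f \<in> elts U_set. vanishes y f}"

lemma definable_vanishes:
  assumes "definable_term G y" "definable_term G f" "\<And>e. G e \<Longrightarrow> sepfun (f e)"
  shows "definable G (\<lambda>e. vanishes (y e) (f e))"
  unfolding vanishes_def
  by (intro definable_intros; (rule definable_term_shift[OF assms(1)] definable_term_shift[OF assms(2)])?)
     (auto intro: in_dom_zfun[OF \<beta>_fun] sepfun_real_at assms(3))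

lemma definable_point_ideal [definable_intros]:
  assumes "definable_term G y" shows "definable_term G (\<lambda>e. point_ideal (y e))"
  unfolding point_ideal_def
  by (intro definable_intros definable_vanishes; (rule definable_term_shift[OF assms])?)
     (auto simp: elts_U_set carrier_U_aleph0)

lemma elts_point_ideal: "elts (point_ideal y) = {f. sepfun f \<and> vanishes y f}"
proof -
  have "elts (point_ideal y) = {f \<in> elts U_set. vanishes y f}"
    unfolding point_ideal_def
    by (intro elts_intern internal_separation definable_intros definable_vanishes)
       (auto simp: elts_U_set carrier_U_aleph0)
  then show ?thesis by (simp add: elts_U_set carrier_U_aleph0)
qed

lemma ideal_point_ideal:
  assumes y: "y \<in> elts Y" shows "ideal (elts (point_ideal y)) U"
proof -
  interpret U: ring U by (rule ring_U)
  show ?thesis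
  proof (rule idealI[OF ring_U])
    show "subgroup (elts (point_ideal y)) (add_monoid U)"
    proof (rule group.subgroupI[OF U.a_group])
      show "elts (point_ideal y) \<subseteq> carrier (add_monoid U)"
        by (auto simp: elts_point_ideal carrier_U_aleph0)
      show "elts (point_ideal y) \<noteq> {}" using vanishes_zero[OF y] by (auto simp: elts_point_ideal)
      fix f assume "f \<in> elts (point_ideal y)"
      then have f: "sepfun f" "vanishes y f" by (auto simp: elts_point_ideal)
      have fc: "f \<in> carrier U" using f by (simp add: carrier_U_aleph0)
      have "\<ominus>\<^bsub>U\<^esub> f = (\<ominus>\<^bsub>U\<^esub> \<one>\<^bsub>U\<^esub>) \<otimes>\<^bsub>U\<^esub> f" using fc by (simp add: U.l_minus)
      moreover have "sepfun (\<ominus>\<^bsub>U\<^esub> \<one>\<^bsub>U\<^esub>)" using U.a_inv_closed[OF U.one_closed] by (simp add: carrier_U_aleph0)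
      ultimately have "\<ominus>\<^bsub>U\<^esub> f \<in> elts (point_ideal y)"
        using vanishes_mult(1)[OF f] sepfun_U_mult f by (simp add: elts_point_ideal)
      then show "inv\<^bsub>add_monoid U\<^esub> f \<in> elts (point_ideal y)" by (simp add: a_inv_def)
    next
      fix f g assume "f \<in> elts (point_ideal y)" "g \<in> elts (point_ideal y)"
      then show "f \<otimes>\<^bsub>add_monoid U\<^esub> g \<in> elts (point_ideal y)"
        using vanishes_add by (auto simp: elts_point_ideal)
    qed
  qed (auto simp: elts_point_ideal carrier_U_aleph0 intro: vanishes_mult)
qed

lemma point_ideal_proper:
  assumes y: "y \<in> elts Y" shows "elts (point_ideal y) \<noteq> carrier U"
proof
  assume "elts (point_ideal y) = carrier U"
  then have "vanishes y \<one>\<^bsub>U\<^esub>" using sepfun_U_one unfolding elts_point_ideal carrier_U_aleph0 by blast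
  moreover have "clopen_in Y S Y"
    using clopen_complement[OF topY clopen_zempty[OF topY]] by (metis Diff_empty elts_inject elts_zdiff elts_zempty)
  ultimately show False using y unfolding vanishes_def by auto
qed

text \<open>
  A function \<open>f\<close> not vanishing at \<open>y\<close> has no zeros in some clopen \<open>V \<ni> y\<close>. The indicator \<open>c\<close> of the
  complement of \<open>V\<close> vanishes at \<open>y\<close>, and \<open>f\<^sup>2 + c\<^sup>2\<close> is positive.
\<close>

lemma point_ideal_maximal:
  assumes y: "y \<in> elts Y" and J: "ideal J U" "elts (point_ideal y) \<subseteq> J" "J \<noteq> elts (point_ideal y)"
  shows "J = carrier U"
proof -
  interpret ideal J U by (rule J(1))
  obtain f where f: "f \<in> J" "f \<notin> elts (point_ideal y)" using J by blast
  have sf: "sepfun f" using a_Hcarr[OF f(1)] by (simp add: carrier_U_aleph0)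
  then have "\<not> vanishes y f" using f(2) by (simp add: elts_point_ideal)
  then obtain V where V: "clopen_in Y S V" "y \<in> elts V" "\<And>x. x \<in> elts X \<Longrightarrow> zapp \<beta> x \<in> elts V \<Longrightarrow> rv f x \<noteq> 0"
    unfolding not_vanishes_iff by blast
  define c where "c = indicator_fun (trace (zdiff Y V))"
  have W: "clopen_in Y S (zdiff Y V)" by (rule clopen_complement[OF topY V(1)])
  have c: "sepfun c" unfolding c_def by (rule sepfun_indicator_fun[OF trace_clopen[OF W]])
  have "c \<in> J" using J(2) vanishes_indicator_iff[OF W y] V(2) c unfolding c_def elts_point_ideal by auto
  from sum_squares_in_ideal[OF J(1) f(1) this] show ?thesis
  proof (rule ideal_U_eq_carrier[OF J(1)])
    fix x assume x: "x \<in> elts X"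
    have "rv f x \<noteq> 0 \<or> rv c x \<noteq> 0"
      using V(3)[OF x] x zapp_in[OF \<beta>_fun x] by (auto simp: c_def rv_indicator_fun)
    then show "0 < rv ((f \<otimes>\<^bsub>U\<^esub> f) \<oplus>\<^bsub>U\<^esub> (c \<otimes>\<^bsub>U\<^esub> c)) x"
      using x sf c by (simp add: sepfun_U_mult sum_squares_gt_zero_iff)
  qed
qed

text \<open>
  Otherwise the clopen sets \<open>V\<close> on which some member of \<open>M\<close> has no zeros cover the compactification.
  They are closed under binary unions, by sums of squares, so compactness gives a member of \<open>M\<close> without zeros
  on the whole space, and \<open>M\<close> is not proper.
\<close>

lemma proper_ideal_vanishes:
  assumes M: "ideal (elts M) U" "elts M \<noteq> carrier U"
  obtains y where "y \<in> elts Y" "\<And>f. f \<in> elts M \<Longrightarrow> vanishes y f"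
proof (rule ccontr)
  assume "\<not> thesis"
  then have no: "\<exists>f \<in> elts M. \<not> vanishes y f" if "y \<in> elts Y" for y
    using that \<open>\<And>y. y \<in> elts Y \<Longrightarrow> (\<And>f. f \<in> elts M \<Longrightarrow> vanishes y f) \<Longrightarrow> thesis\<close> by blast
  interpret ideal "elts M" U by (rule M(1))
  have sM: "sepfun f" if "f \<in> elts M" for f using a_Hcarr[OF that] by (simp add: carrier_U_aleph0)
  let ?S = "{V \<in> elts (clopens Y S). \<exists>f \<in> elts M. \<forall>x \<in> elts X. zapp \<beta> x \<in> elts V \<longrightarrow> rv f x \<noteq> 0}"
  define C where "C = intern ?S"
  have C: "elts C = ?S"
    unfolding C_def by (intro elts_intern internal_separation definable_intros)
      (auto intro: in_dom_zfun[OF \<beta>_fun] sepfun_real_at sM)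
  have "zUnion C = Y"
  proof (rule ZF_extensionality, rule subset_antisym)
    show "elts (zUnion C) \<subseteq> elts Y" by (auto simp: C clopen_in_def)
    show "elts Y \<subseteq> elts (zUnion C)"
    proof
      fix y assume "y \<in> elts Y"
      then obtain f where "f \<in> elts M" "\<not> vanishes y f" using no by blast
      then obtain V where "clopen_in Y S V" "y \<in> elts V" "\<forall>x \<in> elts X. zapp \<beta> x \<in> elts V \<longrightarrow> rv f x \<noteq> 0"
        unfolding not_vanishes_iff by blast
      then have "V \<in> elts C" "y \<in> elts V" unfolding C elts_clopens using \<open>f \<in> elts M\<close> by blast+
      then show "y \<in> elts (zUnion C)" unfolding elts_zUnion by blast
    qed
  qed
  moreover have "elts C \<subseteq> elts S" by (auto simp: C clopen_in_def)
  ultimately obtain F where F: "elts F \<subseteq> elts C" "zfinite F" "zUnion F = Y"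
    using compactY unfolding compact_top_def by blast
  have "elts F \<noteq> {}"
  proof
    assume "elts F = {}"
    then have "elts Y = {}" unfolding F(3)[symmetric] by simp
    then show False using nonempty zapp_in[OF \<beta>_fun] by (auto simp: eq_zempty_iff)
  qed
  have "zUnion F \<in> elts C"
  proof (rule zUnion_zfinite_mem[OF F(2,1) \<open>elts F \<noteq> {}\<close>])
    fix V W assume "V \<in> elts C" "W \<in> elts C"
    then obtain f g where V: "clopen_in Y S V" "f \<in> elts M" "\<And>x. x \<in> elts X \<Longrightarrow> zapp \<beta> x \<in> elts V \<Longrightarrow> rv f x \<noteq> 0"
      and W: "clopen_in Y S W" "g \<in> elts M" "\<And>x. x \<in> elts X \<Longrightarrow> zapp \<beta> x \<in> elts W \<Longrightarrow> rv g x \<noteq> 0"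
      unfolding C by auto
    let ?k = "(f \<otimes>\<^bsub>U\<^esub> f) \<oplus>\<^bsub>U\<^esub> (g \<otimes>\<^bsub>U\<^esub> g)"
    have "rv ?k x \<noteq> 0" if "x \<in> elts X" "zapp \<beta> x \<in> elts (zUn V W)" for x
      using that V(3)[of x] W(3)[of x] sM[OF V(2)] sM[OF W(2)] by (auto simp: sepfun_U_mult sum_squares_eq_zero_iff)
    moreover have "?k \<in> elts M" by (rule sum_squares_in_ideal[OF M(1) V(2) W(2)])
    ultimately show "zUn V W \<in> elts C" unfolding C using clopen_zUn[OF topY V(1) W(1)] by auto
  qed
  then obtain f where f: "f \<in> elts M" "\<And>x. x \<in> elts X \<Longrightarrow> zapp \<beta> x \<in> elts Y \<Longrightarrow> rv f x \<noteq> 0"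
    unfolding F(3) C by auto
  from sum_squares_in_ideal[OF M(1) f(1) f(1)] have "elts M = carrier U"
  proof (rule ideal_U_eq_carrier[OF M(1)])
    fix x assume x: "x \<in> elts X"
    show "0 < rv ((f \<otimes>\<^bsub>U\<^esub> f) \<oplus>\<^bsub>U\<^esub> (f \<otimes>\<^bsub>U\<^esub> f)) x"
      using x sM[OF f(1)] f(2)[OF x zapp_in[OF \<beta>_fun x]]
      by (auto simp: sepfun_U_mult zero_less_mult_iff linorder_neq_iff)
  qed
  then show False using M(2) by simp
qed

lemma elts_max_ideals: "elts (max_ideals U) = {point_ideal y | y. y \<in> elts Y}"
proof -
  have "{M. ideal (elts M) U \<and> elts M \<noteq> carrier U \<and>
     (\<forall>J. ideal (elts J) U \<and> elts M \<subseteq> elts J \<longrightarrow> J = M \<or> elts J = carrier U)} = {point_ideal y | y. y \<in> elts Y}"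
    (is "?L = ?R")
  proof
    show "?R \<subseteq> ?L"
      using ideal_point_ideal point_ideal_proper point_ideal_maximal elts_inject by fastforce
    show "?L \<subseteq> ?R"
    proof
      fix M assume "M \<in> ?L"
      then have M: "ideal (elts M) U" "elts M \<noteq> carrier U"
        and mx: "\<And>J. ideal (elts J) U \<Longrightarrow> elts M \<subseteq> elts J \<Longrightarrow> J = M \<or> elts J = carrier U" by blast+
      interpret ideal "elts M" U by (rule M(1))
      obtain y where y: "y \<in> elts Y" "\<And>f. f \<in> elts M \<Longrightarrow> vanishes y f" using proper_ideal_vanishes[OF M] by blast
      have "elts M \<subseteq> elts (point_ideal y)" using y(2) a_subset by (auto simp: elts_point_ideal carrier_U_aleph0)
      then have "point_ideal y = M" using mx[OF ideal_point_ideal[OF y(1)]] point_ideal_proper[OF y(1)] by blast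
      then show "M \<in> ?R" using y(1) by blast
    qed
  qed
  also have "?R = {M \<in> elts (zPow U_set). \<exists>y \<in> elts Y. M = point_ideal y}"
    by (auto simp: elts_point_ideal elts_U_set carrier_U_aleph0)
  finally have "?L = \<dots>" .
  then show ?thesis unfolding max_ideals_def \<open>?L = ?R\<close>[symmetric] by (rule elts_intern_eqI) (intro definable_intros)
qed

lemma point_ideal_inject:
  assumes "y \<in> elts Y" "z \<in> elts Y" "point_ideal y = point_ideal z" shows "y = z"
proof (rule ccontr)
  assume "y \<noteq> z"
  then obtain V where V: "clopen_in Y S V" "y \<in> elts V" "z \<notin> elts V" using separate_points assms by metis
  let ?c = "indicator_fun (trace V)"
  have "sepfun ?c" by (rule sepfun_indicator_fun[OF trace_clopen[OF V(1)]])
  then have "?c \<in> elts (point_ideal z)" "?c \<notin> elts (point_ideal y)"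
    using vanishes_indicator_iff[OF V(1)] assms(1,2) V(2,3) by (auto simp: elts_point_ideal)
  then show False using assms(3) by simp
qed

lemma hull_kernel_iff:
  "W \<in> elts (hull_kernel_top U) \<longleftrightarrow> elts W \<subseteq> elts (max_ideals U) \<and>
    (\<forall>M \<in> elts W. \<exists>r. sepfun r \<and> r \<notin> elts M \<and> (\<forall>N \<in> elts (max_ideals U). r \<notin> elts N \<longrightarrow> N \<in> elts W))"
proof -
  have e: "elts (intern {M \<in> elts (max_ideals U). r \<notin> elts M}) = {M \<in> elts (max_ideals U). r \<notin> elts M}" for r
    by (intro elts_intern internal_separation definable_intros)
  let ?B = "{intern {M \<in> elts (max_ideals U). r \<notin> elts M} | r. r \<in> carrier U}"
  have "?B = {B \<in> elts (zPow (max_ideals U)). \<exists>r \<in> elts U_set. B = intern {M \<in> elts (max_ideals U). r \<notin> elts M}}"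
    unfolding elts_U_set using e by auto
  moreover have "internal \<dots>" by (intro internal_separation definable_intros)
  ultimately have i: "internal ?B" by (simp only:)
  have "(\<exists>V \<in> ?B. M \<in> elts V \<and> elts V \<subseteq> elts W) \<longleftrightarrow> M \<in> elts (max_ideals U) \<and>
      (\<exists>r. sepfun r \<and> r \<notin> elts M \<and> (\<forall>N \<in> elts (max_ideals U). r \<notin> elts N \<longrightarrow> N \<in> elts W))" for M
  proof -
    have "(\<exists>V \<in> ?B. M \<in> elts V \<and> elts V \<subseteq> elts W) \<longleftrightarrow>
        (\<exists>r \<in> carrier U. M \<in> elts (intern {M \<in> elts (max_ideals U). r \<notin> elts M}) \<and>
           elts (intern {M \<in> elts (max_ideals U). r \<notin> elts M}) \<subseteq> elts W)" by blast
    then show ?thesis unfolding e carrier_U_aleph0 by blast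
  qed
  then show ?thesis
    unfolding hull_kernel_top_def topology_of_base_iff elts_intern[OF i] by blast
qed

text \<open>
  The map from points to ideals is a bijection, and its inverse \<open>h\<close> is the homeomorphism. Basic open sets of
  the hull-kernel topology correspond to complements of closures of zero sets, which are open;
  conversely a clopen set \<open>A\<close> corresponds to the basic open set given by the indicator of \<open>A\<close>.
\<close>

theorem homeomorphic: "homeomorphic_tops (max_ideals U) (hull_kernel_top U) Y S"
proof -
  let ?X = "max_ideals U"
  have dp: "definable_term (\<lambda>e. e 0 \<in> elts Y) (\<lambda>e. point_ideal (e 0))" by (intro definable_intros)
  have pm: "point_ideal y \<in> elts ?X" if "y \<in> elts Y" for y using that elts_max_ideals by blast
  have zp: "zapp (zlam Y point_ideal) y = point_ideal y" if "y \<in> elts Y" for y by (rule zapp_zlam[OF dp pm that])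
  have "zbij (zlam Y point_ideal) Y ?X"
    unfolding zbij_iff
  proof (intro conjI ballI impI)
    show "zfun (zlam Y point_ideal) Y ?X" by (rule zfun_zlam[OF dp pm])
  qed (use zp point_ideal_inject elts_max_ideals in auto)
  then obtain h where h: "zbij h ?X Y" "\<And>y. y \<in> elts Y \<Longrightarrow> zapp h (zapp (zlam Y point_ideal) y) = y"
    by (rule zbij_inverse) blast
  have hf: "zfun h ?X Y" using h(1) by (simp add: zbij_def)
  have hp: "zapp h (point_ideal y) = y" if "y \<in> elts Y" for y using h(2)[OF that] zp[OF that] by simp
  have "homeo_map h ?X (hull_kernel_top U) Y S"
    unfolding homeo_map_def cont_def
  proof (intro conjI ballI h(1) hf)
    fix V assume V: "V \<in> elts S"
    show "zpreimage h ?X V \<in> elts (hull_kernel_top U)"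
      unfolding hull_kernel_iff
    proof (intro conjI ballI)
      show "elts (zpreimage h ?X V) \<subseteq> elts ?X" by (auto simp: elts_zpreimage[OF hf])
      fix M assume "M \<in> elts (zpreimage h ?X V)"
      then have "M \<in> elts ?X" "zapp h M \<in> elts V" by (auto simp: elts_zpreimage[OF hf])
      then obtain y where y: "y \<in> elts Y" "M = point_ideal y" "y \<in> elts V" using elts_max_ideals hp by auto
      obtain A where A: "clopen_in Y S A" "y \<in> elts A" "elts A \<subseteq> elts V" by (rule zero_dim_clopen[OF zero_dimY V y(3)])
      let ?c = "indicator_fun (trace A)"
      have c: "sepfun ?c" by (rule sepfun_indicator_fun[OF trace_clopen[OF A(1)]])
      have in_iff: "?c \<in> elts (point_ideal z) \<longleftrightarrow> z \<notin> elts A" if "z \<in> elts Y" for z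
        using vanishes_indicator_iff[OF A(1) that] c by (simp add: elts_point_ideal)
      show "\<exists>r. sepfun r \<and> r \<notin> elts M \<and> (\<forall>N \<in> elts ?X. r \<notin> elts N \<longrightarrow> N \<in> elts (zpreimage h ?X V))"
      proof (intro exI[of _ ?c] conjI c ballI impI)
        show "?c \<notin> elts M" using in_iff[OF y(1)] y(2) A(2) by simp
        fix N assume N: "N \<in> elts ?X" "?c \<notin> elts N"
        then obtain z where "z \<in> elts Y" "N = point_ideal z" using elts_max_ideals by auto
        then show "N \<in> elts (zpreimage h ?X V)" using N in_iff[of z] A(3) hp[of z] by (auto simp: elts_zpreimage[OF hf])
      qed
    qed
  next
    fix W assume W: "W \<in> elts (hull_kernel_top U)"
    then have WX: "elts W \<subseteq> elts ?X" by (simp add: hull_kernel_iff)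
    have im: "elts (zimage h W) = {y \<in> elts Y. point_ideal y \<in> elts W}"
    proof -
      have "{zapp h M | M. M \<in> elts W} = {y \<in> elts Y. point_ideal y \<in> elts W}"
      proof (intro subset_antisym subsetI)
        fix y assume "y \<in> {zapp h M | M. M \<in> elts W}"
        then obtain M where M: "M \<in> elts W" "y = zapp h M" by blast
        then obtain z where "z \<in> elts Y" "M = point_ideal z" using WX elts_max_ideals by blast
        then show "y \<in> {y \<in> elts Y. point_ideal y \<in> elts W}" using M hp by simp
      next
        fix y assume "y \<in> {y \<in> elts Y. point_ideal y \<in> elts W}"
        then have "point_ideal y \<in> elts W" "y = zapp h (point_ideal y)" using hp by auto
        then show "y \<in> {zapp h M | M. M \<in> elts W}" by blast
      qed
      moreover have "internal \<dots>" by (intro internal_separation definable_intros)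
      ultimately show ?thesis unfolding zimage_def by (simp only: elts_intern)
    qed
    show "zimage h W \<in> elts S"
    proof (rule open_locally[OF topY])
      fix y assume "y \<in> elts (zimage h W)"
      then have y: "y \<in> elts Y" "point_ideal y \<in> elts W" by (auto simp: im)
      obtain r where r: "sepfun r" "r \<notin> elts (point_ideal y)" "\<And>N. N \<in> elts ?X \<Longrightarrow> r \<notin> elts N \<Longrightarrow> N \<in> elts W"
        using W y(2) unfolding hull_kernel_iff by blast
      then have "\<not> vanishes y r" by (simp add: elts_point_ideal)
      then obtain V where V: "clopen_in Y S V" "y \<in> elts V" "\<And>x. x \<in> elts X \<Longrightarrow> zapp \<beta> x \<in> elts V \<Longrightarrow> rv r x \<noteq> 0"
        unfolding not_vanishes_iff by blast
      have "elts V \<subseteq> elts (zimage h W)"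
      proof
        fix z assume z: "z \<in> elts V"
        then have zY: "z \<in> elts Y" using V(1) by (auto simp: clopen_in_def)
        have "\<not> vanishes z r" unfolding not_vanishes_iff using V z by blast
        then have "point_ideal z \<in> elts W" using r(3)[OF pm[OF zY]] by (simp add: elts_point_ideal)
        then show "z \<in> elts (zimage h W)" using zY by (simp add: im)
      qed
      then show "\<exists>V \<in> elts S. y \<in> elts V \<and> elts V \<subseteq> elts (zimage h W)"
        using V(1,2) by (auto simp: clopen_in_def)
    qed
  qed
  then show ?thesis unfolding homeomorphic_tops_def by blast
qed

end


section \<open>Turning a field of the model into a type\<close>

definition ordered_field :: "'b ord_ring \<Rightarrow> bool" where
  "ordered_field F \<longleftrightarrow> field F \<and>
     linear_order_on (carrier F) {(x, y). x \<in> carrier F \<and> y \<in> carrier F \<and> leq F x y} \<and>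
     (\<forall>x \<in> carrier F. \<forall>y \<in> carrier F. \<forall>z \<in> carrier F.
        leq F x y \<longrightarrow> leq F (x \<oplus>\<^bsub>F\<^esub> z) (y \<oplus>\<^bsub>F\<^esub> z)) \<and>
     (\<forall>x \<in> carrier F. \<forall>y \<in> carrier F.
        leq F \<zero>\<^bsub>F\<^esub> x \<and> leq F \<zero>\<^bsub>F\<^esub> y \<longrightarrow> leq F \<zero>\<^bsub>F\<^esub> (x \<otimes>\<^bsub>F\<^esub> y))"

text \<open>
  The rational numbers of HOL, transported along an injection into the infinite type \<open>'a\<close>.
\<close>

lemma ordered_field_exists: "\<exists>F :: 'a::ZF ord_ring. ordered_field F"
proof -
  have inj_numeral: "(zsucc ^^ m) zempty = (zsucc ^^ n) (zempty :: 'a) \<Longrightarrow> m = n" for m n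
  proof (induction m arbitrary: n)
    case 0
    then show ?case by (cases n) auto
  next
    case (Suc m)
    then show ?case by (cases n) auto
  qed
  define e :: "rat \<Rightarrow> 'a" where "e = (\<lambda>q. (zsucc ^^ to_nat q) zempty)"
  have "inj e" by (rule injI) (use inj_numeral in \<open>force simp: e_def\<close>)
  then obtain d where e: "d (e q) = q" for q by (metis inv_f_f)
  define F :: "'a ord_ring" where "F = \<lparr>carrier = range e,
    monoid.mult = \<lambda>x y. e (d x * d y), one = e 1,
    zero = e 0, add = \<lambda>x y. e (d x + d y), leq = \<lambda>x y. d x \<le> d y\<rparr>"
  have "abelian_group F"
  proof (rule abelian_groupI)
    fix x assume "x \<in> carrier F"
    then obtain q where "x = e q" by (auto simp: F_def)
    then show "\<exists>y \<in> carrier F. y \<oplus>\<^bsub>F\<^esub> x = \<zero>\<^bsub>F\<^esub>"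
      by (intro bexI[of _ "e (- q)"]) (auto simp: F_def e)
  qed (auto simp: F_def e add_ac)
  moreover have "comm_monoid F"
    by (rule comm_monoidI) (auto simp: F_def e mult_ac)
  ultimately have "cring F"
    by (rule cringI) (auto simp: F_def e distrib_right)
  then have "field F"
  proof (rule cring.cring_fieldI)
    show "Units F = carrier F - {\<zero>\<^bsub>F\<^esub>}"
    proof (intro subset_antisym subsetI)
      fix x assume "x \<in> Units F"
      then show "x \<in> carrier F - {\<zero>\<^bsub>F\<^esub>}"
        using \<open>inj e\<close> by (auto simp: Units_def F_def e inj_eq)
    next
      fix x assume "x \<in> carrier F - {\<zero>\<^bsub>F\<^esub>}"
      then obtain q where q: "x = e q" "q \<noteq> 0" by (auto simp: F_def)
      then show "x \<in> Units F"
        unfolding Units_def by (auto simp: F_def e intro!: exI[of _ "inverse q"])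
    qed
  qed
  then have "ordered_field F"
    unfolding ordered_field_def linear_order_on_def partial_order_on_def preorder_on_def
    by (auto simp: F_def e refl_on_def trans_def antisym_def total_on_def)
  then show ?thesis ..
qed

text \<open>
  The real field \<open>R\<close> of the model is to become a type, so that \<open>model_reals\<close> can be interpreted. A type cannot
  depend on a variable such as \<open>R\<close>. The main result is therefore proved by contradiction: from a
  field for which it fails, a fixed one (\<open>chosen_field\<close>) is obtained by the choice operator of HOL,
  and the carrier of this constant can be made a type. If the result does not fail, the type
  still has to be an ordered field; then the constant may be any ordered field on the type \<open>'a\<close>.

  The choice made here is outside the model. It picks a structure about which to reason and adds
  no sets to the model.
\<close>

definition counterexample :: "'a::ZF ord_ring \<Rightarrow> bool" where
  "counterexample R \<longleftrightarrow> complete_ordered_field R \<and> CMC TYPE('a) \<and>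
    (\<exists>X T Y S \<beta>. topology_on X T \<and> X \<noteq> zempty \<and> Banaschewski X T Y S \<beta> \<and>
       \<not> homeomorphic_tops (max_ideals (U_aleph0 R X T)) (hull_kernel_top (U_aleph0 R X T)) Y S)"

definition chosen_field :: "'a::ZF ord_ring" where
  "chosen_field = (SOME F. ordered_field F \<and> ((\<exists>R :: 'a ord_ring. counterexample R) \<longrightarrow> counterexample F))"

lemma chosen_field: "ordered_field (chosen_field :: 'a::ZF ord_ring)"
  and counterexample_chosen_field: "counterexample (R :: 'a ord_ring) \<Longrightarrow> counterexample (chosen_field :: 'a ord_ring)"
proof -
  have "ordered_field R" if "counterexample R" for R :: "'a ord_ring"
    using that by (simp add: counterexample_def complete_ordered_field_def ordered_field_def)
  then have "\<exists>F :: 'a ord_ring. ordered_field F \<and> ((\<exists>R :: 'a ord_ring. counterexample R) \<longrightarrow> counterexample F)"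
    using ordered_field_exists by blast
  from someI_ex[OF this] show "ordered_field (chosen_field :: 'a ord_ring)"
    "counterexample R \<Longrightarrow> counterexample (chosen_field :: 'a ord_ring)"
    unfolding chosen_field_def by blast+
qed

typedef (overloaded) 'a scalar = "carrier (chosen_field :: 'a::ZF ord_ring)"
proof -
  interpret field "chosen_field :: 'a ord_ring" using chosen_field[where 'a = 'a] by (simp add: ordered_field_def)
  show ?thesis using zero_closed by blast
qed

instantiation scalar :: (ZF) linordered_field
begin

definition "0 = Abs_scalar \<zero>\<^bsub>chosen_field\<^esub>"
definition "1 = Abs_scalar \<one>\<^bsub>chosen_field\<^esub>"
definition "a + b = Abs_scalar (Rep_scalar a \<oplus>\<^bsub>chosen_field\<^esub> Rep_scalar b)"
definition "a * b = Abs_scalar (Rep_scalar a \<otimes>\<^bsub>chosen_field\<^esub> Rep_scalar b)"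
definition "- a = Abs_scalar (\<ominus>\<^bsub>chosen_field\<^esub> Rep_scalar a)"
definition "a - b = a + (- b :: 'a scalar)"
definition "inverse a = (if a = 0 then 0 else Abs_scalar (inv\<^bsub>chosen_field\<^esub> Rep_scalar a))"
definition "a div b = a * (inverse b :: 'a scalar)"
definition "a \<le> b \<longleftrightarrow> leq chosen_field (Rep_scalar a) (Rep_scalar b)"
definition "a < b \<longleftrightarrow> a \<le> b \<and> a \<noteq> (b :: 'a scalar)"
definition "\<bar>a\<bar> = (if a < 0 then - a else a :: 'a scalar)"
definition "sgn a = (if a = 0 then 0 else if 0 < a then 1 else - 1 :: 'a scalar)"

instance
proof -
  interpret F: field "chosen_field :: 'a ord_ring"
    using chosen_field[where 'a = 'a] by (simp add: ordered_field_def)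
  have R [simp]: "Rep_scalar a \<in> carrier chosen_field" for a :: "'a scalar" by (rule Rep_scalar)
  have rep: "Rep_scalar (0 :: 'a scalar) = \<zero>\<^bsub>chosen_field\<^esub>" "Rep_scalar (1 :: 'a scalar) = \<one>\<^bsub>chosen_field\<^esub>"
    "Rep_scalar (a + b) = Rep_scalar a \<oplus>\<^bsub>chosen_field\<^esub> Rep_scalar b"
    "Rep_scalar (a * b) = Rep_scalar a \<otimes>\<^bsub>chosen_field\<^esub> Rep_scalar b"
    "Rep_scalar (- a) = \<ominus>\<^bsub>chosen_field\<^esub> Rep_scalar a" for a b :: "'a scalar"
    by (simp_all add: zero_scalar_def one_scalar_def plus_scalar_def times_scalar_def uminus_scalar_def Abs_scalar_inverse)
  have inv: "inverse a * a = 1" if "a \<noteq> 0" for a :: "'a scalar"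
  proof -
    have "Rep_scalar a \<in> Units chosen_field"
      using that unfolding F.field_Units by (simp flip: rep(1) add: Rep_scalar_inject)
    then have "Rep_scalar (inverse a) = inv\<^bsub>chosen_field\<^esub> Rep_scalar a"
      "inv\<^bsub>chosen_field\<^esub> Rep_scalar a \<otimes>\<^bsub>chosen_field\<^esub> Rep_scalar a = \<one>\<^bsub>chosen_field\<^esub>"
      using that by (simp_all add: inverse_scalar_def Abs_scalar_inverse)
    then show ?thesis by (simp add: rep flip: Rep_scalar_inject)
  qed
  let ?r = "{(x, y). x \<in> carrier (chosen_field :: 'a ord_ring) \<and> y \<in> carrier chosen_field \<and> leq chosen_field x y}"
  have "linear_order_on (carrier (chosen_field :: 'a ord_ring)) ?r"
    using chosen_field[where 'a = 'a] unfolding ordered_field_def by (elim conjE)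
  then have lin: "refl_on (carrier (chosen_field :: 'a ord_ring)) ?r" "trans ?r" "antisym ?r" "total_on (carrier (chosen_field :: 'a ord_ring)) ?r"
    by (simp_all only: linear_order_on_def partial_order_on_def preorder_on_def)
  have refl: "a \<le> a" for a :: "'a scalar"
    using refl_onD[OF lin(1) R[of a]] by (simp add: less_eq_scalar_def)
  have trans: "a \<le> b \<Longrightarrow> b \<le> c \<Longrightarrow> a \<le> c" for a b c :: "'a scalar"
    using transD[OF lin(2), of "Rep_scalar a" "Rep_scalar b" "Rep_scalar c"] by (simp add: less_eq_scalar_def)
  have antisym: "a \<le> b \<Longrightarrow> b \<le> a \<Longrightarrow> a = b" for a b :: "'a scalar"
    using antisymD[OF lin(3), of "Rep_scalar a" "Rep_scalar b"] by (simp add: less_eq_scalar_def Rep_scalar_inject)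
  have total: "a \<le> b \<or> b \<le> a" for a b :: "'a scalar"
    using lin(4) refl[of a] R[of a] R[of b] unfolding total_on_def
    by (cases "a = b") (auto simp: less_eq_scalar_def Rep_scalar_inject)
  have add_mono: "a \<le> b \<Longrightarrow> c + a \<le> c + b" for a b c :: "'a scalar"
    using chosen_field[where 'a = 'a] R unfolding ordered_field_def less_eq_scalar_def rep
    by (simp add: F.a_comm)
  have mult_nonneg: "0 \<le> a \<Longrightarrow> 0 \<le> b \<Longrightarrow> 0 \<le> a * b" for a b :: "'a scalar"
    using chosen_field[where 'a = 'a] R unfolding ordered_field_def less_eq_scalar_def rep by blast
  show "OFCLASS('a scalar, linordered_field_class)"
  proof
    fix a b c :: "'a scalar"
    show "a + b + c = a + (b + c)" "0 + a = a" "- a + a = 0" "a - b = a + - b"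
      "a * b * c = a * (b * c)" "1 * a = a" "(a + b) * c = a * c + b * c"
      by (simp_all add: rep F.a_assoc F.l_neg F.m_assoc F.l_distr minus_scalar_def flip: Rep_scalar_inject)
    show "a + b = b + a" "a * b = b * a"
      by (simp_all add: rep F.a_comm F.m_comm flip: Rep_scalar_inject)
    show "a + b - a = b"
      by (simp add: rep F.a_assoc F.a_lcomm[of "Rep_scalar a" "Rep_scalar b"] F.r_neg minus_scalar_def flip: Rep_scalar_inject)
    show "a - b - c = a - (b + c)" "0 * a = 0" "a * 0 = 0"
      by (simp_all add: rep F.a_assoc F.minus_add minus_scalar_def flip: Rep_scalar_inject)
    show "(0 :: 'a scalar) \<noteq> 1" by (simp add: rep flip: Rep_scalar_inject)
    show "a \<noteq> 0 \<Longrightarrow> inverse a * a = 1" by (rule inv)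
    show "a div b = a * inverse b" by (rule divide_scalar_def)
    show "inverse (0 :: 'a scalar) = 0" by (simp add: inverse_scalar_def)
    show "a < b \<longleftrightarrow> a \<le> b \<and> \<not> b \<le> a" using antisym refl by (auto simp: less_scalar_def)
    show "a \<le> a" by (rule refl)
    show "a \<le> b \<Longrightarrow> b \<le> c \<Longrightarrow> a \<le> c" by (rule trans)
    show "a \<le> b \<Longrightarrow> b \<le> a \<Longrightarrow> a = b" by (rule antisym)
    show "a \<le> b \<or> b \<le> a" by (rule total)
    show "a \<le> b \<Longrightarrow> c + a \<le> c + b" by (rule add_mono)
    show "\<bar>a\<bar> = (if a < 0 then - a else a)" by (rule abs_scalar_def)
    show "sgn a = (if a = 0 then 0 else if 0 < a then 1 else - 1)" by (rule sgn_scalar_def)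
    show "c * a < c * b" if "a < b" "0 < c"
    proof -
      have eq: "x = y" if "Rep_scalar x = Rep_scalar y" for x y :: "'a scalar"
        using that by (simp add: Rep_scalar_inject)
      have "0 \<le> b - a"
      proof -
        have "- a + a \<le> - a + b" using add_mono that(1) by (simp add: less_scalar_def)
        moreover have "- a + a = 0" by (rule eq) (simp add: rep F.l_neg)
        moreover have "- a + b = b - a" by (rule eq) (simp add: rep minus_scalar_def F.a_comm)
        ultimately show ?thesis by simp
      qed
      then have "0 \<le> c * (b - a)" using mult_nonneg that(2) by (simp add: less_scalar_def)
      then have "c * a + 0 \<le> c * a + c * (b - a)" by (rule add_mono)
      moreover have "c * a + 0 = c * a" by (rule eq) (simp add: rep)
      moreover have "c * a + c * (b - a) = c * b"
        by (rule eq) (simp add: rep minus_scalar_def F.r_distr F.r_minus F.r_neg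
            F.a_lcomm[of "Rep_scalar c \<otimes>\<^bsub>chosen_field\<^esub> Rep_scalar a" "Rep_scalar c \<otimes>\<^bsub>chosen_field\<^esub> Rep_scalar b"])
      ultimately have le: "c * a \<le> c * b" by simp
      have "c * a \<noteq> c * b"
      proof
        assume "c * a = c * b"
        then have "Rep_scalar c \<otimes>\<^bsub>chosen_field\<^esub> Rep_scalar a = Rep_scalar c \<otimes>\<^bsub>chosen_field\<^esub> Rep_scalar b"
          by (simp flip: rep)
        moreover have "Rep_scalar c \<noteq> \<zero>\<^bsub>chosen_field\<^esub>"
          using that(2) by (auto simp: less_scalar_def Rep_scalar_inject simp flip: rep(1))
        ultimately have "Rep_scalar a = Rep_scalar b" using F.m_lcancel by simp
        then show False using that(1) by (simp add: less_scalar_def Rep_scalar_inject)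
      qed
      then show ?thesis using le by (simp add: less_scalar_def)
    qed
  qed
qed

end

theorem theorem2p22:
  fixes X T \<beta>X T\<beta> \<beta> :: "'a::ZF" and R :: "'a ord_ring"
  assumes "complete_ordered_field R"
    and "topology_on X T" and "X \<noteq> zempty" and "zero_dim X T" and "T1 X T"
    and "Banaschewski X T \<beta>X T\<beta> \<beta>"
  shows "CMC TYPE('a) \<longrightarrow>
    homeomorphic_tops (max_ideals (U_aleph0 R X T)) (hull_kernel_top (U_aleph0 R X T)) \<beta>X T\<beta>"
proof (intro impI, rule ccontr)
  assume cmc: "CMC TYPE('a)" and
    "\<not> homeomorphic_tops (max_ideals (U_aleph0 R X T)) (hull_kernel_top (U_aleph0 R X T)) \<beta>X T\<beta>"
  then have "counterexample R" using assms unfolding counterexample_def by blast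
  then have "counterexample (chosen_field :: 'a ord_ring)" by (rule counterexample_chosen_field)
  then obtain X T Y S \<beta> :: 'a where F: "complete_ordered_field (chosen_field :: 'a ord_ring)"
    and XT: "topology_on X T" "X \<noteq> zempty" "Banaschewski X T Y S \<beta>"
    and no: "\<not> homeomorphic_tops (max_ideals (U_aleph0 chosen_field X T)) (hull_kernel_top (U_aleph0 chosen_field X T)) Y S"
    unfolding counterexample_def by blast
  interpret banaschewski_space chosen_field Abs_scalar Rep_scalar X T Y S \<beta>
  proof
    show "complete_ordered_field (chosen_field :: 'a ord_ring)" by (rule F)
    fix x y :: 'a
    assume "x \<in> carrier chosen_field" "y \<in> carrier chosen_field"
    then show "Abs_scalar (x \<oplus>\<^bsub>chosen_field\<^esub> y) = Abs_scalar x + Abs_scalar y"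
      "Abs_scalar (x \<otimes>\<^bsub>chosen_field\<^esub> y) = Abs_scalar x * Abs_scalar y"
      "leq chosen_field x y = (Abs_scalar x \<le> Abs_scalar y)"
      by (simp_all add: plus_scalar_def times_scalar_def less_eq_scalar_def Abs_scalar_inverse)
  qed (use XT cmc in \<open>auto simp: Rep_scalar Rep_scalar_inverse Abs_scalar_inverse zero_scalar_def one_scalar_def\<close>)
  show False using homeomorphic no by blast
qed

end
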